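(* There is a randomized algorithm that, given a directed graph $G=(V,E)$ with $n$ vertices, $m$ edges and nonnegative integer edge weights, a set $S\subseteq V$, and any $\tau$ with $0<\tau<1$, runs in $\tilde{O}(m/\tau)$ time and outputs for all $v\in S$ an estimate $\varepsilon'(v)$ such that, with high probability, $\frac{1-\tau}{2}\varepsilon_S(v)\leq\varepsilon'(v)\leq\varepsilon_S(v)$ for all $v\in S$.
   Context: $d(u,v)$ denotes the length of a shortest directed path from $u$ to $v$. For $v\in S$, the Subset Eccentricity is $\varepsilon_S(v)=\max_{u\in S}d(v,u)$. "With high probability" means with probability at least $1-1/n^c$ for every constant $c$. $\tilde{O}$ hides polylogarithmic factors.
   Formalization: The running time is proved as Õ((n+m)/τ) instead of Õ(m/τ); the two agree when m is at least of order n, and for much smaller m the literal bound fails because an estimate must be output for every v in S (e.g. m=1, S=V). *)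

theory Defs
  imports "HOL-Probability.Probability" "Graph_Theory.Pair_Digraph" "Graph_Theory.Shortest_Path"
begin

section \<open>Subset eccentricities\<close>

text \<open>
  Digraphs are \<^typ>\<open>nat pair_pre_digraph\<close> (no parallel arcs, loops allowed). Distances are the
  library's \<^const>\<open>wf_digraph.\<mu>\<close>, with values in \<^typ>\<open>ereal\<close>: the distance is \<open>\<infinity>\<close> if there is no
  directed path.
\<close>

type_synonym weights = "nat \<times> nat \<Rightarrow> nat"

definition dist_G :: "nat pair_pre_digraph \<Rightarrow> weights \<Rightarrow> nat \<Rightarrow> nat \<Rightarrow> ereal" where
  "dist_G G wt u v = wf_digraph.\<mu> (with_proj G) (\<lambda>e. real (wt e)) u v"

definition subset_ecc :: "nat pair_pre_digraph \<Rightarrow> weights \<Rightarrow> nat set \<Rightarrow> nat \<Rightarrow> ereal" where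
  "subset_ecc G wt S v = Max ((\<lambda>u. dist_G G wt v u) ` S)"


section \<open>A randomized word RAM\<close>

text \<open>
  Programs are structured programs over finitely many registers and finitely many arrays, both
  named by numerals occurring in the program text; arrays are indexed by computed values. All
  computed values are words of \<open>w\<close> bits: results are reduced modulo \<open>2 ^ w\<close>, except that
  subtraction is cut off at 0 (and, as in HOL, \<open>x div 0 = 0\<close> and \<open>x mod 0 = x\<close>).

  The real input parameter \<open>\<tau>\<close> cannot be stored in a word. A program accesses it only by comparing
  it with quotients of words: \<open>ParamLe a b\<close> tests whether \<open>a \<le> \<tau> * b\<close>.
\<close>

datatype binop = Plus | Minus | Times | Div | Mod | Less | Equal

datatype expr =
    Const nat
  | Reg nat
  | Elem nat expr
  | Op binop expr expr
  | ParamLe expr expr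

datatype com =
    Skip
  | Assign nat expr
  | Store nat expr expr
  | Rand nat expr
  | Seq com com
  | If expr com com
  | While expr com

record store =
  regs :: "nat \<Rightarrow> nat"
  arrs :: "nat \<Rightarrow> nat \<Rightarrow> nat"

fun eval_op :: "binop \<Rightarrow> nat \<Rightarrow> nat \<Rightarrow> nat" where
  "eval_op Plus x y = x + y"
| "eval_op Minus x y = x - y"
| "eval_op Times x y = x * y"
| "eval_op Div x y = x div y"
| "eval_op Mod x y = x mod y"
| "eval_op Less x y = (if x < y then 1 else 0)"
| "eval_op Equal x y = (if x = y then 1 else 0)"

fun eval :: "nat \<Rightarrow> real \<Rightarrow> store \<Rightarrow> expr \<Rightarrow> nat" where
  "eval w \<tau> s (Const k) = k mod 2 ^ w"
| "eval w \<tau> s (Reg r) = regs s r"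
| "eval w \<tau> s (Elem a e) = arrs s a (eval w \<tau> s e)"
| "eval w \<tau> s (Op f e1 e2) = eval_op f (eval w \<tau> s e1) (eval w \<tau> s e2) mod 2 ^ w"
| "eval w \<tau> s (ParamLe e1 e2) =
     (if real (eval w \<tau> s e1) \<le> \<tau> * real (eval w \<tau> s e2) then 1 else 0) mod 2 ^ w"

definition set_reg :: "nat \<Rightarrow> nat \<Rightarrow> store \<Rightarrow> store" where
  "set_reg r x s = s\<lparr>regs := (regs s)(r := x)\<rparr>"

definition set_elem :: "nat \<Rightarrow> nat \<Rightarrow> nat \<Rightarrow> store \<Rightarrow> store" where
  "set_elem a i x s = s\<lparr>arrs := (arrs s)(a := (arrs s a)(i := x))\<rparr>"

text \<open>
  One step of a program, as a probability distribution on the next configurations. A configuration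
  with \<^const>\<open>Skip\<close> is final. \<open>Rand r e\<close> draws a uniformly distributed number below the value of
  \<open>e\<close>, with fresh randomness. A step evaluates at most two expressions from the program text, so it
  takes time bounded by a constant that depends only on the program.
\<close>

fun step :: "nat \<Rightarrow> real \<Rightarrow> com \<Rightarrow> store \<Rightarrow> (com \<times> store) pmf" where
  "step w \<tau> Skip s = return_pmf (Skip, s)"
| "step w \<tau> (Assign r e) s = return_pmf (Skip, set_reg r (eval w \<tau> s e) s)"
| "step w \<tau> (Store a i e) s = return_pmf (Skip, set_elem a (eval w \<tau> s i) (eval w \<tau> s e) s)"
| "step w \<tau> (Rand r e) s =
     (let k = eval w \<tau> s e in
      if k = 0 then return_pmf (Skip, set_reg r 0 s)
      else map_pmf (\<lambda>x. (Skip, set_reg r x s)) (pmf_of_set {..<k}))"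
| "step w \<tau> (Seq c1 c2) s =
     (if c1 = Skip then return_pmf (c2, s)
      else map_pmf (\<lambda>(c1', s'). (Seq c1' c2, s')) (step w \<tau> c1 s))"
| "step w \<tau> (If e c1 c2) s = return_pmf (if eval w \<tau> s e \<noteq> 0 then c1 else c2, s)"
| "step w \<tau> (While e c) s =
     return_pmf (if eval w \<tau> s e \<noteq> 0 then Seq c (While e c) else Skip, s)"

fun run :: "nat \<Rightarrow> real \<Rightarrow> nat \<Rightarrow> com \<Rightarrow> store \<Rightarrow> (com \<times> store) pmf" where
  "run w \<tau> 0 c s = return_pmf (c, s)"
| "run w \<tau> (Suc t) c s = bind_pmf (step w \<tau> c s) (\<lambda>(c', s'). run w \<tau> t c' s')"

text \<open>Halting holds for every outcome of the random choices, not merely with probability close to 1.\<close>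

definition halts_within :: "nat \<Rightarrow> real \<Rightarrow> nat \<Rightarrow> com \<Rightarrow> store \<Rightarrow> bool" where
  "halts_within w \<tau> t c s \<longleftrightarrow> (\<forall>(c', s') \<in> set_pmf (run w \<tau> t c s). c' = Skip)"


section \<open>Input and output of the algorithm\<close>

text \<open>
  The vertices are the numbers below \<open>n\<close>. Registers 0 and 1 contain \<open>n\<close> and \<open>m\<close>. The arcs are given
  as a list in arbitrary order: arrays 0, 1, 2 contain tails, heads and weights. Array 3 is the
  characteristic function of \<open>S\<close>. Everything else is 0.
\<close>

definition input_store :: "nat \<Rightarrow> (nat \<times> nat) list \<Rightarrow> weights \<Rightarrow> nat set \<Rightarrow> store" where
  "input_store n es wt S =
     \<lparr>regs = (\<lambda>_. 0)(0 := n, 1 := length es),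
      arrs = (\<lambda>_ _. 0)
        (0 := \<lambda>i. if i < length es then fst (es ! i) else 0,
         1 := \<lambda>i. if i < length es then snd (es ! i) else 0,
         2 := \<lambda>i. if i < length es then wt (es ! i) else 0,
         3 := \<lambda>v. if v \<in> S then 1 else 0)\<rparr>"

text \<open>The estimate for \<open>v\<close> is in array 4, unless array 5 flags it as infinite.\<close>

definition estimate :: "store \<Rightarrow> nat \<Rightarrow> ereal" where
  "estimate s v = (if arrs s 5 v \<noteq> 0 then \<infinity> else ereal (real (arrs s 4 v)))"

definition max_weight :: "nat pair_pre_digraph \<Rightarrow> weights \<Rightarrow> nat" where
  "max_weight G wt = Max (insert 0 (wt ` parcs G))"

text \<open>
  Words of \<open>w\<close> bits with \<open>w\<close> at least \<open>b\<close> times the logarithm of \<open>n + max_weight + 2\<close>. Such words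
  can hold the vertices, the weights and (for \<open>b \<ge> 2\<close>) the finite distances.
\<close>

definition word_size_ok :: "nat \<Rightarrow> nat \<Rightarrow> nat pair_pre_digraph \<Rightarrow> weights \<Rightarrow> bool" where
  "word_size_ok b w G wt \<longleftrightarrow> (card (pverts G) + max_weight G wt + 2) ^ b \<le> 2 ^ w"

definition approximates :: "real \<Rightarrow> nat pair_pre_digraph \<Rightarrow> weights \<Rightarrow> nat set \<Rightarrow> store \<Rightarrow> bool" where
  "approximates \<tau> G wt S s \<longleftrightarrow>
     (\<forall>v\<in>S. ereal ((1 - \<tau>) / 2) * subset_ecc G wt S v \<le> estimate s v \<and>
             estimate s v \<le> subset_ecc G wt S v)"

end

theory Submission
  imports Defs
begin

text \<open>
  The algorithm computes a 2-approximation, so \<open>\<tau>\<close> plays no role. It maintains a set \<open>U \<subseteq> S\<close> of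
  vertices without a good estimate, initially \<open>S\<close>, and estimates \<open>\<epsilon>\<^sub>S(v)\<close> by the largest
  distance from \<open>v\<close> to a vertex of \<open>S\<close> seen so far. A phase draws \<open>O(log n)\<close> samples \<open>A\<close> from \<open>U\<close>
  and finds the vertex \<open>x \<in> S\<close> with the largest distance \<open>R\<close> from \<open>A\<close>. Since every vertex of \<open>S\<close>
  has distance at most \<open>R\<close> from \<open>A\<close>, the eccentricity of \<open>v\<close> is at most \<open>R\<close> plus the largest
  distance from \<open>v\<close> to a sample; hence the estimate is good for every \<open>v\<close> with \<open>d(v, x) \<ge> R\<close>,
  and these leave \<open>U\<close>. With high probability \<open>A\<close> meets the half of \<open>U\<close> that is closest to \<open>y\<close>, for
  every \<open>y \<in> S\<close>, and then at least half of \<open>U\<close> has distance at least \<open>R\<close> to \<open>x\<close>. So \<open>U\<close> is empty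
  after \<open>O(log n)\<close> phases. The number of phases does not depend on the weights, and infinite
  distances need no special treatment if \<open>\<infinity>\<close> is encoded by a number above all finite distances.

  The probability of failure is bounded by a potential whose expected value does not increase: the
  number of \<open>y\<close> whose closest half has not been met, times \<open>2 ^ (- k)\<close> with \<open>k\<close> draws to come.
\<close>

section \<open>A program logic with running times and expected potentials\<close>

text \<open>The vertex \<open>x\<close> depends on the draws, so hitting its closest half cannot be
  analysed for \<open>x\<close> alone; demanding it for every \<open>y\<close> in \<open>S\<close>
  is a union bound that costs a factor of at most \<open>n\<close>. One draw misses the closest half
  of a fixed \<open>y\<close> with probability at most 1/2, so \<open>kc * l\<close> draws with
  \<open>2 ^ l > n\<close> all miss it with probability at most \<open>n ^ (- kc)\<close>. Over all
  \<open>y\<close> and at most \<open>l \<le> n\<close> phases this adds up to at most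
  \<open>n ^ (2 - kc)\<close>, hence the choice \<open>kc \<ge> c + 2\<close>. Every run has to halt
  in time, so the phases are capped at \<open>l\<close>, and an unlucky run may end with a nonempty
  \<open>U\<close>. Chance endangers only the lower bound at vertices still in \<open>U\<close>: an
  estimate is 0 or an actual distance to a vertex of \<open>S\<close>, so it never exceeds the
  eccentricity, and a vertex leaves \<open>U\<close> only when its estimate is certified. The
  samples themselves are not stored; whether the closest half of \<open>y\<close> has been hit can
  be read off the distance from \<open>A\<close> to \<open>y\<close>, which makes failure a property
  of the store.\<close>

primrec written_regs :: "com \<Rightarrow> nat set" where
  "written_regs Skip = {}"
| "written_regs (Assign r e) = {r}"
| "written_regs (Store a i e) = {}"
| "written_regs (Rand r e) = {r}"
| "written_regs (Seq c1 c2) = written_regs c1 \<union> written_regs c2"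
| "written_regs (If e c1 c2) = written_regs c1 \<union> written_regs c2"
| "written_regs (While e c) = written_regs c"

primrec written_arrs :: "com \<Rightarrow> nat set" where
  "written_arrs Skip = {}"
| "written_arrs (Assign r e) = {}"
| "written_arrs (Store a i e) = {a}"
| "written_arrs (Rand r e) = {}"
| "written_arrs (Seq c1 c2) = written_arrs c1 \<union> written_arrs c2"
| "written_arrs (If e c1 c2) = written_arrs c1 \<union> written_arrs c2"
| "written_arrs (While e c) = written_arrs c"

definition unchanged :: "nat set \<Rightarrow> nat set \<Rightarrow> store \<Rightarrow> store \<Rightarrow> bool" where
  "unchanged R A s s' \<longleftrightarrow> (\<forall>r. r \<notin> R \<longrightarrow> regs s' r = regs s r) \<and> (\<forall>a. a \<notin> A \<longrightarrow> arrs s' a = arrs s a)"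

lemma unchanged_refl [simp]: "unchanged R A s s"
  by (simp add: unchanged_def)

lemma unchanged_trans: "unchanged R A s s' \<Longrightarrow> unchanged R A s' s'' \<Longrightarrow> unchanged R A s s''"
  by (simp add: unchanged_def)

lemma unchanged_mono:
  "unchanged R A s s' \<Longrightarrow> R \<subseteq> R' \<Longrightarrow> A \<subseteq> A' \<Longrightarrow> unchanged R' A' s s'"
  by (auto simp: unchanged_def)

lemma regs_set_reg [simp]: "regs (set_reg r x s) = (regs s)(r := x)"
  and arrs_set_reg [simp]: "arrs (set_reg r x s) = arrs s"
  and regs_set_elem [simp]: "regs (set_elem a i x s) = regs s"
  and arrs_set_elem [simp]: "arrs (set_elem a i x s) = (arrs s)(a := (arrs s a)(i := x))"
  by (simp_all add: set_reg_def set_elem_def)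

lemma step_writes:
  assumes "(c', s') \<in> set_pmf (step w \<tau> c s)"
  shows "written_regs c' \<subseteq> written_regs c \<and> written_arrs c' \<subseteq> written_arrs c \<and>
    unchanged (written_regs c) (written_arrs c) s s'"
  using assms
proof (induction c arbitrary: c' s')
  case (Rand r e)
  then show ?case
    by (auto simp: Let_def unchanged_def split: if_splits)
next
  case (Seq c1 c2)
  show ?case
  proof (cases "c1 = Skip")
    case True
    with Seq show ?thesis by (auto simp: unchanged_def)
  next
    case False
    with Seq.prems obtain c1' where
      "(c1', s') \<in> set_pmf (step w \<tau> c1 s)" "c' = Seq c1' c2"
      by auto
    with Seq.IH(1) show ?thesis by (fastforce simp: unchanged_def)
  qed
qed (auto simp: unchanged_def)

lemma run_writes:
  assumes "(c', s') \<in> set_pmf (run w \<tau> t c s)"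
  shows "unchanged (written_regs c) (written_arrs c) s s'"
  using assms
proof (induction t arbitrary: c s)
  case (Suc t)
  then obtain c1 s1 where "(c1, s1) \<in> set_pmf (step w \<tau> c s)"
    and "(c', s') \<in> set_pmf (run w \<tau> t c1 s1)"
    by auto
  with Suc.IH step_writes show ?case
    by (meson unchanged_mono unchanged_trans)
qed simp

lemma run_Skip: "run w \<tau> t Skip s = return_pmf (Skip, s)"
  by (induction t) (simp_all add: bind_return_pmf)

lemma run_add:
  "run w \<tau> (t1 + t2) c s = bind_pmf (run w \<tau> t1 c s) (\<lambda>(c', s'). run w \<tau> t2 c' s')"
  by (induction t1 arbitrary: c s)
    (simp_all add: bind_return_pmf bind_assoc_pmf case_prod_unfold)

text \<open>A finished run idles in \<open>Skip\<close>. So times are upper bounds: outcomes may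
  halt at different moments, and every rule may round its time up.\<close>

lemma run_extend:
  assumes "halts_within w \<tau> t1 c s" "t1 \<le> t2"
  shows "run w \<tau> t2 c s = run w \<tau> t1 c s"
proof -
  have "run w \<tau> t2 c s = bind_pmf (run w \<tau> t1 c s) (\<lambda>(c', s'). run w \<tau> (t2 - t1) c' s')"
    using run_add[of w \<tau> t1 "t2 - t1" c s] assms(2) by simp
  also have "\<dots> = bind_pmf (run w \<tau> t1 c s) return_pmf"
    using assms(1) by (intro bind_pmf_cong) (auto simp: halts_within_def run_Skip)
  finally show ?thesis by (simp add: bind_return_pmf')
qed

section \<open>Rules for single commands, sequences and loops\<close>

locale ram =
  fixes w :: nat and \<tau> :: real
begin

abbreviation "evl \<equiv> eval w \<tau>"

text \<open>
  The potential \<open>F\<close> is evaluated in the final store. Bounding the expected value of a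
  \<open>{0, 1}\<close>-valued potential bounds the probability of failure; more general potentials are what a
  loop invariant needs.
\<close>

definition ensures ::
  "nat \<Rightarrow> com \<Rightarrow> (store \<Rightarrow> bool) \<Rightarrow> (store \<Rightarrow> ennreal) \<Rightarrow> store \<Rightarrow> ennreal \<Rightarrow> bool" where
  "ensures t c Q F s B \<longleftrightarrow>
     (\<forall>(c', s') \<in> set_pmf (run w \<tau> t c s). c' = Skip \<and> Q s') \<and>
     (\<integral>\<^sup>+x. F (snd x) \<partial>measure_pmf (run w \<tau> t c s)) \<le> B"

abbreviation always :: "nat \<Rightarrow> com \<Rightarrow> (store \<Rightarrow> bool) \<Rightarrow> store \<Rightarrow> bool" where
  "always t c Q s \<equiv> ensures t c Q (\<lambda>_. 0) s 0"

lemma ensures_halts: "ensures t c Q F s B \<Longrightarrow> halts_within w \<tau> t c s"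
  by (auto simp: ensures_def halts_within_def)

lemma ensures_time:
  assumes "ensures t c Q F s B" "t \<le> t'"
  shows "ensures t' c Q F s B"
  using assms run_extend[OF ensures_halts[OF assms(1)] assms(2)] by (simp add: ensures_def)

lemma nn_integral_pmf_mono:
  "(\<And>x. x \<in> set_pmf p \<Longrightarrow> f x \<le> g x) \<Longrightarrow>
    (\<integral>\<^sup>+x. f x \<partial>measure_pmf p) \<le> (\<integral>\<^sup>+x. g x \<partial>measure_pmf p)"
  by (intro nn_integral_mono_AE) (simp add: AE_measure_pmf_iff)

lemma ensures_weaken:
  assumes "ensures t c Q F s B" "t \<le> t'" "\<And>s'. Q s' \<Longrightarrow> Q' s'" "\<And>s'. Q s' \<Longrightarrow> F' s' \<le> F s'" "B \<le> B'"
  shows "ensures t' c Q' F' s B'"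
proof -
  have *: "ensures t' c Q F s B" using assms(1,2) by (rule ensures_time)
  have "(\<integral>\<^sup>+x. F' (snd x) \<partial>measure_pmf (run w \<tau> t' c s)) \<le>
      (\<integral>\<^sup>+x. F (snd x) \<partial>measure_pmf (run w \<tau> t' c s))"
    using * assms(4) by (intro nn_integral_pmf_mono) (auto simp: ensures_def)
  with * assms(3,5) show ?thesis
    by (auto simp: ensures_def)
qed

lemma always_weaken:
  "always t c Q s \<Longrightarrow> (\<And>s'. Q s' \<Longrightarrow> Q' s') \<Longrightarrow> t \<le> t' \<Longrightarrow> always t' c Q' s"
  by (erule ensures_weaken) auto

lemma ensures_of_always:
  assumes "always t c Q s" "\<And>s'. Q s' \<Longrightarrow> F s' \<le> B"
  shows "ensures t c Q F s B"
proof -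
  have "(\<integral>\<^sup>+x. F (snd x) \<partial>measure_pmf (run w \<tau> t c s)) \<le>
      (\<integral>\<^sup>+x. B \<partial>measure_pmf (run w \<tau> t c s))"
    using assms by (intro nn_integral_pmf_mono) (auto simp: ensures_def)
  with assms(1) show ?thesis by (auto simp: ensures_def)
qed

lemma ensures_frame:
  assumes "ensures t c Q F s B"
  shows "ensures t c (\<lambda>s'. Q s' \<and> unchanged (written_regs c) (written_arrs c) s s') F s B"
  using assms run_writes by (fastforce simp: ensures_def)

lemma ensures_Skip: "Q s \<Longrightarrow> F s \<le> B \<Longrightarrow> ensures 0 Skip Q F s B"
  by (simp add: ensures_def)

lemma ensures_Assign:
  "Q (set_reg r (evl s e) s) \<Longrightarrow> F (set_reg r (evl s e) s) \<le> B \<Longrightarrow>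
    ensures 1 (Assign r e) Q F s B"
  by (simp add: ensures_def bind_return_pmf)

lemma ensures_Store:
  "Q (set_elem a (evl s i) (evl s e) s) \<Longrightarrow> F (set_elem a (evl s i) (evl s e) s) \<le> B \<Longrightarrow>
    ensures 1 (Store a i e) Q F s B"
  by (simp add: ensures_def bind_return_pmf)

lemma ensures_Rand:
  assumes "evl s e = k" "k > 0" "\<And>x. x < k \<Longrightarrow> Q (set_reg r x s)"
    "(\<Sum>x<k. F (set_reg r x s)) / of_nat k \<le> B"
  shows "ensures 1 (Rand r e) Q F s B"
proof -
  have ne: "{..<k} \<noteq> {}" using assms(2) by auto
  have "run w \<tau> 1 (Rand r e) s = map_pmf (\<lambda>x. (Skip, set_reg r x s)) (pmf_of_set {..<k})"
    using assms(1,2) by (simp add: map_pmf_def bind_assoc_pmf bind_return_pmf)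
  with assms ne show ?thesis
    by (auto simp: ensures_def nn_integral_pmf_of_set)
qed

text \<open>The law of total expectation for one step: \<open>G\<close> gives each successor
  configuration its own bound, and only the average of \<open>G\<close> has to stay below
  \<open>B\<close>.\<close>

lemma ensures_step:
  assumes "\<And>c' s'. (c', s') \<in> set_pmf (step w \<tau> c s) \<Longrightarrow> ensures t c' Q F s' (G (c', s'))"
    and "(\<integral>\<^sup>+x. G x \<partial>measure_pmf (step w \<tau> c s)) \<le> B"
  shows "ensures (Suc t) c Q F s B"
proof -
  have "(\<integral>\<^sup>+x. F (snd x) \<partial>measure_pmf (run w \<tau> (Suc t) c s)) =
      (\<integral>\<^sup>+y. \<integral>\<^sup>+x. F (snd x) \<partial>measure_pmf (run w \<tau> t (fst y) (snd y)) \<partial>measure_pmf (step w \<tau> c s))"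
    by (simp add: case_prod_unfold)
  also have "\<dots> \<le> (\<integral>\<^sup>+x. G x \<partial>measure_pmf (step w \<tau> c s))"
    using assms(1) by (intro nn_integral_pmf_mono) (auto simp: ensures_def)
  finally show ?thesis using assms by (fastforce simp: ensures_def)
qed

text \<open>\<open>c1\<close> may halt at different times on different outcomes, so
  \<open>c2\<close> starts at no fixed time; the induction therefore follows the single steps of
  \<open>c1\<close>. \<open>G\<close> is an intermediate potential: its value in the store left by
  \<open>c1\<close> is the bound allotted to \<open>c2\<close>.\<close>

lemma ensures_Seq:
  assumes "ensures t1 c1 P G s B" "\<And>s'. P s' \<Longrightarrow> ensures t2 c2 Q F s' (G s')"
  shows "ensures (Suc (t1 + t2)) (Seq c1 c2) Q F s B"
  using assms(1)
proof (induction t1 arbitrary: c1 s B)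
  case 0
  then have "c1 = Skip" "P s" "G s \<le> B" by (auto simp: ensures_def)
  with assms(2)[of s] show ?case
    by (auto simp: bind_return_pmf ensures_def)
next
  case (Suc t1)
  show ?case
  proof (cases "c1 = Skip")
    case True
    with Suc.prems have "P s" "G s \<le> B" by (auto simp: ensures_def run_Skip simp del: run.simps)
    with assms(2)[of s] have "ensures t2 c2 Q F s B" by (auto simp: ensures_def)
    with ensures_time have "ensures (Suc t1 + t2) c2 Q F s B" by force
    with True show ?thesis by (simp add: ensures_def bind_return_pmf)
  next
    case False
    define K where "K = (\<lambda>(c', s'). \<integral>\<^sup>+x. G (snd x) \<partial>measure_pmf (run w \<tau> t1 c' s'))"
    have st: "step w \<tau> (Seq c1 c2) s = map_pmf (\<lambda>(c', s'). (Seq c' c2, s')) (step w \<tau> c1 s)"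
      using False by simp
    \<comment> \<open>\<open>H\<close> carries \<open>K\<close> over to configurations of the
      sequence. All successors have the form \<open>Seq d c2\<close>, so the default 0 is never
      reached.\<close>
    define H where "H = (\<lambda>(c', s'). case c' of Seq c'' _ \<Rightarrow> K (c'', s') | _ \<Rightarrow> 0)"
    have "ensures (Suc (Suc t1 + t2)) (Seq c1 c2) Q F s B"
    proof (rule ensures_step[where G = H])
      fix c' s' assume "(c', s') \<in> set_pmf (step w \<tau> (Seq c1 c2) s)"
      then obtain d where d: "(d, s') \<in> set_pmf (step w \<tau> c1 s)" "c' = Seq d c2"
        by (auto simp: st simp del: step.simps)
      with Suc.prems have "ensures t1 d P G s' (K (d, s'))"
        by (auto simp: ensures_def K_def)
      from Suc.IH[OF this] d show "ensures (Suc t1 + t2) c' Q F s' (H (c', s'))"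
        by (simp add: H_def)
    next
      have "(\<integral>\<^sup>+x. H x \<partial>measure_pmf (step w \<tau> (Seq c1 c2) s)) =
          (\<integral>\<^sup>+x. K x \<partial>measure_pmf (step w \<tau> c1 s))"
        unfolding st by (simp add: H_def case_prod_unfold)
      also have "\<dots> \<le> B"
        using Suc.prems by (simp add: ensures_def K_def case_prod_unfold)
      finally show "(\<integral>\<^sup>+x. H x \<partial>measure_pmf (step w \<tau> (Seq c1 c2) s)) \<le> B" .
    qed
    then show ?thesis by simp
  qed
qed

lemma ensures_If:
  assumes "evl s e \<noteq> 0 \<Longrightarrow> ensures t c1 Q F s B" "evl s e = 0 \<Longrightarrow> ensures t c2 Q F s B"
  shows "ensures (Suc t) (If e c1 c2) Q F s B"
  using assms by (cases "evl s e = 0") (simp_all add: ensures_def bind_return_pmf)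

text \<open>
  The bound \<open>T\<close> on the remaining running time is a function of the store, so that the costs of the
  iterations can be amortized. The frame is built into the rule: the invariant need not mention
  what the body does not write.
\<close>

lemma ensures_While:
  assumes "I s"
  assumes body: "\<And>s'. I s' \<Longrightarrow> evl s' e \<noteq> 0 \<Longrightarrow> unchanged (written_regs c) (written_arrs c) s s' \<Longrightarrow>
    \<exists>t. ensures t c (\<lambda>s''. I s'' \<and> T s'' + t + 2 \<le> T s') F s' (F s')"
  shows "ensures (Suc (T s)) (While e c) (\<lambda>s'. I s' \<and> evl s' e = 0) F s (F s)"
proof -
  have "ensures (Suc (T s')) (While e c) (\<lambda>s'. I s' \<and> evl s' e = 0) F s' (F s')"
    if "I s'" "unchanged (written_regs c) (written_arrs c) s s'" for s'
    using that
  proof (induction "T s'" arbitrary: s' rule: less_induct)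
    case less
    show ?case
    proof (cases "evl s' e = 0")
      case True
      with less.prems have "ensures (T s') Skip (\<lambda>s'. I s' \<and> evl s' e = 0) F s' (F s')"
        by (auto simp: ensures_def run_Skip)
      with True show ?thesis by (simp add: ensures_def bind_return_pmf)
    next
      case False
      then obtain t where
        t: "ensures t c (\<lambda>s''. I s'' \<and> T s'' + t + 2 \<le> T s') F s' (F s')"
        using body less.prems by blast
      \<comment> \<open>The decrease of \<open>T\<close> is part of the postcondition, hence known
        only at outcomes; a run has at least one outcome, and this yields
        \<open>t + 2 \<le> T s'\<close>.\<close>
      obtain s1 where "T s1 + t + 2 \<le> T s'"
        using t set_pmf_not_empty[of "run w \<tau> t c s'"] unfolding ensures_def by fast
      then have le: "t + 2 \<le> T s'" by simp
      have "ensures (Suc (t + (T s' - t - 1))) (Seq c (While e c)) (\<lambda>s'. I s' \<and> evl s' e = 0) F s' (F s')"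
      proof (rule ensures_Seq[OF ensures_frame[OF t]])
        fix s'' assume s'': "(I s'' \<and> T s'' + t + 2 \<le> T s') \<and> unchanged (written_regs c) (written_arrs c) s' s''"
        then have "ensures (Suc (T s'')) (While e c) (\<lambda>s'. I s' \<and> evl s' e = 0) F s'' (F s'')"
          using less.prems unchanged_trans by (intro less.hyps) auto
        then show "ensures (T s' - t - 1) (While e c) (\<lambda>s'. I s' \<and> evl s' e = 0) F s'' (F s'')"
          using s'' by (elim ensures_time) auto
      qed
      then have "ensures (T s') (Seq c (While e c)) (\<lambda>s'. I s' \<and> evl s' e = 0) F s' (F s')"
        using le by simp
      with False show ?thesis by (simp add: ensures_def bind_return_pmf)
    qed
  qed
  from this[OF assms(1) unchanged_refl] show ?thesis .
qed

end

section \<open>Counting loops and straight-line code\<close>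

primrec straight :: "com \<Rightarrow> bool" where
  "straight Skip = True"
| "straight (Assign r e) = True"
| "straight (Store a i e) = True"
| "straight (Rand r e) = False"
| "straight (Seq c1 c2) = (straight c1 \<and> straight c2)"
| "straight (If e c1 c2) = (straight c1 \<and> straight c2)"
| "straight (While e c) = False"

primrec cost :: "com \<Rightarrow> nat" where
  "cost Skip = 0"
| "cost (Assign r e) = 1"
| "cost (Store a i e) = 1"
| "cost (Rand r e) = 1"
| "cost (Seq c1 c2) = Suc (cost c1 + cost c2)"
| "cost (If e c1 c2) = Suc (max (cost c1) (cost c2))"
| "cost (While e c) = 0"

notation Seq (infixr ";;" 60)

definition For :: "nat \<Rightarrow> nat \<Rightarrow> com \<Rightarrow> com" where
  "For r q c = Seq (Assign r (Const 0))
     (While (Op Less (Reg r) (Reg q)) (Seq c (Assign r (Op Plus (Reg r) (Const 1)))))"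

lemma written_For [simp]:
  "written_regs (For r q c) = insert r (written_regs c)"
  "written_arrs (For r q c) = written_arrs c"
  by (auto simp: For_def)

context ram
begin

text \<open>\<open>I\<close> and \<open>F\<close> are indexed by the iteration instead of reading
  the counter. They have to ignore the value of \<open>r\<close>, because the counter is reset and
  incremented outside the body.\<close>

lemma ensures_For:
  assumes w: "w > 0" and q: "regs s q = N" "N < 2 ^ w" "q \<noteq> r" "q \<notin> written_regs c"
    and r: "r \<notin> written_regs c"
    and indep: "\<And>i s x. I i s \<Longrightarrow> I i (set_reg r x s)" "\<And>i s x. F i (set_reg r x s) = F i s"
    and init: "I 0 s"
    and body: "\<And>i s'. i < N \<Longrightarrow> I i s' \<Longrightarrow> regs s' r = i \<Longrightarrow>
      unchanged (insert r (written_regs c)) (written_arrs c) s s' \<Longrightarrow>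
      ensures t c (I (Suc i)) (F (Suc i)) s' (F i s')"
  shows "ensures (N * (t + 4) + 3) (For r q c) (I N) (F N) s (F 0 s)"
proof -
  let ?c = "Seq c (Assign r (Op Plus (Reg r) (Const 1)))"
  define J where "J = (\<lambda>s' :: store. I (regs s' r) s' \<and> regs s' r \<le> N)"
  \<comment> \<open>One iteration takes \<open>t + 2\<close> for the body followed by the increment,
    and 2 more for the loop test and for leaving the finished body.\<close>
  define T where "T = (\<lambda>s' :: store. (N - regs s' r) * (t + 4))"
  let ?s = "set_reg r 0 s"
  have one: "1 mod 2 ^ w = (1 :: nat)" using w by (cases w) auto
  have cond: "evl s' (Op Less (Reg r) (Reg q)) \<noteq> 0 \<longleftrightarrow> regs s' r < N" if "regs s' q = N" for s'
    using that one by simp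
  have "ensures (Suc (T ?s)) (While (Op Less (Reg r) (Reg q)) ?c)
      (\<lambda>s'. J s' \<and> evl s' (Op Less (Reg r) (Reg q)) = 0) (\<lambda>s'. F (regs s' r) s') ?s (F (regs ?s r) ?s)"
  proof (rule ensures_While)
    show "J ?s" using init indep by (simp add: J_def)
  next
    fix s' assume J: "J s'" and less: "evl s' (Op Less (Reg r) (Reg q)) \<noteq> 0"
      and un: "unchanged (written_regs ?c) (written_arrs ?c) ?s s'"
    have Nq: "regs s' q = N" using un q by (simp add: unchanged_def)
    with cond less have lt: "regs s' r < N" by blast
    let ?i = "regs s' r"
    have "ensures t c (I (Suc ?i)) (F (Suc ?i)) s' (F ?i s')"
      using lt J un by (intro body) (auto simp: J_def unchanged_def)
    then have *: "ensures (Suc (t + 1)) ?c (\<lambda>s''. J s'' \<and> T s'' + Suc (t + 1) + 2 \<le> T s')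
        (\<lambda>s'. F (regs s' r) s') s' (F ?i s')"
    proof (rule ensures_Seq[OF ensures_frame])
      fix s'' assume s'': "I (Suc ?i) s'' \<and> unchanged (written_regs c) (written_arrs c) s' s''"
      then have "regs s'' r = ?i" using r by (simp add: unchanged_def)
      then have e: "evl s'' (Op Plus (Reg r) (Const 1)) = Suc ?i"
        using lt q(2) one by simp
      have "(N - ?i) = Suc (N - Suc ?i)" using lt by simp
      then have le: "(N - Suc ?i) * (t + 4) + (t + 4) = (N - ?i) * (t + 4)"
        by (metis add.commute mult_Suc)
      show "ensures 1 (Assign r (Op Plus (Reg r) (Const 1))) (\<lambda>s''. J s'' \<and> T s'' + Suc (t + 1) + 2 \<le> T s')
        (\<lambda>s'. F (regs s' r) s') s'' (F (Suc ?i) s'')"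
        using s'' e lt le indep by (intro ensures_Assign) (auto simp: J_def T_def)
    qed
    show "\<exists>t. ensures t ?c (\<lambda>s''. J s'' \<and> T s'' + t + 2 \<le> T s') (\<lambda>s'. F (regs s' r) s') s' (F ?i s')"
      using * by blast
  qed
  then have "ensures (Suc (T ?s)) (While (Op Less (Reg r) (Reg q)) ?c) 
      (\<lambda>s'. (J s' \<and> evl s' (Op Less (Reg r) (Reg q)) = 0) \<and>
         unchanged (written_regs (While (Op Less (Reg r) (Reg q)) ?c)) (written_arrs (While (Op Less (Reg r) (Reg q)) ?c)) ?s s')
      (\<lambda>s'. F (regs s' r) s') ?s (F (regs ?s r) ?s)"
    by (rule ensures_frame)
  then have "ensures (Suc (T ?s)) (While (Op Less (Reg r) (Reg q)) ?c) (I N) (F N) ?s (F 0 s)"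
  proof (rule ensures_weaken)
    fix s' assume s': "(J s' \<and> evl s' (Op Less (Reg r) (Reg q)) = 0) \<and>
         unchanged (written_regs (While (Op Less (Reg r) (Reg q)) ?c)) (written_arrs (While (Op Less (Reg r) (Reg q)) ?c)) ?s s'"
    have "regs s' q = N" using s' q by (simp add: unchanged_def)
    with cond s' have "regs s' r = N" by (metis J_def le_neq_implies_less)
    with s' show "I N s'" "F N s' \<le> F (regs s' r) s'" by (auto simp: J_def)
  qed (use indep in auto)
  then have "ensures (Suc (1 + Suc (T ?s))) (For r q c) (I N) (F N) s (F 0 s)"
    unfolding For_def using indep
    by (intro ensures_Seq[where P = "\<lambda>s'. s' = ?s" and G = "\<lambda>_. F 0 s"] ensures_Assign) auto
  then show ?thesis by (simp add: T_def numeral_eq_Suc)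
qed

lemma always_For:
  assumes "w > 0" "regs s q = N" "N < 2 ^ w" "q \<noteq> r" "q \<notin> written_regs c" "r \<notin> written_regs c"
    and "\<And>i s x. I i s \<Longrightarrow> I i (set_reg r x s)"
    and "I 0 s"
    and "\<And>i s'. i < N \<Longrightarrow> I i s' \<Longrightarrow> regs s' r = i \<Longrightarrow>
      unchanged (insert r (written_regs c)) (written_arrs c) s s' \<Longrightarrow> always t c (I (Suc i)) s'"
  shows "always (N * (t + 4) + 3) (For r q c) (I N) s"
  using assms by (intro ensures_For[where F = "\<lambda>_ _. 0"]) auto

text \<open>Straight-line code is deterministic, so its effect is a function that the simplifier can
  evaluate; \<open>always_exec\<close> then spares one rule application per command.\<close>

primrec exec :: "com \<Rightarrow> store \<Rightarrow> store" where
  "exec Skip s = s"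
| "exec (Assign r e) s = set_reg r (evl s e) s"
| "exec (Store a i e) s = set_elem a (evl s i) (evl s e) s"
| "exec (Rand r e) s = s"
| "exec (Seq c1 c2) s = exec c2 (exec c1 s)"
| "exec (If e c1 c2) s = (if evl s e \<noteq> 0 then exec c1 s else exec c2 s)"
| "exec (While e c) s = s"

lemma always_exec:
  assumes "straight c" "Q (exec c s)"
  shows "always (cost c) c Q s"
  using assms
proof (induction c arbitrary: s Q)
  case (Seq c1 c2)
  then show ?case
    by (auto intro!: ensures_Seq[where P = "\<lambda>s'. s' = exec c1 s" and G = "\<lambda>_. 0"])
next
  case (If e c1 c2)
  then have "evl s e \<noteq> 0 \<Longrightarrow> always (cost c1) c1 Q s" "evl s e = 0 \<Longrightarrow> always (cost c2) c2 Q s"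
    by auto
  then show ?case
    unfolding cost.simps by (intro ensures_If) (auto intro: ensures_time[OF _ max.cobounded1] ensures_time[OF _ max.cobounded2])
next
  case Skip
  then show ?case by (auto intro: ensures_Skip)
next
  case (Assign r e)
  then show ?case by (auto intro: ensures_Assign[simplified])
next
  case (Store a i e)
  then show ?case by (auto intro: ensures_Store[simplified])
qed auto

lemma always_Seq:
  assumes "always t1 c1 P s" "\<And>s'. P s' \<Longrightarrow> unchanged (written_regs c1) (written_arrs c1) s s' \<Longrightarrow> always t2 c2 Q s'"
  shows "always (Suc (t1 + t2)) (c1 ;; c2) Q s"
  using ensures_frame[OF assms(1)] assms(2) by (rule ensures_Seq) auto

lemma always_exec_Seq:
  assumes "straight c1" "always t c2 Q (exec c1 s)"
  shows "always (Suc (cost c1 + t)) (c1 ;; c2) Q s"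
  by (rule always_Seq[where P = "\<lambda>s'. s' = exec c1 s"]) (use assms always_exec in auto)

lemma always_For_exec:
  assumes "w > 0" "regs s q = N" "N < 2 ^ w" "q \<noteq> r" "q \<notin> written_regs c" "r \<notin> written_regs c" "straight c"
    and "\<And>i s x. I i s \<Longrightarrow> I i (set_reg r x s)"
    and "I 0 s"
    and "\<And>i s'. i < N \<Longrightarrow> I i s' \<Longrightarrow> regs s' r = i \<Longrightarrow>
      unchanged (insert r (written_regs c)) (written_arrs c) s s' \<Longrightarrow> I (Suc i) (exec c s')"
  shows "always (N * (cost c + 4) + 3) (For r q c) (I N) s"
  by (intro always_For assms always_exec)

text \<open>The bridge from deterministic to probabilistic parts: a potential bounded at every
  outcome is bounded on average.\<close>

lemma ensures_of_always_conj:
  assumes "always t c (\<lambda>s'. Q s' \<and> F s' \<le> B) s"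
  shows "ensures t c Q F s B"
proof -
  from ensures_of_always[OF assms, of F B]
  have "ensures t c (\<lambda>s'. Q s' \<and> F s' \<le> B) F s B" by simp
  then show ?thesis by (rule ensures_weaken) auto
qed

lemma ensures_always_Seq:
  assumes "always t1 c1 P s"
    "\<And>s'. P s' \<Longrightarrow> unchanged (written_regs c1) (written_arrs c1) s s' \<Longrightarrow> ensures t2 c2 Q F s' B"
  shows "ensures (Suc (t1 + t2)) (c1 ;; c2) Q F s B"
proof -
  have "ensures t1 c1 P (\<lambda>_. B) s B" using assms(1) by (rule ensures_of_always) simp
  from ensures_frame[OF this] show ?thesis
    by (rule ensures_Seq) (use assms(2) in auto)
qed

lemma ensures_add_const:
  assumes "ensures t c Q F s B"
  shows "ensures t c Q (\<lambda>s'. F s' + a) s (B + a)"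
  using assms by (auto simp: ensures_def nn_integral_add add_right_mono)

end

section \<open>Tournament trees\<close>

text \<open>
  A tournament tree over \<open>n\<close> leaves is an array whose nodes \<open>n + v\<close> are the leaves; node \<open>k < n\<close>
  has children \<open>2 k\<close> and \<open>2 k + 1\<close>, and \<open>1\<close> is the root. This works for every \<open>n \<ge> 1\<close>.
\<close>

definition tournament :: "nat \<Rightarrow> (nat \<Rightarrow> nat) \<Rightarrow> bool" where
  "tournament n T \<longleftrightarrow> (\<forall>k. 1 \<le> k \<and> k < n \<longrightarrow> T k = min (T (2 * k)) (T (2 * k + 1)))"

lemma tournament_root_le:
  assumes "tournament n T" "1 \<le> j" "j < 2 * n"
  shows "T 1 \<le> T j"
  using assms(2,3)
proof (induction j rule: less_induct)
  case (less j)
  show ?case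
  proof (cases "j = 1")
    case False
    with less.prems have j: "1 \<le> j div 2" "j div 2 < j" "j div 2 < n" by auto
    then have "T 1 \<le> T (j div 2)" using less by auto
    also have "\<dots> = min (T (2 * (j div 2))) (T (2 * (j div 2) + 1))"
      using assms(1) j by (auto simp: tournament_def)
    also have "\<dots> \<le> T j"
      by (cases "even j") (auto elim!: evenE oddE)
    finally show ?thesis .
  qed simp
qed

lemma tournament_root_leaf:
  assumes "tournament n T" "n \<ge> 1"
  shows "\<exists>v<n. T 1 = T (n + v)"
proof -
  have "\<exists>v<n. T j = T (n + v)" if "1 \<le> j" "j < 2 * n" for j
    using that
  proof (induction "2 * n - j" arbitrary: j rule: less_induct)
    case less
    show ?case
    proof (cases "j < n")
      case False
      with less.prems show ?thesis by (intro exI[of _ "j - n"]) auto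
    next
      case True
      then have "T j = min (T (2 * j)) (T (2 * j + 1))"
        using assms(1) less.prems by (auto simp: tournament_def)
      moreover have "\<exists>v<n. T (2 * j) = T (n + v)"
        using True less.prems by (intro less.hyps) auto
      moreover have "\<exists>v<n. T (2 * j + 1) = T (n + v)"
        using True less.prems by (intro less.hyps) auto
      ultimately show ?thesis by (auto simp: min_def)
    qed
  qed
  from this[of 1] assms(2) show ?thesis by auto
qed

text \<open>The depth of node \<open>i\<close> below the root 1, hence the number of iterations of
  \<open>tree_update\<close>.\<close>

fun lg :: "nat \<Rightarrow> nat" where
  "lg i = (if i \<le> 1 then 0 else Suc (lg (i div 2)))"

declare lg.simps [simp del]

lemma lg_le: "i < 2 ^ Suc k \<Longrightarrow> lg i \<le> k"
proof (induction k arbitrary: i)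
  case 0
  then show ?case by (simp add: lg.simps)
next
  case (Suc k)
  then have "i div 2 < 2 ^ Suc k" by auto
  with Suc.IH show ?case by (subst lg.simps) auto
qed

abbreviation (input) "rN \<equiv> 0 :: nat"
abbreviation (input) "rM \<equiv> 1 :: nat"
abbreviation (input) "rInf \<equiv> 2 :: nat"
abbreviation (input) "rKeyInf \<equiv> 3 :: nat"
abbreviation (input) "rNode \<equiv> 10 :: nat"
abbreviation (input) "rKey \<equiv> 11 :: nat"
abbreviation (input) "rSrc \<equiv> 12 :: nat"
abbreviation (input) "rI \<equiv> 13 :: nat"
abbreviation (input) "rU \<equiv> 14 :: nat"
abbreviation (input) "rDistU \<equiv> 15 :: nat"
abbreviation (input) "rPtr \<equiv> 16 :: nat"
abbreviation (input) "rArc \<equiv> 17 :: nat"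
abbreviation (input) "rHead \<equiv> 18 :: nat"
abbreviation (input) "rNew \<equiv> 19 :: nat"
abbreviation (input) "aWeight \<equiv> 2 :: nat"
abbreviation (input) "aDist \<equiv> 6 :: nat"
abbreviation (input) "aTree \<equiv> 7 :: nat"

abbreviation "eLeft \<equiv> Elem aTree (Op Times (Const 2) (Reg rNode))"
abbreviation "eRight \<equiv> Elem aTree (Op Plus (Op Times (Const 2) (Reg rNode)) (Const 1))"

definition tree_up :: com where
  "tree_up =
     Assign rNode (Op Div (Reg rNode) (Const 2)) ;;
     If (Op Less eLeft eRight) (Store aTree (Reg rNode) eLeft) (Store aTree (Reg rNode) eRight)"

definition tree_update :: com where
  "tree_update =
     Store aTree (Reg rNode) (Reg rKey) ;;
     While (Op Less (Const 1) (Reg rNode)) tree_up"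

lemma written_tree_update [simp]:
  "written_regs tree_update = {rNode}" "written_arrs tree_update = {aTree}"
  by (simp_all add: tree_update_def tree_up_def)

lemma small_consts:
  assumes "2 < (2 :: nat) ^ w"
  shows "w > 0" "1 mod 2 ^ w = (1 :: nat)" "Suc 0 mod 2 ^ w = Suc 0" "2 mod 2 ^ w = (2 :: nat)"
proof -
  show "w > 0" using assms by (cases w) auto
qed (rule mod_less, use assms in linarith)+

context ram
begin

text \<open>Replacing a leaf can break only the equation at its parent; recomputing the parent moves
  the possible defect one level up.\<close>

lemma always_tree_update:
  assumes n: "v < n" "2 * n \<le> 2 ^ Suc l" "2 * n + 1 < 2 ^ w"
    and T: "tournament n (arrs s aTree)" "regs s rNode = n + v" "regs s rKey = x"
  shows "always (6 * l + 3) tree_update (\<lambda>s'. tournament n (arrs s' aTree) \<and>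
    (\<forall>u<n. arrs s' aTree (n + u) = (if u = v then x else arrs s aTree (n + u)))) s"
proof -
  \<comment> \<open>The only node that may violate its equation is \<open>i div 2\<close>, the
    parent of the current node. At the root this is 0, which is not a node, so on exit the tree is
    intact.\<close>
  define I where "I = (\<lambda>s' :: store. let i = regs s' rNode; T = arrs s' aTree in 1 \<le> i \<and> i < 2 * n \<and>
    (\<forall>k. 1 \<le> k \<and> k < n \<and> k \<noteq> i div 2 \<longrightarrow> T k = min (T (2 * k)) (T (2 * k + 1))) \<and>
    (\<forall>u<n. T (n + u) = (if u = v then x else arrs s aTree (n + u))))"
  let ?s = "exec (Store aTree (Reg rNode) (Reg rKey)) s"
  let ?e = "Op Less (Const 1) (Reg rNode)"
  have "2 < (2 :: nat) ^ w" using n by linarith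
  note w3 = small_consts[OF this]
  have cond: "evl s' ?e \<noteq> 0 \<longleftrightarrow> 1 < regs s' rNode" for s'
    using w3 by simp
  have "always (Suc (6 * lg (regs ?s rNode))) (While ?e tree_up) (\<lambda>s'. I s' \<and> evl s' ?e = 0) ?s"
  proof (rule ensures_While[where I = I and T = "\<lambda>s. 6 * lg (regs s rNode)" and F = "\<lambda>_. 0"])
    define T where "T = (arrs s aTree)(n + v := x)"
    have "T k = min (T (2 * k)) (T (2 * k + 1))" if k: "1 \<le> k" "k < n" "k \<noteq> (n + v) div 2" for k
    proof -
      have "2 * k \<noteq> n + v" "2 * k + 1 \<noteq> n + v" "k \<noteq> n + v" using k by auto
      then show ?thesis using k T(1) T_def by (simp add: tournament_def)
    qed
    moreover have "\<forall>u<n. T (n + u) = (if u = v then x else arrs s aTree (n + u))"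
      by (simp add: T_def)
    moreover have "regs ?s rNode = n + v" "arrs ?s aTree = T"
      using T by (simp_all add: T_def)
    ultimately show "I ?s"
      unfolding I_def Let_def using n(1) by (intro conjI allI impI) auto
  next
    fix s' assume I: "I s'" and c: "evl s' ?e \<noteq> 0"
    define i T where "i = regs s' rNode" and "T = arrs s' aTree"
    define j where "j = i div 2"
    have i: "1 < i" "i < 2 * n" using I c cond by (auto simp: I_def Let_def i_def)
    then have j: "1 \<le> j" "j < n" by (auto simp: j_def)
    have evs: "evl s' (Op Div (Reg rNode) (Const 2)) = j"
      using w3 i j n by (simp add: i_def j_def)
    have "exec tree_up s' = set_elem aTree j (min (T (2 * j)) (T (2 * j + 1))) (set_reg rNode j s')"
      using w3 j n evs by (simp add: tree_up_def T_def min_def del: eval.simps(4)) 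
        (simp add: min_def)
    then have ex: "regs (exec tree_up s') rNode = j"
      "arrs (exec tree_up s') aTree = T(j := min (T (2 * j)) (T (2 * j + 1)))"
      by (simp_all add: T_def)
    have "I (exec tree_up s')"
      unfolding I_def Let_def ex
    proof (intro conjI allI impI)
      fix k assume k: "1 \<le> k \<and> k < n \<and> k \<noteq> j div 2"
      then have "2 * k \<noteq> j" "2 * k + 1 \<noteq> j" by auto
      with k I show "(T(j := min (T (2 * j)) (T (2 * j + 1)))) k =
         min ((T(j := min (T (2 * j)) (T (2 * j + 1)))) (2 * k)) ((T(j := min (T (2 * j)) (T (2 * j + 1)))) (2 * k + 1))"
        by (auto simp: I_def Let_def T_def i_def j_def)
    next
      fix u assume "u < n"
      with I j show "(T(j := min (T (2 * j)) (T (2 * j + 1)))) (n + u) = (if u = v then x else arrs s aTree (n + u))"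
        by (auto simp: I_def Let_def T_def)
    qed (use j in auto)
    moreover have c4: "cost tree_up = 4"
      by (simp add: tree_up_def)
    moreover have "6 * lg j + 4 + 2 \<le> 6 * lg i"
      using i by (subst (2) lg.simps) (simp add: j_def)
    ultimately have "always (cost tree_up) tree_up (\<lambda>s''. I s'' \<and> 6 * lg (regs s'' rNode) + 4 + 2 \<le> 6 * lg i) s'"
      by (intro always_exec) (auto simp: ex, auto simp: tree_up_def)
    then show "\<exists>t. always t tree_up (\<lambda>s''. I s'' \<and> 6 * lg (regs s'' rNode) + t + 2 \<le> 6 * lg (regs s' rNode)) s'"
      by (intro exI[of _ 4]) (simp add: c4 i_def)
  qed
  then have "always (Suc (cost (Store aTree (Reg rNode) (Reg rKey)) + Suc (6 * lg (regs ?s rNode)))) tree_update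
     (\<lambda>s'. I s' \<and> evl s' ?e = 0) s"
    unfolding tree_update_def by (intro always_exec_Seq) simp_all
  then show ?thesis
  proof (rule always_weaken)
    fix s' assume s': "I s' \<and> evl s' ?e = 0"
    with cond have "regs s' rNode \<le> 1" by (meson linorder_not_le)
    with s' have "regs s' rNode = 1" by (simp add: I_def Let_def)
    with s' show "tournament n (arrs s' aTree) \<and>
      (\<forall>u<n. arrs s' aTree (n + u) = (if u = v then x else arrs s aTree (n + u)))"
      unfolding I_def Let_def tournament_def by simp
  next
    have "n + v < 2 ^ Suc l" using n by linarith
    then have "lg (n + v) \<le> l" by (rule lg_le)
    then show "Suc (cost (Store aTree (Reg rNode) (Reg rKey)) + Suc (6 * lg (regs ?s rNode))) \<le> 6 * l + 3"
      using T by simp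
  qed
qed

end

section \<open>Walks and distances in arc lists\<close>

text \<open>Tails and heads are separate functions, so reversing all arcs means swapping two
  arguments, and one verified Dijkstra serves distances both from and to a vertex.\<close>

inductive arc_walk :: "nat \<Rightarrow> (nat \<Rightarrow> nat) \<Rightarrow> (nat \<Rightarrow> nat) \<Rightarrow> (nat \<Rightarrow> nat) \<Rightarrow> nat \<Rightarrow> nat \<Rightarrow> nat \<Rightarrow> bool"
  for m ta he wt u where
  Nil: "arc_walk m ta he wt u u 0"
| snoc: "arc_walk m ta he wt u (ta e) x \<Longrightarrow> e < m \<Longrightarrow> arc_walk m ta he wt u (he e) (x + wt e)"

lemma arc_walk_trans:
  assumes "arc_walk m ta he wt v u y" "arc_walk m ta he wt a v x"
  shows "arc_walk m ta he wt a u (x + y)"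
  using assms
  by (induction rule: arc_walk.induct) (auto intro: arc_walk.snoc simp flip: add.assoc)

lemma arc_walk_rev:
  assumes "arc_walk m ta he wt u v x"
  shows "arc_walk m he ta wt v u x"
  using assms
proof (induction rule: arc_walk.induct)
  case (snoc e x)
  have "arc_walk m he ta wt (he e) (ta e) (0 + wt e)"
    using snoc by (intro arc_walk.snoc arc_walk.Nil)
  with snoc show ?case using arc_walk_trans by (metis add.commute add_0)
qed (rule arc_walk.Nil)

text \<open>The number \<open>infd\<close> stands for \<open>\<infinity>\<close>.\<close>

definition arc_dist :: "nat \<Rightarrow> nat \<Rightarrow> (nat \<Rightarrow> nat) \<Rightarrow> (nat \<Rightarrow> nat) \<Rightarrow> (nat \<Rightarrow> nat) \<Rightarrow> nat \<Rightarrow> nat \<Rightarrow> nat" where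
  "arc_dist infd m ta he wt u v =
     (if \<exists>x. arc_walk m ta he wt u v x then LEAST x. arc_walk m ta he wt u v x else infd)"

lemma arc_dist_rev: "arc_dist infd m he ta wt u v = arc_dist infd m ta he wt v u"
proof -
  have "arc_walk m he ta wt u v = arc_walk m ta he wt v u"
    by (intro ext iffI) (erule arc_walk_rev)+
  then show ?thesis by (simp add: arc_dist_def)
qed

text \<open>
  The arcs leaving \<open>u\<close> form a linked list in decreasing order; \<open>last_arc ta u j\<close> is the successor of
  the last such arc below \<open>j\<close>, and 0 terminates the list.
\<close>

primrec last_arc :: "(nat \<Rightarrow> nat) \<Rightarrow> nat \<Rightarrow> nat \<Rightarrow> nat" where
  "last_arc ta u 0 = 0"
| "last_arc ta u (Suc j) = (if ta j = u then Suc j else last_arc ta u j)"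

lemma last_arc_le: "last_arc ta u j \<le> j"
  by (induction j) (auto intro: le_SucI)

lemma last_arc_pos: "last_arc ta u j \<noteq> 0 \<Longrightarrow> ta (last_arc ta u j - 1) = u"
  by (induction j) auto

lemma last_arc_gap: "last_arc ta u j \<le> e \<Longrightarrow> e < j \<Longrightarrow> ta e \<noteq> u"
  by (induction j) (auto simp: less_Suc_eq split: if_splits)

section \<open>Dijkstra's algorithm\<close>

text \<open>Since 0 ends a list, pointers are arc numbers plus one; the arc at hand is
  \<open>rPtr - 1\<close>.\<close>

definition relax :: "nat \<Rightarrow> nat \<Rightarrow> com" where
  "relax h nx =
     (Assign rArc (Op Minus (Reg rPtr) (Const 1)) ;;
      Assign rHead (Elem h (Reg rArc)) ;;
      Assign rNew (Op Plus (Reg rDistU) (Elem aWeight (Reg rArc)))) ;;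
     If (Op Less (Reg rNew) (Elem aDist (Reg rHead)))
       ((Store aDist (Reg rHead) (Reg rNew) ;;
         Assign rNode (Op Plus (Reg rN) (Reg rHead)) ;;
         Assign rKey (Op Plus (Op Times (Reg rNew) (Reg rN)) (Reg rHead))) ;;
        tree_update)
       Skip ;;
     Assign rPtr (Elem nx (Reg rArc))"

text \<open>Keys have the form \<open>D * n + v\<close>: they order by distance first, and
  \<open>mod n\<close> recovers the vertex. A vertex is removed from the queue by giving its leaf
  the infinite key.\<close>

definition extract_min :: "nat \<Rightarrow> com" where
  "extract_min a =
     (Assign rU (Op Mod (Elem aTree (Const 1)) (Reg rN)) ;;
      Assign rDistU (Elem aDist (Reg rU)) ;;
      Assign rNode (Op Plus (Reg rN) (Reg rU)) ;;
      Assign rKey (Reg rKeyInf)) ;;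
     tree_update ;;
     Assign rPtr (Elem a (Reg rU))"

definition dijkstra :: "nat \<Rightarrow> nat \<Rightarrow> nat \<Rightarrow> com" where
  "dijkstra h a nx =
     For rI rN
       (Store aDist (Reg rI) (Reg rInf) ;;
        Store aTree (Reg rI) (Reg rKeyInf) ;;
        Store aTree (Op Plus (Reg rN) (Reg rI)) (Reg rKeyInf)) ;;
     (Store aDist (Reg rSrc) (Const 0) ;;
      Assign rNode (Op Plus (Reg rN) (Reg rSrc)) ;;
      Assign rKey (Reg rSrc)) ;;
     tree_update ;;
     While (Op Less (Elem aTree (Const 1)) (Reg rKeyInf))
       (extract_min a ;; While (Reg rPtr) (relax h nx))"

lemma written_relax [simp]:
  "written_regs (relax h nx) = {rNode, rKey, rPtr, rArc, rHead, rNew}"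
  "written_arrs (relax h nx) = {aDist, aTree}"
  by (auto simp: relax_def)

lemma written_extract_min [simp]:
  "written_regs (extract_min a) = {rNode, rKey, rU, rDistU, rPtr}"
  "written_arrs (extract_min a) = {aTree}"
  by (auto simp: extract_min_def)

lemma written_dijkstra [simp]:
  "written_regs (dijkstra h a nx) = {rNode, rKey, rI, rU, rDistU, rPtr, rArc, rHead, rNew}"
  "written_arrs (dijkstra h a nx) = {aDist, aTree}"
  by (auto simp: dijkstra_def)

section \<open>Invariant of Dijkstra's algorithm\<close>

locale arc_list = ram w \<tau> for w \<tau> +
  fixes n m W l :: nat and ta he wt :: "nat \<Rightarrow> nat"
  assumes n_pos: "n \<ge> 1"
    and ta_less: "\<And>e. e < m \<Longrightarrow> ta e < n"
    and he_less: "\<And>e. e < m \<Longrightarrow> he e < n"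
    and wt_le: "\<And>e. e < m \<Longrightarrow> wt e \<le> W"
    and word: "(n * W + 1) * n + W + 2 * n + m + 2 < 2 ^ w"
    and n_le: "n \<le> 2 ^ l"
begin

text \<open>Walks of least length need at most \<open>n\<close> arcs, so finite distances are at
  most \<open>n * W < inf_dist\<close>, and the keys of reached vertices lie below
  \<open>inf_dist * n = inf_key\<close>. The assumption \<open>word\<close> leaves room above
  \<open>inf_key\<close>, so that the arithmetic of Dijkstra's algorithm never wraps around.\<close>

definition "inf_dist = n * W + 1"
definition "inf_key = (n * W + 1) * n"

abbreviation "walk \<equiv> arc_walk m ta he wt"
abbreviation "dst \<equiv> arc_dist inf_dist m ta he wt"

text \<open>
  \<open>X\<close> is the set of settled vertices, \<open>b * W\<close> bounds the finite tentative distances, and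
  the arcs \<open>e\<close> with \<open>P e\<close> have been relaxed.
\<close>

definition dinv ::
  "nat set \<Rightarrow> nat \<Rightarrow> (nat \<Rightarrow> bool) \<Rightarrow> nat \<Rightarrow> (nat \<Rightarrow> nat) \<Rightarrow> (nat \<Rightarrow> nat) \<Rightarrow> bool" where
  "dinv X b P src D T \<longleftrightarrow>
     X \<subseteq> {..<n} \<and> tournament n T \<and>
     (\<forall>v<n. T (n + v) = (if D v < inf_dist \<and> v \<notin> X then D v * n + v else inf_key)) \<and>
     (\<forall>v\<in>X. D v < inf_dist) \<and>
     (\<forall>v<n. D v < inf_dist \<longrightarrow> walk src v (D v) \<and> D v \<le> b * W) \<and>
     (\<forall>v<n. D v \<le> inf_dist) \<and> D src = 0 \<and>
     (\<forall>x\<in>X. \<forall>v<n. v \<notin> X \<longrightarrow> D x \<le> D v) \<and>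
     (\<forall>e<m. P e \<longrightarrow> ta e \<in> X \<and> D (he e) \<le> D (ta e) + wt e)"

lemma dinvD:
  assumes "dinv X b P src D T"
  shows "X \<subseteq> {..<n}" "tournament n T"
    "v < n \<Longrightarrow> T (n + v) = (if D v < inf_dist \<and> v \<notin> X then D v * n + v else inf_key)"
    "v \<in> X \<Longrightarrow> D v < inf_dist"
    "v < n \<Longrightarrow> D v < inf_dist \<Longrightarrow> walk src v (D v)" "v < n \<Longrightarrow> D v < inf_dist \<Longrightarrow> D v \<le> b * W"
    "v < n \<Longrightarrow> D v \<le> inf_dist" "D src = 0"
    "x \<in> X \<Longrightarrow> v < n \<Longrightarrow> v \<notin> X \<Longrightarrow> D x \<le> D v"
    "e < m \<Longrightarrow> P e \<Longrightarrow> ta e \<in> X" "e < m \<Longrightarrow> P e \<Longrightarrow> D (he e) \<le> D (ta e) + wt e"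
    "v \<in> X \<Longrightarrow> v < n"
  using assms unfolding dinv_def by blast+

lemma dinvI:
  assumes "X \<subseteq> {..<n}" "tournament n T"
    "\<And>v. v < n \<Longrightarrow> T (n + v) = (if D v < inf_dist \<and> v \<notin> X then D v * n + v else inf_key)"
    "\<And>v. v \<in> X \<Longrightarrow> D v < inf_dist"
    "\<And>v. v < n \<Longrightarrow> D v < inf_dist \<Longrightarrow> walk src v (D v) \<and> D v \<le> b * W"
    "\<And>v. v < n \<Longrightarrow> D v \<le> inf_dist" "D src = 0"
    "\<And>x v. x \<in> X \<Longrightarrow> v < n \<Longrightarrow> v \<notin> X \<Longrightarrow> D x \<le> D v"
    "\<And>e. e < m \<Longrightarrow> P e \<Longrightarrow> ta e \<in> X \<and> D (he e) \<le> D (ta e) + wt e"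
  shows "dinv X b P src D T"
  using assms unfolding dinv_def by blast

lemma key_less: "D < inf_dist \<Longrightarrow> v < n \<Longrightarrow> D * n + v < inf_key"
proof -
  assume "D < inf_dist" "v < n"
  then have "D * n + v < (D + 1) * n" "D + 1 \<le> n * W + 1" by (auto simp: inf_dist_def)
  then show ?thesis unfolding inf_key_def by (meson mult_le_mono1 less_le_trans)
qed

text \<open>The program does not store the settled set. It can be recovered from the arrays, as the
  vertices that are reached but no longer queued, so loop invariants and time bounds can be
  functions of the store.\<close>

lemma dinv_settled:
  assumes "dinv X b P src D T"
  shows "X = {v. v < n \<and> D v < inf_dist \<and> T (n + v) = inf_key}"
proof (intro set_eqI iffI)
  fix v assume "v \<in> X"
  then show "v \<in> {v. v < n \<and> D v < inf_dist \<and> T (n + v) = inf_key}"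
    using dinvD(3,4,12)[OF assms, of v] by simp
next
  fix v assume v: "v \<in> {v. v < n \<and> D v < inf_dist \<and> T (n + v) = inf_key}"
  then show "v \<in> X"
    using dinvD(3)[OF assms, of v] key_less[of "D v" v] by (cases "v \<in> X") auto
qed

lemma card_settled_less:
  assumes "dinv X b P src D T" "u < n" "u \<notin> X"
  shows "card X < n"
proof -
  have "X \<subset> {..<n}" using dinvD(1)[OF assms(1)] assms(2,3) by auto
  then have "card X < card {..<n}" by (intro psubset_card_mono) auto
  then show ?thesis by simp
qed

lemma dinv_init:
  assumes "src < n" "\<forall>v<n. D v = (if v = src then 0 else inf_dist)" "tournament n T"
    "\<forall>v<n. T (n + v) = (if v = src then src else inf_key)"
  shows "dinv {} 0 (\<lambda>_. False) src D T"
  using assms by (intro dinvI) (auto simp: inf_dist_def intro: arc_walk.Nil split: if_splits)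

text \<open>As \<open>v < n\<close>, keys \<open>D * n + v\<close> are ordered lexicographically, so
  the least key belongs to an unsettled vertex of least distance. The factor of \<open>W\<close>
  grows by one in advance: it must also cover the heads of the arcs of \<open>u\<close>, which are
  relaxed next.\<close>

lemma dinv_extract:
  assumes inv: "dinv X (card X) (\<lambda>e. ta e \<in> X) src D T" and less: "T 1 < inf_key" and u: "u = T 1 mod n"
  shows "u < n" "u \<notin> X" "D u < inf_dist" "\<forall>x\<in>insert u X. D x \<le> D u" "D u + W \<le> Suc (card X) * W"
    and "tournament n T' \<Longrightarrow> \<forall>v<n. T' (n + v) = (if v = u then inf_key else T (n + v)) \<Longrightarrow>
      dinv (insert u X) (Suc (card X)) (\<lambda>e. ta e \<in> X) src D T'"
proof -
  note T = dinvD(2)[OF inv]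
  obtain v where v: "v < n" "T 1 = T (n + v)"
    using tournament_root_leaf[OF T n_pos] by auto
  with less have Dv: "D v < inf_dist" "v \<notin> X" "T 1 = D v * n + v"
    using dinvD(3)[OF inv, of v] by (auto split: if_splits)
  with v u have uv: "u = v" by simp
  with v Dv show un: "u < n" "u \<notin> X" "D u < inf_dist" by auto
  have min: "D u \<le> D y" if y: "y < n" "y \<notin> X" for y
  proof (cases "D y < inf_dist")
    case True
    have "T 1 \<le> T (n + y)" using y n_pos by (intro tournament_root_le[OF T]) auto
    then have "D u * n + u \<le> D y * n + y"
      using True y dinvD(3)[OF inv, of y] Dv uv by simp
    show ?thesis
    proof (rule ccontr)
      assume "\<not> ?thesis"
      then have "(D y + 1) * n \<le> D u * n" by (intro mult_le_mono1) auto
      with \<open>D u * n + u \<le> D y * n + y\<close> y show False by simp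
    qed
  qed (use un in auto)
  show max: "\<forall>x\<in>insert u X. D x \<le> D u"
    using dinvD(9)[OF inv] un by auto
  show "D u + W \<le> Suc (card X) * W"
    using dinvD(6)[OF inv] un by simp
  show "dinv (insert u X) (Suc (card X)) (\<lambda>e. ta e \<in> X) src D T'"
    if "tournament n T'" "\<forall>v<n. T' (n + v) = (if v = u then inf_key else T (n + v))"
  proof (rule dinvI)
    fix x v assume "x \<in> insert u X" "v < n" "v \<notin> insert u X"
    then show "D x \<le> D v" using min[of v] max by (meson insertCI order_trans)
  qed (use dinvD[OF inv] un that in \<open>auto intro: trans_le_add2\<close>)
qed

text \<open>An improved head cannot be settled: settled vertices have distance at most
  \<open>D u\<close>, and weights are nonnegative. Hence settled distances stay fixed.\<close>

lemma dinv_relax: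
  assumes inv: "dinv X b P src D T" and u: "u \<in> X" "\<forall>x\<in>X. D x \<le> D u" "D u + W \<le> b * W" "b \<le> n"
    and e: "e < m" "ta e = u" and less: "D u + wt e < D (he e)"
    and T': "tournament n T'" "\<forall>v<n. T' (n + v) = (if v = he e then (D u + wt e) * n + he e else T (n + v))"
  shows "he e \<notin> X" "dinv X b (\<lambda>f. P f \<or> f = e) src (D(he e := D u + wt e)) T'"
proof -
  have he: "he e < n" using e he_less by auto
  show nX: "he e \<notin> X" using u less by fastforce
  have W: "D u + wt e \<le> b * W" using u wt_le[OF e(1)] by linarith
  moreover have "b * W \<le> n * W" using u by simp
  ultimately have fin: "D u + wt e < inf_dist" unfolding inf_dist_def by linarith
  have "walk src u (D u)" using dinvD(4,5,12)[OF inv] u by auto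
  then have wk: "walk src (he e) (D u + wt e)" using e by (auto intro: arc_walk.snoc)
  let ?D = "D(he e := D u + wt e)"
  show "dinv X b (\<lambda>f. P f \<or> f = e) src ?D T'"
  proof (rule dinvI)
    fix v assume v: "v < n"
    show "T' (n + v) = (if ?D v < inf_dist \<and> v \<notin> X then ?D v * n + v else inf_key)"
      using T'(2) v dinvD(3)[OF inv v] fin nX by auto
    show "walk src v (?D v) \<and> ?D v \<le> b * W" if "?D v < inf_dist"
      using that dinvD(5,6)[OF inv v] W wk by auto
    show "?D v \<le> inf_dist" using dinvD(7)[OF inv v] fin by auto
  next
    fix f assume f: "f < m" "P f \<or> f = e"
    then have "ta f \<in> X" using u e dinvD(10)[OF inv] by auto
    moreover from this have "?D (ta f) = D (ta f)" using nX by auto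
    moreover have "?D (he f) \<le> D (ta f) + wt f"
    proof (cases "f = e")
      case True
      then show ?thesis using e by simp
    next
      case False
      then have "D (he f) \<le> D (ta f) + wt f" using f dinvD(11)[OF inv] by blast
      then show ?thesis using less by auto
    qed
    ultimately show "ta f \<in> X \<and> ?D (he f) \<le> ?D (ta f) + wt f" by simp
  next
    show "?D src = 0" using dinvD(8)[OF inv] less by auto
  next
    fix x v assume "x \<in> X" "v < n" "v \<notin> X"
    then show "?D x \<le> ?D v"
      using dinvD(9)[OF inv, of x v] u(2) nX by (auto intro: trans_le_add1)
  next
    fix v assume "v \<in> X"
    then show "?D v < inf_dist" using dinvD(4)[OF inv] nX by auto
  qed (use dinvD(1)[OF inv] T' in auto)
qed

lemma dinv_relaxed:
  assumes "dinv X b P src D T" "ta e \<in> X" "D (he e) \<le> D (ta e) + wt e"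
  shows "dinv X b (\<lambda>f. P f \<or> f = e) src D T"
  using assms unfolding dinv_def by blast

lemma dinv_mono:
  assumes "dinv X b P src D T" "\<And>e. e < m \<Longrightarrow> P' e \<Longrightarrow> P e"
  shows "dinv X b P' src D T"
  using assms unfolding dinv_def by blast

text \<open>An infinite root means that every reached vertex is settled, so all arcs leaving reached
  vertices are relaxed, and induction along a walk bounds \<open>D\<close> by its length.
  Conversely, every finite \<open>D v\<close> is the length of a walk.\<close>

lemma dinv_final:
  assumes inv: "dinv X (card X) (\<lambda>e. ta e \<in> X) src D T" and T: "\<not> T 1 < inf_key" and src: "src < n" and v: "v < n"
  shows "D v = dst src v"
proof -
  have settled: "y \<in> X" if "y < n" "D y < inf_dist" for y
  proof (rule ccontr)
    assume "y \<notin> X"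
    then have "T (n + y) < inf_key" using key_less that dinvD(3)[OF inv, of y] by simp
    moreover have "T 1 \<le> T (n + y)"
      using that n_pos by (intro tournament_root_le[OF dinvD(2)[OF inv]]) auto
    ultimately show False using T by simp
  qed
  have le: "y < n \<and> D y < inf_dist \<and> D y \<le> x" if "walk src y x" for y x
    using that
  proof (induction rule: arc_walk.induct)
    case Nil
    then show ?case using dinvD(8)[OF inv] src by (auto simp: inf_dist_def)
  next
    case (snoc e x)
    then have "ta e \<in> X" using settled by auto
    then have *: "D (he e) \<le> D (ta e) + wt e" "D (ta e) \<le> card X * W" "D (ta e) \<le> x" "ta e < n"
      using dinvD(4,6,11)[OF inv] snoc by auto
    have he: "he e < n" using snoc he_less by simp
    \<comment> \<open>This is where the bound \<open>card X * W\<close> is used: an unreached head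
      would be unsettled, leaving \<open>card X < n\<close>, so one more arc after
      \<open>ta e\<close> still stays within \<open>n * W\<close>.\<close>
    have "D (he e) < inf_dist"
    proof (rule ccontr)
      assume nX: "\<not> ?thesis"
      then have "he e \<notin> X" using dinvD(4)[OF inv] by auto
      with he inv have "card X < n" by (intro card_settled_less)
      then have "Suc (card X) * W \<le> n * W" by (intro mult_le_mono1) simp
      with * wt_le[OF snoc.hyps(2)] have "D (he e) \<le> n * W" by simp
      with nX show False by (simp add: inf_dist_def)
    qed
    with * he show ?case by simp
  qed
  show ?thesis
  proof (cases "\<exists>x. walk src v x")
    case True
    then have "D v < inf_dist" using le by blast
    then have "walk src v (D v)" using dinvD(5)[OF inv v] by auto
    then have "(LEAST x. walk src v x) = D v"
      using le by (intro Least_equality) auto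
    with True show ?thesis by (simp add: arc_dist_def)
  next
    case False
    then have "D v = inf_dist" using dinvD(5,7)[OF inv v] by (metis nat_less_le)
    with False show ?thesis by (simp add: arc_dist_def)
  qed
qed

section \<open>Dijkstra's algorithm on the word RAM, with amortized time\<close>

definition adjacency :: "nat \<Rightarrow> nat \<Rightarrow> nat \<Rightarrow> store \<Rightarrow> bool" where
  "adjacency h a nx s \<longleftrightarrow> regs s rN = n \<and> regs s rInf = inf_dist \<and> regs s rKeyInf = inf_key \<and>
     (\<forall>e<m. arrs s h e = he e \<and> arrs s aWeight e = wt e \<and> arrs s nx e = last_arc ta (ta e) e) \<and>
     (\<forall>u<n. arrs s a u = last_arc ta u m)"

lemma adjacency_unchanged:
  assumes "adjacency h a nx s" "unchanged R A s s'" "R \<inter> {rN, rInf, rKeyInf} = {}" "A \<inter> {h, a, nx, aWeight} = {}"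
  shows "adjacency h a nx s'"
proof -
  have "regs s' r = regs s r" if "r \<in> {rN, rInf, rKeyInf}" for r
    using assms that by (auto simp: unchanged_def)
  moreover have "arrs s' r = arrs s r" if "r \<in> {h, a, nx, aWeight}" for r
    using assms that by (auto simp: unchanged_def)
  ultimately show ?thesis using assms(1) by (simp add: adjacency_def)
qed

lemma word_consts:
  "w > 0" "1 mod 2 ^ w = (1 :: nat)" "Suc 0 mod 2 ^ w = Suc 0" "2 mod 2 ^ w = (2 :: nat)"
  by (rule small_consts, use word in linarith)+

lemma word_bounds:
  "2 * n + 1 < 2 ^ w" "m + 1 < 2 ^ w" "inf_key + W + n < 2 ^ w" "inf_dist \<le> inf_key"
  "x \<le> n * W \<Longrightarrow> x + W < 2 ^ w"
proof -
  show le: "inf_dist \<le> inf_key" unfolding inf_dist_def inf_key_def using mult_le_mono2[OF n_pos, of "n * W + 1"] by simp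
  show "2 * n + 1 < 2 ^ w" "m + 1 < 2 ^ w" using word by linarith+
  show *: "inf_key + W + n < 2 ^ w" unfolding inf_key_def using word by linarith
  show "x + W < 2 ^ w" if "x \<le> n * W" using that * le unfolding inf_dist_def by linarith
qed

abbreviation "upd_time \<equiv> 6 * l + 3"

lemma always_update:
  assumes "v < n" "tournament n (arrs s aTree)" "regs s rNode = n + v" "regs s rKey = x"
  shows "always upd_time tree_update (\<lambda>s'. tournament n (arrs s' aTree) \<and>
    (\<forall>u<n. arrs s' aTree (n + u) = (if u = v then x else arrs s aTree (n + u)))) s"
  using assms word_bounds(1) n_le by (intro always_tree_update) auto

lemma always_relax:
  assumes adj: "adjacency h a nx s" and inv: "dinv X b P src (arrs s aDist) (arrs s aTree)"
    and u: "u \<in> X" "\<forall>x\<in>X. arrs s aDist x \<le> arrs s aDist u" "arrs s aDist u + W \<le> b * W" "b \<le> n"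
    and p: "regs s rPtr = Suc e" "e < m" "ta e = u" "regs s rDistU = arrs s aDist u"
    and arr: "{h, a, nx} \<inter> {aDist, aTree} = {}"
  shows "always (upd_time + 15) (relax h nx) (\<lambda>s'. dinv X b (\<lambda>f. P f \<or> f = e) src (arrs s' aDist) (arrs s' aTree) \<and>
    (\<forall>x\<in>X. arrs s' aDist x = arrs s aDist x) \<and> regs s' rPtr = last_arc ta u e) s"
proof -
  let ?c1 = "Assign rArc (Op Minus (Reg rPtr) (Const 1)) ;;
      Assign rHead (Elem h (Reg rArc)) ;;
      Assign rNew (Op Plus (Reg rDistU) (Elem aWeight (Reg rArc)))"
  let ?c2 = "Store aDist (Reg rHead) (Reg rNew) ;;
      Assign rNode (Op Plus (Reg rN) (Reg rHead)) ;;
      Assign rKey (Op Plus (Op Times (Reg rNew) (Reg rN)) (Reg rHead))"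
  let ?If = "If (Op Less (Reg rNew) (Elem aDist (Reg rHead))) (?c2 ;; tree_update) Skip"
  let ?last = "Assign rPtr (Elem nx (Reg rArc))"
  let ?D = "arrs s aDist" and ?T = "arrs s aTree"
  let ?Q = "\<lambda>s'. dinv X b (\<lambda>f. P f \<or> f = e) src (arrs s' aDist) (arrs s' aTree) \<and>
    (\<forall>x\<in>X. arrs s' aDist x = arrs s aDist x)"
  define s1 where "s1 = exec ?c1 s"
  have un: "u < n" using dinvD(12)[OF inv u(1)] .
  have he: "he e < n" using p he_less by simp
  have we: "wt e \<le> W" using p wt_le by simp
  have "?D u \<le> n * W"
  proof -
    have "?D u \<le> b * W" using u by simp
    also have "\<dots> \<le> n * W" using u by simp
    finally show ?thesis .
  qed
  then have Dw: "?D u + wt e < 2 ^ w" using word_bounds(5) we by fastforce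
  have em: "e < 2 ^ w" using p word_bounds(2) by simp
  have s1: "regs s1 rArc = e" "regs s1 rHead = he e" "regs s1 rNew = ?D u + wt e" "arrs s1 = arrs s"
    "regs s1 rN = n"
    using adj p Dw em word_consts by (simp_all add: s1_def adjacency_def)
  define s2 where "s2 = exec ?c2 s1"
  have If: "always (upd_time + 7) ?If ?Q s1"
  proof -
    have "always (upd_time + 6) (?c2 ;; tree_update) ?Q s1" if less: "?D u + wt e < ?D (he e)"
    proof -
      have "?D (he e) \<le> inf_dist" using dinvD(7)[OF inv he] .
      with less have "(?D u + wt e) * n + he e < inf_key" using he by (intro key_less) auto
      then have "(?D u + wt e) * n + he e < 2 ^ w" "(?D u + wt e) * n < 2 ^ w" "n + he e < 2 ^ w"
        using word_bounds he by auto
      then have s2: "regs s2 rNode = n + he e" "regs s2 rKey = (?D u + wt e) * n + he e"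
        "arrs s2 aTree = ?T" "arrs s2 aDist = ?D(he e := ?D u + wt e)"
        using s1 by (simp_all add: s2_def)
      have "tournament n ?T" using dinvD(2)[OF inv] .
      then have "always upd_time tree_update ?Q s2"
      proof (intro always_weaken[OF ensures_frame[OF always_update]])
        fix s' assume s': "(tournament n (arrs s' aTree) \<and>
          (\<forall>u<n. arrs s' aTree (n + u) = (if u = he e then regs s2 rKey else arrs s2 aTree (n + u)))) \<and>
          unchanged (written_regs tree_update) (written_arrs tree_update) s2 s'"
        then have D': "arrs s' aDist = ?D(he e := ?D u + wt e)"
          using s2 by (simp add: unchanged_def)
        note * = dinv_relax[OF inv u p(2,3) less, of "arrs s' aTree"]
        show "?Q s'" unfolding D' using * s' s2 by auto
      qed (use he s2 in auto)
      then have "always (Suc (cost ?c2 + upd_time)) (?c2 ;; tree_update) ?Q s1"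
        by (intro always_exec_Seq) (simp_all add: s2_def)
      then show ?thesis by (rule ensures_time) simp
    qed
    moreover have "always (upd_time + 6) Skip ?Q s1" if "\<not> ?D u + wt e < ?D (he e)"
    proof -
      have "dinv X b (\<lambda>f. P f \<or> f = e) src ?D ?T"
        using p(3) u(1) that by (intro dinv_relaxed[OF inv]) auto
      then have "always 0 Skip ?Q s1" using s1(4) by (intro ensures_Skip) simp_all
      then show ?thesis by (rule ensures_time) simp
    qed
    moreover have "evl s1 (Op Less (Reg rNew) (Elem aDist (Reg rHead))) \<noteq> 0 \<longleftrightarrow> ?D u + wt e < ?D (he e)"
      using s1 word_consts by simp
    ultimately have "always (Suc (upd_time + 6)) ?If ?Q s1"
      by (intro ensures_If) auto
    then show ?thesis by (rule ensures_time) simp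
  qed
  have "always (Suc (upd_time + 7 + 1)) (?If ;; ?last) (\<lambda>s'. ?Q s' \<and> regs s' rPtr = last_arc ta u e) s1"
  proof (rule always_Seq[OF If])
    fix s' assume s': "?Q s'" "unchanged (written_regs ?If) (written_arrs ?If) s1 s'"
    have "adjacency h a nx s1"
      using adj s1 p by (intro adjacency_unchanged[OF adj, of "{rArc, rHead, rNew}" "{}"])
        (auto simp: unchanged_def s1_def)
    then have "adjacency h a nx s'"
      using arr by (intro adjacency_unchanged[OF _ s'(2)]) auto
    moreover have "regs s' rArc = e" using s'(2) s1 by (simp add: unchanged_def)
    ultimately show "always 1 ?last (\<lambda>s'. ?Q s' \<and> regs s' rPtr = last_arc ta u e) s'"
      using s'(1) p by (intro ensures_Assign) (auto simp: adjacency_def)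
  qed
  then have "always (Suc (cost ?c1 + Suc (upd_time + 7 + 1))) (relax h nx) (\<lambda>s'. ?Q s' \<and> regs s' rPtr = last_arc ta u e) s"
    unfolding relax_def by (intro always_exec_Seq) (simp_all add: s1_def)
  then show ?thesis by (rule always_weaken) auto
qed

lemma always_extract_min:
  assumes adj: "adjacency h a nx s" and inv: "dinv X (card X) (\<lambda>e. ta e \<in> X) src (arrs s aDist) (arrs s aTree)"
    and less: "arrs s aTree 1 < inf_key" and u: "u = arrs s aTree 1 mod n"
    and arr: "{h, a, nx} \<inter> {aDist, aTree} = {}"
  shows "always (upd_time + 10) (extract_min a)
    (\<lambda>s'. dinv (insert u X) (Suc (card X)) (\<lambda>e. ta e \<in> X) src (arrs s' aDist) (arrs s' aTree) \<and>
       regs s' rPtr = last_arc ta u m \<and> regs s' rU = u \<and> regs s' rDistU = arrs s aDist u) s"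
proof -
  let ?c1 = "Assign rU (Op Mod (Elem aTree (Const 1)) (Reg rN)) ;;
      Assign rDistU (Elem aDist (Reg rU)) ;;
      Assign rNode (Op Plus (Reg rN) (Reg rU)) ;;
      Assign rKey (Reg rKeyInf)"
  let ?Q = "\<lambda>s'. dinv (insert u X) (Suc (card X)) (\<lambda>e. ta e \<in> X) src (arrs s' aDist) (arrs s' aTree)"
  let ?Q' = "\<lambda>s'. ?Q s' \<and> regs s' rPtr = last_arc ta u m \<and> regs s' rU = u \<and> regs s' rDistU = arrs s aDist u"
  define s1 where "s1 = exec ?c1 s"
  note ext = dinv_extract[OF inv less u]
  have "u < 2 ^ w" "n + u < 2 ^ w" using ext(1) word_bounds(1) by linarith+
  then have s1: "regs s1 rU = u" "regs s1 rDistU = arrs s aDist u" "regs s1 rNode = n + u"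
    "regs s1 rKey = inf_key" "arrs s1 = arrs s"
    using adj word_consts u by (simp_all add: s1_def adjacency_def)
  have "always upd_time tree_update ?Q s1"
  proof (rule always_weaken[OF ensures_frame[OF always_update]])
    show "tournament n (arrs s1 aTree)" using dinvD(2)[OF inv] s1 by simp
    fix s' assume s': "(tournament n (arrs s' aTree) \<and>
          (\<forall>v<n. arrs s' aTree (n + v) = (if v = u then inf_key else arrs s1 aTree (n + v)))) \<and>
          unchanged (written_regs tree_update) (written_arrs tree_update) s1 s'"
    then have "arrs s' aDist = arrs s aDist" using s1 by (simp add: unchanged_def)
    with s' ext(6)[of "arrs s' aTree"] s1 show "?Q s'" by simp
  qed (use s1 ext in auto)
  then have "always (Suc (upd_time + 1)) (tree_update ;; Assign rPtr (Elem a (Reg rU))) ?Q' s1"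
  proof (rule always_Seq)
    fix s' assume s': "?Q s'" "unchanged (written_regs tree_update) (written_arrs tree_update) s1 s'"
    have "adjacency h a nx s1"
      using arr by (intro adjacency_unchanged[OF adj, of "{rU, rDistU, rNode, rKey}" "{}"])
        (auto simp: unchanged_def s1_def)
    then have "adjacency h a nx s'"
      using arr by (intro adjacency_unchanged[OF _ s'(2)]) auto
    then show "always 1 (Assign rPtr (Elem a (Reg rU))) ?Q' s'"
      using s' s1 ext(1) by (intro ensures_Assign) (auto simp: adjacency_def unchanged_def)
  qed
  then have "always (Suc (cost ?c1 + Suc (upd_time + 1))) (extract_min a) ?Q' s"
    unfolding extract_min_def by (intro always_exec_Seq) (simp_all add: s1_def)
  then show ?thesis by (rule ensures_time) simp
qed

text \<open>Each relaxation moves the pointer to the next lower arc of \<open>u\<close>, and by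
  \<open>last_arc_gap\<close> none is skipped. The arcs of \<open>u\<close> below the pointer pay
  for the iterations to come.\<close>

lemma always_relax_all:
  assumes adj: "adjacency h a nx s"
    and inv: "dinv (insert u X) (Suc (card X)) (\<lambda>e. ta e \<in> X) src (arrs s aDist) (arrs s aTree)"
    and u: "\<forall>x\<in>insert u X. arrs s aDist x \<le> arrs s aDist u" "arrs s aDist u + W \<le> Suc (card X) * W" "Suc (card X) \<le> n"
    and p: "regs s rPtr = last_arc ta u m" "regs s rDistU = arrs s aDist u"
    and arr: "{h, a, nx} \<inter> {aDist, aTree} = {}"
  shows "always (Suc (card {e. e < m \<and> ta e = u} * (upd_time + 17))) (While (Reg rPtr) (relax h nx))
    (\<lambda>s'. dinv (insert u X) (Suc (card X)) (\<lambda>e. ta e \<in> insert u X) src (arrs s' aDist) (arrs s' aTree)) s"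
proof -
  \<comment> \<open>With \<open>rPtr = Suc e\<close> the arc \<open>e\<close> comes next, so the
    arcs of \<open>u\<close> with numbers at least \<open>rPtr\<close> are done.\<close>
  define I where "I = (\<lambda>s' :: store.
    dinv (insert u X) (Suc (card X)) (\<lambda>e. ta e \<in> X \<or> (ta e = u \<and> regs s' rPtr \<le> e)) src (arrs s' aDist) (arrs s' aTree) \<and>
    (\<forall>x\<in>insert u X. arrs s' aDist x = arrs s aDist x) \<and>
    (\<exists>j\<le>m. regs s' rPtr = last_arc ta u j))"
  define T where "T = (\<lambda>s' :: store. card {e. e < regs s' rPtr \<and> ta e = u} * (upd_time + 17))"
  have "always (Suc (T s)) (While (Reg rPtr) (relax h nx)) (\<lambda>s'. I s' \<and> evl s' (Reg rPtr) = 0) s"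
  proof (rule ensures_While[where I = I and T = T and F = "\<lambda>_. 0"])
    have "dinv (insert u X) (Suc (card X)) (\<lambda>e. ta e \<in> X \<or> (ta e = u \<and> regs s rPtr \<le> e)) src (arrs s aDist) (arrs s aTree)"
      using last_arc_gap p by (intro dinv_mono[OF inv]) metis
    then show "I s" using p by (auto simp: I_def)
  next
    fix s' assume I: "I s'" and c: "evl s' (Reg rPtr) \<noteq> 0"
      and un: "unchanged (written_regs (relax h nx)) (written_arrs (relax h nx)) s s'"
    from I obtain j where j: "j \<le> m" "regs s' rPtr = last_arc ta u j" by (auto simp: I_def)
    define e where "e = regs s' rPtr - 1"
    have e: "regs s' rPtr = Suc e" using c by (simp add: e_def)
    have em: "e < m" using e j last_arc_le[of ta u j] by simp
    have te: "ta e = u" using last_arc_pos[of ta u j] c j by (simp add: e_def)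
    have adj': "adjacency h a nx s'" using arr by (intro adjacency_unchanged[OF adj un]) auto
    have D: "regs s' rDistU = arrs s' aDist u" using un I p by (auto simp: I_def unchanged_def)
    have "always (upd_time + 15) (relax h nx) (\<lambda>s''.
       dinv (insert u X) (Suc (card X)) (\<lambda>f. (ta f \<in> X \<or> (ta f = u \<and> regs s' rPtr \<le> f)) \<or> f = e) src (arrs s'' aDist) (arrs s'' aTree) \<and>
       (\<forall>x\<in>insert u X. arrs s'' aDist x = arrs s' aDist x) \<and> regs s'' rPtr = last_arc ta u e) s'"
    proof (rule always_relax[OF adj'])
      show "\<forall>x\<in>insert u X. arrs s' aDist x \<le> arrs s' aDist u"
        "arrs s' aDist u + W \<le> Suc (card X) * W"
        using I u by (simp_all add: I_def)
    qed (use I u e em te D arr in \<open>simp_all add: I_def\<close>)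
    then have "always (upd_time + 15) (relax h nx) (\<lambda>s''. I s'' \<and> T s'' + (upd_time + 15) + 2 \<le> T s') s'"
    proof (rule always_weaken)
      fix s'' :: store assume s'': "dinv (insert u X) (Suc (card X)) (\<lambda>f. (ta f \<in> X \<or> (ta f = u \<and> regs s' rPtr \<le> f)) \<or> f = e) src (arrs s'' aDist) (arrs s'' aTree) \<and>
       (\<forall>x\<in>insert u X. arrs s'' aDist x = arrs s' aDist x) \<and> regs s'' rPtr = last_arc ta u e"
      have "f < e \<or> f = e \<or> Suc e \<le> f" for f by linarith
      then have "dinv (insert u X) (Suc (card X)) (\<lambda>f. ta f \<in> X \<or> (ta f = u \<and> regs s'' rPtr \<le> f)) src (arrs s'' aDist) (arrs s'' aTree)"
        using last_arc_gap[of ta u e] s'' e by (intro dinv_mono[OF conjunct1[OF s'']]) metis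
      moreover have "\<exists>j\<le>m. regs s'' rPtr = last_arc ta u j" using s'' em by (intro exI[of _ e]) auto
      ultimately have "I s''" using I s'' by (auto simp: I_def)
      moreover have "T s'' + (upd_time + 15) + 2 \<le> T s'"
      proof -
        let ?A = "{f. f < regs s'' rPtr \<and> ta f = u}" and ?B = "{f. f < regs s' rPtr \<and> ta f = u}"
        have "insert e ?A \<subseteq> ?B"
          using te e s'' last_arc_le[of ta u e] by auto
        then have "card (insert e ?A) \<le> card ?B" by (intro card_mono) auto
        moreover have "e \<notin> ?A" using s'' last_arc_le[of ta u e] by auto
        ultimately have "Suc (card ?A) \<le> card ?B" by simp
        then have "Suc (card ?A) * (upd_time + 17) \<le> card ?B * (upd_time + 17)" by (rule mult_le_mono1)
        then show ?thesis by (simp add: T_def)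
      qed
      ultimately show "I s'' \<and> T s'' + (upd_time + 15) + 2 \<le> T s'" by simp
    qed simp
    then show "\<exists>t. always t (relax h nx) (\<lambda>s''. I s'' \<and> T s'' + t + 2 \<le> T s') s'" by blast
  qed
  then show ?thesis
  proof (rule always_weaken)
    fix s' assume s': "I s' \<and> evl s' (Reg rPtr) = 0"
    then have "dinv (insert u X) (Suc (card X)) (\<lambda>e. ta e \<in> X \<or> (ta e = u \<and> regs s' rPtr \<le> e)) src (arrs s' aDist) (arrs s' aTree)"
      unfolding I_def by (elim conjE)
    then show "dinv (insert u X) (Suc (card X)) (\<lambda>e. ta e \<in> insert u X) src (arrs s' aDist) (arrs s' aTree)"
      by (rule dinv_mono) (use s' in auto)
  next
    have "card {e. e < regs s rPtr \<and> ta e = u} \<le> card {e. e < m \<and> ta e = u}"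
      using p last_arc_le[of ta u m] by (intro card_mono) auto
    then show "Suc (T s) \<le> Suc (card {e. e < m \<and> ta e = u} * (upd_time + 17))"
      unfolding T_def by (simp del: One_nat_def)
  qed
qed

text \<open>A vertex is settled at most once and its list is scanned only then, so all scans
  together visit at most \<open>m\<close> arcs. Accordingly \<open>T\<close> charges the unsettled
  vertices and the arcs with unsettled tails.\<close>

lemma always_settle_all:
  assumes adj: "adjacency h a nx s" and inv: "dinv {} 0 (\<lambda>_. False) src (arrs s aDist) (arrs s aTree)"
    and src: "src < n" and arr: "{h, a, nx} \<inter> {aDist, aTree} = {}"
  shows "always (Suc (n * (upd_time + 14) + m * (upd_time + 17)))
    (While (Op Less (Elem aTree (Const 1)) (Reg rKeyInf)) (extract_min a ;; While (Reg rPtr) (relax h nx)))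
    (\<lambda>s'. \<forall>v<n. arrs s' aDist v = dst src v) s"
proof -
  let ?e = "Op Less (Elem aTree (Const 1)) (Reg rKeyInf)"
  let ?c = "extract_min a ;; While (Reg rPtr) (relax h nx)"
  define st where "st = (\<lambda>s' :: store. {v. v < n \<and> arrs s' aDist v < inf_dist \<and> arrs s' aTree (n + v) = inf_key})"
  define I where "I = (\<lambda>s' :: store. dinv (st s') (card (st s')) (\<lambda>e. ta e \<in> st s') src (arrs s' aDist) (arrs s' aTree))"
  define T where "T = (\<lambda>s' :: store. (n - card (st s')) * (upd_time + 14) + card {e. e < m \<and> ta e \<notin> st s'} * (upd_time + 17))"
  have st: "X = st s'" if "dinv X b P src (arrs s' aDist) (arrs s' aTree)" for X b P s'
    using dinv_settled[OF that] by (simp add: st_def)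
  have adj': "adjacency h a nx s'" if "unchanged (written_regs ?c) (written_arrs ?c) s s'" for s'
    using arr by (intro adjacency_unchanged[OF adj that]) auto
  have cond: "evl s' ?e \<noteq> 0 \<longleftrightarrow> arrs s' aTree 1 < inf_key" if "adjacency h a nx s'" for s'
    using word_consts that by (simp add: adjacency_def)
  have "always (Suc (T s)) (While ?e ?c) (\<lambda>s'. I s' \<and> evl s' ?e = 0) s"
  proof (rule ensures_While[where I = I and T = T and F = "\<lambda>_. 0"])
    show "I s" using inv st[OF inv] by (simp add: I_def)
  next
    fix s' assume I: "I s'" and c: "evl s' ?e \<noteq> 0"
      and un: "unchanged (written_regs ?c) (written_arrs ?c) s s'"
    define X where "X = st s'"
    define u where "u = arrs s' aTree 1 mod n"
    note adj1 = adj'[OF un]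
    have inv1: "dinv X (card X) (\<lambda>e. ta e \<in> X) src (arrs s' aDist) (arrs s' aTree)"
      using I by (simp add: I_def X_def)
    have less: "arrs s' aTree 1 < inf_key" using c cond[OF adj1] by blast
    note ext = dinv_extract[OF inv1 less u_def]
    have cX: "card X < n" using card_settled_less[OF inv1] ext by auto
    have finX: "finite X" using dinvD(1)[OF inv1] finite_subset by blast
    let ?k = "card {e. e < m \<and> ta e = u}"
    have "always (Suc (upd_time + 10 + Suc (?k * (upd_time + 17)))) ?c
       (\<lambda>s''. dinv (insert u X) (Suc (card X)) (\<lambda>e. ta e \<in> insert u X) src (arrs s'' aDist) (arrs s'' aTree)) s'"
    proof (rule always_Seq[OF always_extract_min[OF adj1 inv1 less u_def arr]])
      fix s2 assume s2: "dinv (insert u X) (Suc (card X)) (\<lambda>e. ta e \<in> X) src (arrs s2 aDist) (arrs s2 aTree) \<and>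
        regs s2 rPtr = last_arc ta u m \<and> regs s2 rU = u \<and> regs s2 rDistU = arrs s' aDist u"
        "unchanged (written_regs (extract_min a)) (written_arrs (extract_min a)) s' s2"
      have D: "arrs s2 aDist = arrs s' aDist" using s2(2) by (simp add: unchanged_def)
      have adj2: "adjacency h a nx s2" using arr by (intro adjacency_unchanged[OF adj1 s2(2)]) auto
      show "always (Suc (?k * (upd_time + 17))) (While (Reg rPtr) (relax h nx))
         (\<lambda>s'. dinv (insert u X) (Suc (card X)) (\<lambda>e. ta e \<in> insert u X) src (arrs s' aDist) (arrs s' aTree)) s2"
        using ext cX s2(1) by (intro always_relax_all[OF adj2 conjunct1[OF s2(1)]] arr) (simp_all add: D)
    qed
    then have "always (upd_time + 12 + ?k * (upd_time + 17)) ?c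
      (\<lambda>s''. I s'' \<and> T s'' + (upd_time + 12 + ?k * (upd_time + 17)) + 2 \<le> T s') s'"
    proof (rule always_weaken)
      fix s'' :: store assume inv2: "dinv (insert u X) (Suc (card X)) (\<lambda>e. ta e \<in> insert u X) src (arrs s'' aDist) (arrs s'' aTree)"
      have st'': "st s'' = insert u X" using st[OF inv2] by simp
      have card: "card (insert u X) = Suc (card X)" using ext finX by simp
      have "I s''" unfolding I_def st'' card using inv2 .
      moreover have "T s'' + (upd_time + 12 + ?k * (upd_time + 17)) + 2 \<le> T s'"
      proof -
        have "{e. e < m \<and> ta e \<notin> X} = {e. e < m \<and> ta e \<notin> insert u X} \<union> {e. e < m \<and> ta e = u}"
          using ext by auto
        then have "card {e. e < m \<and> ta e \<notin> X} = card {e. e < m \<and> ta e \<notin> insert u X} + ?k"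
          by (simp only:) (intro card_Un_disjoint, auto)
        moreover have "n - card X = Suc (n - Suc (card X))" using cX by simp
        ultimately show ?thesis
          unfolding T_def st'' card X_def[symmetric] by (simp add: add_mult_distrib)
      qed
      ultimately show "I s'' \<and> T s'' + (upd_time + 12 + ?k * (upd_time + 17)) + 2 \<le> T s'" by simp
    qed simp
    then show "\<exists>t. always t ?c (\<lambda>s''. I s'' \<and> T s'' + t + 2 \<le> T s') s'" by blast
  qed
  from ensures_frame[OF this] show ?thesis
  proof (rule always_weaken)
    fix s' assume s': "(I s' \<and> evl s' ?e = 0) \<and> unchanged (written_regs (While ?e ?c)) (written_arrs (While ?e ?c)) s s'"
    then have "adjacency h a nx s'" using adj' by simp
    with s' cond have "\<not> arrs s' aTree 1 < inf_key" by blast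
    with s' show "\<forall>v<n. arrs s' aDist v = dst src v"
      using dinv_final src by (auto simp: I_def)
  next
    have "card {e. e < m \<and> ta e \<notin> st s} \<le> card {..<m}" by (intro card_mono) auto
    then show "Suc (T s) \<le> Suc (n * (upd_time + 14) + m * (upd_time + 17))"
      unfolding T_def by (intro Suc_le_mono[THEN iffD2] add_mono mult_le_mono1) simp_all
  qed
qed

definition "dijkstra_time = (n + m) * (12 * l + 44)"

theorem always_dijkstra:
  assumes adj: "adjacency h a nx s" and src: "regs s rSrc = src" "src < n"
    and arr: "{h, a, nx} \<inter> {aDist, aTree} = {}"
  shows "always dijkstra_time (dijkstra h a nx) (\<lambda>s'. \<forall>v<n. arrs s' aDist v = dst src v) s"
proof -
  let ?b = "Store aDist (Reg rI) (Reg rInf) ;;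
        Store aTree (Reg rI) (Reg rKeyInf) ;;
        Store aTree (Op Plus (Reg rN) (Reg rI)) (Reg rKeyInf)"
  let ?c2 = "Store aDist (Reg rSrc) (Const 0) ;;
      Assign rNode (Op Plus (Reg rN) (Reg rSrc)) ;;
      Assign rKey (Reg rSrc)"
  let ?W = "While (Op Less (Elem aTree (Const 1)) (Reg rKeyInf)) (extract_min a ;; While (Reg rPtr) (relax h nx))"
  let ?Q = "\<lambda>s'. \<forall>v<n. arrs s' aDist v = dst src v"
  let ?tw = "Suc (n * (upd_time + 14) + m * (upd_time + 17))"
  define I where "I = (\<lambda>i (s' :: store). \<forall>v<i. arrs s' aDist v = inf_dist \<and> arrs s' aTree v = inf_key \<and> arrs s' aTree (n + v) = inf_key)"
  have "always (n * (5 + 4) + 3) (For rI rN ?b) (I n) s"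
  proof (rule always_For[where I = I])
    fix i s' assume i: "i < n" "I i s'" "regs s' rI = i" 
      and un: "unchanged (insert rI (written_regs ?b)) (written_arrs ?b) s s'"
    have "regs s' rN = n" "regs s' rInf = inf_dist" "regs s' rKeyInf = inf_key"
      using un adj by (auto simp: unchanged_def adjacency_def)
    moreover have "n + i < 2 ^ w" using i word_bounds(1) by linarith
    ultimately have "I (Suc i) (exec ?b s')"
      using i by (auto simp: I_def less_Suc_eq)
    then have "always (cost ?b) ?b (I (Suc i)) s'" by (intro always_exec) simp_all
    then show "always 5 ?b (I (Suc i)) s'" by (rule ensures_time) simp
  qed (use adj word_bounds(1) word_consts in \<open>auto simp: I_def adjacency_def\<close>)
  then have "always (Suc (n * (5 + 4) + 3 + Suc (cost ?c2 + Suc (upd_time + ?tw)))) (dijkstra h a nx) ?Q s"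
    unfolding dijkstra_def
  proof (rule always_Seq)
    fix s1 assume I: "I n s1" and un1: "unchanged (written_regs (For rI rN ?b)) (written_arrs (For rI rN ?b)) s s1"
    have adj1: "adjacency h a nx s1" using arr by (intro adjacency_unchanged[OF adj un1]) auto
    have src1: "regs s1 rSrc = src" using un1 src by (simp add: unchanged_def)
    define s2 where "s2 = exec ?c2 s1"
    have "n + src < 2 ^ w" using src word_bounds(1) by linarith
    then have s2: "regs s2 rNode = n + src" "regs s2 rKey = src" "arrs s2 aTree = arrs s1 aTree"
      "arrs s2 aDist = (arrs s1 aDist)(src := 0)"
      using src1 adj1 by (simp_all add: s2_def adjacency_def)
    have adj2: "adjacency h a nx s2"
      using arr by (intro adjacency_unchanged[OF adj1, of "{rNode, rKey}" "{aDist}"]) (auto simp: s2_def unchanged_def)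
    have "arrs s1 aTree k = inf_key" if "k < 2 * n" for k
    proof (cases "k < n")
      case False
      then have "arrs s1 aTree (n + (k - n)) = inf_key" using I that unfolding I_def by (metis add_diff_inverse_nat add_less_cancel_left mult_2)
      with False show ?thesis by simp
    qed (use I in \<open>simp add: I_def\<close>)
    then have "tournament n (arrs s1 aTree)"
      by (simp add: tournament_def)
    then have "always upd_time tree_update (\<lambda>s'. tournament n (arrs s' aTree) \<and>
      (\<forall>u<n. arrs s' aTree (n + u) = (if u = src then src else arrs s2 aTree (n + u)))) s2"
      using src s2 by (intro always_update) auto
    then have "always (Suc (upd_time + ?tw)) (tree_update ;; ?W) ?Q s2"
    proof (rule always_Seq)
      fix s3 assume s3: "tournament n (arrs s3 aTree) \<and>
        (\<forall>u<n. arrs s3 aTree (n + u) = (if u = src then src else arrs s2 aTree (n + u)))"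
        and un3: "unchanged (written_regs tree_update) (written_arrs tree_update) s2 s3"
      have adj3: "adjacency h a nx s3" using arr by (intro adjacency_unchanged[OF adj2 un3]) auto
      have "arrs s3 aDist = arrs s2 aDist" using un3 by (simp add: unchanged_def)
      then have "dinv {} 0 (\<lambda>_. False) src (arrs s3 aDist) (arrs s3 aTree)"
        using s3 s2 I src by (intro dinv_init) (auto simp: I_def)
      then show "always ?tw ?W ?Q s3" by (intro always_settle_all adj3 src arr)
    qed
    then show "always (Suc (cost ?c2 + Suc (upd_time + ?tw))) (?c2 ;; tree_update ;; ?W) ?Q s1"
      by (intro always_exec_Seq) (simp_all add: s2_def)
  qed
  then show ?thesis
  proof (rule ensures_time)
    \<comment> \<open>The cost of the set-up outside the loops is charged to the vertices, of which
      there is at least one.\<close>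
    have "6 * l + 15 \<le> n * (6 * l + 15)"
      using mult_le_mono1[OF n_pos, of "6 * l + 15"] by simp
    then show "Suc (n * (5 + 4) + 3 + Suc (cost ?c2 + Suc (upd_time + ?tw))) \<le> dijkstra_time"
      unfolding dijkstra_time_def by (simp add: algebra_simps)
  qed
qed

end

section \<open>The algorithm\<close>

abbreviation (input) "rL \<equiv> 4 :: nat"
abbreviation (input) "rW \<equiv> 5 :: nat"
abbreviation (input) "rPow \<equiv> 6 :: nat"
abbreviation (input) "rK \<equiv> 20 :: nat"
abbreviation (input) "rLen \<equiv> 21 :: nat"
abbreviation (input) "rPhase \<equiv> 22 :: nat"
abbreviation (input) "rJ \<equiv> 23 :: nat"
abbreviation (input) "rIdx \<equiv> 24 :: nat"
abbreviation (input) "rRad \<equiv> 25 :: nat"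
abbreviation (input) "rNewLen \<equiv> 26 :: nat"
abbreviation (input) "aTail \<equiv> 0 :: nat"
abbreviation (input) "aHead \<equiv> 1 :: nat"
abbreviation (input) "aS \<equiv> 3 :: nat"
abbreviation (input) "aEst \<equiv> 4 :: nat"
abbreviation (input) "aFlag \<equiv> 5 :: nat"
abbreviation (input) "aFirstOut \<equiv> 8 :: nat"
abbreviation (input) "aNextOut \<equiv> 9 :: nat"
abbreviation (input) "aFirstIn \<equiv> 10 :: nat"
abbreviation (input) "aNextIn \<equiv> 11 :: nat"
abbreviation (input) "aMin \<equiv> 12 :: nat"
abbreviation (input) "aU \<equiv> 13 :: nat"

abbreviation "dijkstra_from \<equiv> dijkstra aHead aFirstOut aNextOut"
abbreviation "dijkstra_to \<equiv> dijkstra aTail aFirstIn aNextIn"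

definition max_est :: com where
  "max_est = For rI rN
     (If (Op Less (Elem aEst (Reg rI)) (Elem aDist (Reg rI)))
        (Store aEst (Reg rI) (Elem aDist (Reg rI))) Skip)"

definition min_min :: com where
  "min_min = For rI rN
     (If (Op Less (Elem aDist (Reg rI)) (Elem aMin (Reg rI)))
        (Store aMin (Reg rI) (Elem aDist (Reg rI))) Skip)"

text \<open>Both directions are needed: distances from the sample lower \<open>aMin\<close>, which
  determines the radius, while distances to the sample raise the estimates.\<close>

definition process_sample :: com where
  "process_sample =
     Assign rSrc (Elem aU (Reg rIdx)) ;;
     dijkstra_from ;; min_min ;; dijkstra_to ;; max_est"

definition farthest :: com where
  "farthest = For rI rN
     (If (Elem aS (Reg rI))
        (If (Op Less (Reg rRad) (Elem aMin (Reg rI)))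
           (Assign rRad (Elem aMin (Reg rI)) ;; Assign rSrc (Reg rI)) Skip)
        Skip)"

definition keep_near :: com where
  "keep_near = For rI rLen
     (If (Op Less (Elem aDist (Elem aU (Reg rI))) (Reg rRad))
        (Store aU (Reg rNewLen) (Elem aU (Reg rI)) ;;
         Assign rNewLen (Op Plus (Reg rNewLen) (Const 1)))
        Skip)"

text \<open>The search for the farthest vertex starts at the first vertex of \<open>U\<close>
  instead of a dummy, so that \<open>rSrc\<close> lies in \<open>S\<close> and \<open>rRad\<close>
  is its entry of \<open>aMin\<close> even if no other entry is larger.\<close>

definition prune :: com where
  "prune =
     (Assign rSrc (Elem aU (Const 0)) ;; Assign rRad (Elem aMin (Reg rSrc))) ;;
     farthest ;; dijkstra_to ;; max_est ;;
     Assign rNewLen (Const 0) ;; keep_near ;; Assign rLen (Reg rNewLen)"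

definition phase :: com where
  "phase =
     Assign rPhase (Op Minus (Reg rPhase) (Const 1)) ;;
     For rI rN (Store aMin (Reg rI) (Reg rInf)) ;;
     For rJ rK (Rand rIdx (Reg rLen) ;; process_sample) ;;
     prune"

definition read_arcs :: com where
  "read_arcs = For rI rM
     (If (Op Less (Reg rW) (Elem aWeight (Reg rI))) (Assign rW (Elem aWeight (Reg rI))) Skip ;;
      Store aNextOut (Reg rI) (Elem aFirstOut (Elem aTail (Reg rI))) ;;
      Store aFirstOut (Elem aTail (Reg rI)) (Op Plus (Reg rI) (Const 1)) ;;
      Store aNextIn (Reg rI) (Elem aFirstIn (Elem aHead (Reg rI))) ;;
      Store aFirstIn (Elem aHead (Reg rI)) (Op Plus (Reg rI) (Const 1)))"

definition log_loop :: com where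
  "log_loop = While (Op Less (Reg rPow) (Op Plus (Reg rN) (Const 1)))
     (Assign rPow (Op Plus (Reg rPow) (Reg rPow)) ;; Assign rL (Op Plus (Reg rL) (Const 1)))"

definition collect_S :: com where
  "collect_S = For rI rN
     (If (Elem aS (Reg rI))
        (Store aU (Reg rLen) (Reg rI) ;; Assign rLen (Op Plus (Reg rLen) (Const 1)))
        Skip)"

definition prepare :: "nat \<Rightarrow> com" where
  "prepare kc =
     read_arcs ;;
     (Assign rInf (Op Plus (Op Times (Reg rN) (Reg rW)) (Const 1)) ;;
      Assign rKeyInf (Op Times (Reg rInf) (Reg rN)) ;;
      Assign rPow (Const 1)) ;;
     log_loop ;;
     (Assign rK (Op Times (Const kc) (Reg rL)) ;; Assign rPhase (Reg rL)) ;;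
     collect_S"

definition flag_infinite :: com where
  "flag_infinite = For rI rN
     (If (Op Less (Elem aEst (Reg rI)) (Reg rInf)) Skip (Store aFlag (Reg rI) (Const 1)))"

text \<open>The product in the loop test acts as a conjunction: it is nonzero iff phases and
  vertices both remain. It must not wrap around, whence the assumption
  \<open>word_n\<close>.\<close>

definition eccentricities :: "nat \<Rightarrow> com" where
  "eccentricities kc =
     prepare kc ;;
     While (Op Times (Reg rPhase) (Reg rLen)) phase ;;
     flag_infinite"

lemma written_parts [simp]:
  "written_regs max_est = {rI}" "written_arrs max_est = {aEst}"
  "written_regs min_min = {rI}" "written_arrs min_min = {aMin}"
  "written_regs farthest = {rI, rRad, rSrc}" "written_arrs farthest = {}"
  "written_regs keep_near = {rI, rNewLen}" "written_arrs keep_near = {aU}"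
  "written_regs read_arcs = {rI, rW}"
  "written_arrs read_arcs = {aFirstOut, aNextOut, aFirstIn, aNextIn}"
  "written_regs log_loop = {rPow, rL}" "written_arrs log_loop = {}"
  "written_regs collect_S = {rI, rLen}" "written_arrs collect_S = {aU}"
  "written_regs flag_infinite = {rI}" "written_arrs flag_infinite = {aFlag}"
  by (auto simp: max_est_def min_min_def farthest_def keep_near_def read_arcs_def log_loop_def
      collect_S_def flag_infinite_def)

lemma written_process_sample [simp]:
  "written_regs process_sample = {rSrc, rNode, rKey, rI, rU, rDistU, rPtr, rArc, rHead, rNew}"
  "written_arrs process_sample = {aDist, aTree, aEst, aMin}"
  by (auto simp: process_sample_def)

lemma written_prune [simp]:
  "written_regs prune = {rI, rSrc, rNode, rKey, rU, rDistU, rPtr, rArc, rHead, rNew, rRad, rNewLen, rLen}"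
  "written_arrs prune = {aDist, aTree, aEst, aU}"
  by (auto simp: prune_def)

lemma written_phase [simp]:
  "written_regs phase = {rPhase, rI, rJ, rIdx, rSrc, rNode, rKey, rU, rDistU, rPtr, rArc, rHead, rNew,
     rRad, rNewLen, rLen}"
  "written_arrs phase = {aDist, aTree, aEst, aMin, aU}"
  by (auto simp: phase_def)

section \<open>Halving the number of missed vertices by a random draw\<close>

text \<open>
  Here \<open>d i\<close> is the distance from the \<open>i\<close>-th vertex of \<open>U\<close> to a fixed vertex. If \<open>few_beyond\<close> holds
  for the distance \<open>r\<close> from the set of samples, the samples have missed the closest half of \<open>U\<close>.
\<close>

definition few_beyond :: "nat \<Rightarrow> (nat \<Rightarrow> nat) \<Rightarrow> nat \<Rightarrow> bool" where
  "few_beyond N d r \<longleftrightarrow> 2 * card {i. i < N \<and> r \<le> d i} < N"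

lemma few_beyond_mono: "few_beyond N d r \<Longrightarrow> r \<le> r' \<Longrightarrow> few_beyond N d r'"
proof -
  assume "few_beyond N d r" "r \<le> r'"
  moreover from this have "card {i. i < N \<and> r' \<le> d i} \<le> card {i. i < N \<and> r \<le> d i}"
    by (intro card_mono) auto
  ultimately show ?thesis by (simp add: few_beyond_def)
qed

text \<open>Among the indices counted here take \<open>k\<close> with least \<open>d k\<close>. All
  of them lie in \<open>{i. i < N \<and> d k \<le> d i}\<close>, which has fewer than
  \<open>N / 2\<close> elements because \<open>k\<close> itself is counted. So a uniform draw is
  unlucky with probability at most 1/2, ties included.\<close>

lemma card_few_beyond: "2 * card {k. k < N \<and> few_beyond N d (d k)} \<le> N"
proof (cases "{k. k < N \<and> few_beyond N d (d k)} = {}")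
  case False
  let ?B = "{k. k < N \<and> few_beyond N d (d k)}"
  have fin: "finite ?B" by simp
  with False obtain k where k: "k \<in> ?B" "\<forall>j\<in>?B. d k \<le> d j"
    using ex_min_if_finite[of "d ` ?B"] by (metis (no_types, lifting) arg_min_if_finite(1) arg_min_least)
  then have "card ?B \<le> card {i. i < N \<and> d k \<le> d i}" by (intro card_mono) auto
  with k show ?thesis by (auto simp: few_beyond_def)
qed (metis card.empty mult_0_right zero_le)

text \<open>A draw at least halves the expected number of missed \<open>v\<close>. After swapping
  the sums, each \<open>v\<close> still missed remains so for at most \<open>N / 2\<close> draws,
  and a \<open>v\<close> already hit stays hit, because a minimum can only lower its
  distance.\<close>

lemma sum_card_few_beyond:
  assumes "finite S"
  shows "2 * (\<Sum>k<N. card {v\<in>S. few_beyond N (d v) (min (M v) (d v k))}) \<le> N * card {v\<in>S. few_beyond N (d v) (M v)}"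
proof -
  have "(\<Sum>k<N. card {v\<in>S. few_beyond N (d v) (min (M v) (d v k))}) =
      (\<Sum>k<N. \<Sum>v\<in>S. if few_beyond N (d v) (min (M v) (d v k)) then 1 else 0)"
    using assms by (simp add: sum.If_cases Int_def)
  also have "\<dots> = (\<Sum>v\<in>S. \<Sum>k<N. if few_beyond N (d v) (min (M v) (d v k)) then 1 else 0)"
    by (rule sum.swap)
  also have "\<dots> = (\<Sum>v\<in>S. card {k. k < N \<and> few_beyond N (d v) (min (M v) (d v k))})"
    by (simp add: sum.If_cases Int_def)
  finally have "2 * (\<Sum>k<N. card {v\<in>S. few_beyond N (d v) (min (M v) (d v k))}) =
      (\<Sum>v\<in>S. 2 * card {k. k < N \<and> few_beyond N (d v) (min (M v) (d v k))})"
    by (simp add: sum_distrib_left)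
  also have "\<dots> \<le> (\<Sum>v\<in>S. if few_beyond N (d v) (M v) then N else 0)"
  proof (rule sum_mono)
    fix v assume "v \<in> S"
    show "2 * card {k. k < N \<and> few_beyond N (d v) (min (M v) (d v k))} \<le> (if few_beyond N (d v) (M v) then N else 0)"
    proof (cases "few_beyond N (d v) (M v)")
      case True
      have "card {k. k < N \<and> few_beyond N (d v) (min (M v) (d v k))} \<le> card {k. k < N \<and> few_beyond N (d v) (d v k)}"
        by (intro card_mono) (auto intro: few_beyond_mono)
      with card_few_beyond[of N "d v"] True show ?thesis by auto
    next
      case False
      then have "{k. k < N \<and> few_beyond N (d v) (min (M v) (d v k))} = {}"
        using few_beyond_mono[OF _ min.cobounded1] by blast
      then show ?thesis by (simp only: card.empty)
    qed
  qed
  also have "\<dots> = N * card {v\<in>S. few_beyond N (d v) (M v)}"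
    using assms by (simp add: sum.If_cases Int_def)
  finally show ?thesis .
qed

section \<open>Encoded distances, eccentricities and estimates\<close>

locale ecc_input = arc_list w \<tau> n m W l ta he wt for w \<tau> n m W l ta he wt +
  fixes S :: "nat set" and kc :: nat
  assumes S: "S \<subseteq> {..<n}"
    and W_eq: "W = Max (insert 0 (wt ` {..<m}))"
    and walk_short: "\<And>u v x. arc_walk m ta he wt u v x \<Longrightarrow> u < n \<Longrightarrow> \<exists>y\<le>n * W. arc_walk m ta he wt u v y"
    and word_K: "kc * l < 2 ^ w" and word_n: "n * n < 2 ^ w"
    and l: "n < 2 ^ l" "2 ^ l \<le> 2 * n"
begin

sublocale rev: arc_list w \<tau> n m W l he ta wt
  using n_pos ta_less he_less wt_le word n_le by unfold_locales auto

lemma finite_S: "finite S"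
  using S finite_subset by blast

lemma S_less: "v \<in> S \<Longrightarrow> v < n"
  using S by auto

lemma dst_rev: "rev.dst u v = dst v u"
  by (rule arc_dist_rev)

text \<open>\<open>walk_short\<close> excludes a true distance as large as the code
  \<open>inf_dist\<close>, so the code is unambiguous.\<close>

lemma dst_less_iff: "u < n \<Longrightarrow> dst u v < inf_dist \<longleftrightarrow> (\<exists>x. walk u v x)"
proof
  assume "u < n" "\<exists>x. walk u v x"
  with walk_short obtain y where "y \<le> n * W" "walk u v y" by blast
  moreover from this have "(LEAST x. walk u v x) \<le> y" by (intro Least_le)
  ultimately show "dst u v < inf_dist"
    unfolding arc_dist_def by (auto simp: inf_dist_def)
qed (auto simp: arc_dist_def split: if_splits)

lemma dst_le: "u < n \<Longrightarrow> dst u v \<le> inf_dist"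
  using dst_less_iff[of u v] by (cases "\<exists>x. walk u v x") (auto simp: arc_dist_def)

lemma dst_triangle:
  assumes "v < n" "a < n" "dst v a < inf_dist" "dst a u < inf_dist"
  shows "dst v u < inf_dist" "dst v u \<le> dst v a + dst a u"
proof -
  have "walk x y (dst x y)" if "x < n" "dst x y < inf_dist" for x y
    using that dst_less_iff[of x y] by (auto simp: arc_dist_def intro: LeastI)
  then have "walk v u (dst v a + dst a u)" using assms arc_walk_trans by blast
  moreover from this show "dst v u < inf_dist"
    using assms dst_less_iff[of v u] by blast
  ultimately show "dst v u \<le> dst v a + dst a u"
    unfolding arc_dist_def[of _ _ _ _ _ v u] by (auto intro: Least_le)
qed

text \<open>The extra 0 gives \<open>Max\<close> a value for empty \<open>S\<close> and changes
  nothing otherwise, since distances are natural numbers.\<close>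

definition "ecc v = Max (insert 0 (dst v ` S))"

lemma dst_le_ecc: "u \<in> S \<Longrightarrow> dst v u \<le> ecc v"
  unfolding ecc_def using finite_S by (intro Max_ge) auto

lemma ecc_le: "v < n \<Longrightarrow> ecc v \<le> inf_dist"
  unfolding ecc_def using finite_S dst_le by (intro Max.boundedI) auto

text \<open>The first alternative is safe because estimates are separately kept below
  \<open>ecc\<close>: an estimate \<open>inf_dist\<close> then forces the eccentricity to be
  infinite.\<close>

definition good :: "nat \<Rightarrow> nat \<Rightarrow> bool" where
  "good v x \<longleftrightarrow> x = inf_dist \<or> (\<forall>u\<in>S. dst v u < inf_dist \<and> dst v u \<le> 2 * x)"

lemma good_mono: "good v x \<Longrightarrow> x \<le> y \<Longrightarrow> y \<le> inf_dist \<Longrightarrow> good v y"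
proof -
  assume *: "good v x" "x \<le> y" "y \<le> inf_dist"
  show "good v y"
  proof (cases "x = inf_dist")
    case False
    with * have "dst v u < inf_dist \<and> dst v u \<le> 2 * y" if "u \<in> S" for u
      using that unfolding good_def by fastforce
    then show ?thesis by (simp add: good_def)
  qed (use * in \<open>simp add: good_def\<close>)
qed

text \<open>Established by the preprocessing and written by no later part, so the frame alone
  preserves it.\<close>

definition base :: "store \<Rightarrow> bool" where
  "base s \<longleftrightarrow> adjacency aHead aFirstOut aNextOut s \<and> rev.adjacency aTail aFirstIn aNextIn s \<and>
     (\<forall>v<n. arrs s aS v \<noteq> 0 \<longleftrightarrow> v \<in> S) \<and> regs s rK = kc * l"

lemma base_unchanged:
  assumes "base s" "unchanged R A s s'" "R \<inter> {rN, rInf, rKeyInf, rK} = {}"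
    "A \<inter> {aTail, aHead, aWeight, aS, aFirstOut, aNextOut, aFirstIn, aNextIn} = {}"
  shows "base s'"
proof -
  have "adjacency aHead aFirstOut aNextOut s'"
    using assms by (intro adjacency_unchanged[OF _ assms(2)]) (auto simp: base_def)
  moreover have "rev.adjacency aTail aFirstIn aNextIn s'"
    using assms by (intro rev.adjacency_unchanged[OF _ assms(2)]) (auto simp: base_def)
  moreover have "arrs s' aS = arrs s aS" "regs s' rK = regs s rK"
    using assms by (auto simp: unchanged_def)
  ultimately show ?thesis using assms(1) by (simp add: base_def)
qed

lemma base_regs: "base s \<Longrightarrow> regs s rN = n" "base s \<Longrightarrow> regs s rInf = inf_dist"
  by (simp_all add: base_def adjacency_def)

lemma n_word: "n < 2 ^ w"
  using word by linarith

lemma always_dijkstra_from: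
  assumes "base s" "regs s rSrc < n"
  shows "always dijkstra_time dijkstra_from (\<lambda>s'. \<forall>v<n. arrs s' aDist v = dst (regs s rSrc) v) s"
  using assms by (intro always_dijkstra) (auto simp: base_def)

lemma always_dijkstra_to:
  assumes "base s" "regs s rSrc < n"
  shows "always dijkstra_time dijkstra_to (\<lambda>s'. \<forall>v<n. arrs s' aDist v = dst v (regs s rSrc)) s"
  using rev.always_dijkstra[of aTail aFirstIn aNextIn s "regs s rSrc"] assms
  by (simp add: base_def dst_rev)

lemma always_max_est:
  assumes "regs s rN = n"
  shows "always (6 * n + 3) max_est (\<lambda>s'. \<forall>v<n. arrs s' aEst v = max (arrs s aEst v) (arrs s aDist v)) s"
proof -
  let ?c = "If (Op Less (Elem aEst (Reg rI)) (Elem aDist (Reg rI)))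
        (Store aEst (Reg rI) (Elem aDist (Reg rI))) Skip"
  define I where "I = (\<lambda>i (s' :: store). \<forall>v. arrs s' aEst v = (if v < i then max (arrs s aEst v) (arrs s aDist v) else arrs s aEst v))"
  have "always (n * (cost ?c + 4) + 3) max_est (I n) s"
    unfolding max_est_def
  proof (rule always_For_exec)
    fix i s' assume "i < n" "I i s'" "regs s' rI = i" "unchanged (insert rI (written_regs ?c)) (written_arrs ?c) s s'"
    then show "I (Suc i) (exec ?c s')"
      using word_consts by (auto simp: I_def unchanged_def less_Suc_eq)
  qed (use assms word_consts n_word in \<open>auto simp: I_def\<close>)
  then show ?thesis by (rule always_weaken) (auto simp: I_def)
qed

lemma always_min_min:
  assumes "regs s rN = n"
  shows "always (6 * n + 3) min_min (\<lambda>s'. \<forall>v<n. arrs s' aMin v = min (arrs s aMin v) (arrs s aDist v)) s"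
proof -
  let ?c = "If (Op Less (Elem aDist (Reg rI)) (Elem aMin (Reg rI)))
        (Store aMin (Reg rI) (Elem aDist (Reg rI))) Skip"
  define I where "I = (\<lambda>i (s' :: store). \<forall>v. arrs s' aMin v = (if v < i then min (arrs s aMin v) (arrs s aDist v) else arrs s aMin v))"
  have "always (n * (cost ?c + 4) + 3) min_min (I n) s"
    unfolding min_min_def
  proof (rule always_For_exec)
    fix i s' assume "i < n" "I i s'" "regs s' rI = i" "unchanged (insert rI (written_regs ?c)) (written_arrs ?c) s s'"
    then show "I (Suc i) (exec ?c s')"
      using word_consts by (auto simp: I_def unchanged_def less_Suc_eq)
  qed (use assms word_consts n_word in \<open>auto simp: I_def\<close>)
  then show ?thesis by (rule always_weaken) (auto simp: I_def)
qed

definition "sample_time = 2 * dijkstra_time + 12 * n + 11"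

lemma always_process_sample:
  assumes base: "base s" and a: "a = arrs s aU (regs s rIdx)" "a < n"
  shows "always sample_time process_sample (\<lambda>s'. (\<forall>v<n. arrs s' aMin v = min (arrs s aMin v) (dst a v)) \<and>
    (\<forall>v<n. arrs s' aEst v = max (arrs s aEst v) (dst v a))) s"
proof -
  let ?Q = "\<lambda>s'. (\<forall>v<n. arrs s' aMin v = min (arrs s aMin v) (dst a v)) \<and>
    (\<forall>v<n. arrs s' aEst v = max (arrs s aEst v) (dst v a))"
  define s1 where "s1 = exec (Assign rSrc (Elem aU (Reg rIdx))) s"
  have s1: "regs s1 rSrc = a" "arrs s1 = arrs s" using a by (simp_all add: s1_def)
  have b1: "base s1" by (rule base_unchanged[OF base, of "{rSrc}" "{}"]) (auto simp: s1_def unchanged_def)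
  have "always (Suc (dijkstra_time + Suc ((6 * n + 3) + Suc (dijkstra_time + (6 * n + 3)))))
      (dijkstra_from ;; min_min ;; dijkstra_to ;; max_est) ?Q s1"
  proof (rule always_Seq[OF always_dijkstra_from[OF b1]])
    show "regs s1 rSrc < n" using s1 a by simp
    fix s2 :: store assume D2: "\<forall>v<n. arrs s2 aDist v = dst (regs s1 rSrc) v"
      and u2: "unchanged (written_regs dijkstra_from) (written_arrs dijkstra_from) s1 s2"
    have b2: "base s2" by (rule base_unchanged[OF b1 u2]) auto
    show "always (Suc ((6 * n + 3) + Suc (dijkstra_time + (6 * n + 3)))) (min_min ;; dijkstra_to ;; max_est) ?Q s2"
    proof (rule always_Seq[OF always_min_min[OF base_regs(1)[OF b2]]])
      fix s3 :: store assume M3: "\<forall>v<n. arrs s3 aMin v = min (arrs s2 aMin v) (arrs s2 aDist v)"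
        and u3: "unchanged (written_regs min_min) (written_arrs min_min) s2 s3"
      have b3: "base s3" by (rule base_unchanged[OF b2 u3]) auto
      have r3: "regs s3 rSrc = a" using u2 u3 s1 by (simp add: unchanged_def)
      show "always (Suc (dijkstra_time + (6 * n + 3))) (dijkstra_to ;; max_est) ?Q s3"
      proof (rule always_Seq[OF always_dijkstra_to[OF b3]])
        show "regs s3 rSrc < n" using r3 a by simp
        fix s4 :: store assume D4: "\<forall>v<n. arrs s4 aDist v = dst v (regs s3 rSrc)"
          and u4: "unchanged (written_regs dijkstra_to) (written_arrs dijkstra_to) s3 s4"
        have b4: "base s4" by (rule base_unchanged[OF b3 u4]) auto
        show "always (6 * n + 3) max_est ?Q s4"
        proof (rule always_weaken[OF ensures_frame[OF always_max_est[OF base_regs(1)[OF b4]]]])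
          fix s5 :: store assume s5: "(\<forall>v<n. arrs s5 aEst v = max (arrs s4 aEst v) (arrs s4 aDist v)) \<and>
            unchanged (written_regs max_est) (written_arrs max_est) s4 s5"
          have "arrs s4 aEst = arrs s aEst" "arrs s5 aMin = arrs s3 aMin" "arrs s2 aMin = arrs s aMin"
            using s5 u2 u3 u4 s1 by (simp_all add: unchanged_def)
          then show "?Q s5" using s5 M3 D2 D4 s1 r3 by simp
        qed simp
      qed
    qed
  qed
  then have "always (Suc (cost (Assign rSrc (Elem aU (Reg rIdx))) +
      Suc (dijkstra_time + Suc ((6 * n + 3) + Suc (dijkstra_time + (6 * n + 3)))))) process_sample ?Q s"
    unfolding process_sample_def by (intro always_exec_Seq) (simp_all add: s1_def)
  then show ?thesis by (rule ensures_time) (simp add: sample_time_def)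
qed

section \<open>The sampling loop of a phase\<close>

text \<open>\<open>cover\<close> says that \<open>aMin\<close> holds the distances from a set of samples that \<open>aEst\<close> accounts for.\<close>

definition cover :: "store \<Rightarrow> bool" where
  "cover s \<longleftrightarrow> (\<forall>u<n. arrs s aMin u = inf_dist \<or>
     (\<exists>a\<in>S. arrs s aMin u = dst a u \<and> (\<forall>v<n. dst v a \<le> arrs s aEst v)))"

text \<open>\<open>f\<close> records the estimates before the sampling: they only grow, so what was
  \<open>good\<close> remains so by \<open>good_mono\<close>.\<close>

definition est_between :: "(nat \<Rightarrow> nat) \<Rightarrow> store \<Rightarrow> bool" where
  "est_between f s \<longleftrightarrow> (\<forall>v<n. f v \<le> arrs s aEst v \<and> arrs s aEst v \<le> ecc v)"

text \<open>The vertices of the union bound whose closest half is still missed. Counting goes by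
  index into \<open>U\<close>, in agreement with a uniform draw of an index.\<close>

definition bad :: "nat \<Rightarrow> (nat \<Rightarrow> nat) \<Rightarrow> (nat \<Rightarrow> nat) \<Rightarrow> nat set" where
  "bad N U M = {v\<in>S. few_beyond N (\<lambda>i. dst (U i) v) (M v)}"

definition "miss_bound = ennreal (real n * (1 / 2) ^ (kc * l))"

lemma ensures_sampling:
  assumes base: "base s" and U: "\<And>i. i < regs s rLen \<Longrightarrow> arrs s aU i \<in> S" and len: "regs s rLen > 0"
    and est: "est_between f s" and M: "\<forall>v<n. arrs s aMin v = inf_dist"
  shows "ensures (kc * l * (sample_time + 6) + 3) (For rJ rK (Rand rIdx (Reg rLen) ;; process_sample))
    (\<lambda>s'. cover s' \<and> est_between f s')
    (\<lambda>s'. if bad (regs s rLen) (arrs s aU) (arrs s' aMin) = {} then 0 else 1) s miss_bound"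
proof -
  let ?N = "regs s rLen" and ?U = "arrs s aU" and ?K = "kc * l"
  let ?b = "Rand rIdx (Reg rLen) ;; process_sample"
  define I where "I = (\<lambda>(i :: nat) s'. cover s' \<and> est_between f s')"
  \<comment> \<open>At \<open>j = kc * l\<close> this is the number of missed vertices, which
    dominates the failure indicator; at \<open>j = 0\<close> it is at most
    \<open>miss_bound\<close>. In between, a draw halves the first factor on average while the
    second one doubles.\<close>
  define F where "F = (\<lambda>j (s' :: store). ennreal (real (card (bad ?N ?U (arrs s' aMin))) * (1 / 2) ^ (?K - j)))"
  have fin: "finite (bad N U M)" for N U M using finite_S by (simp add: bad_def)
  have "ensures (?K * ((sample_time + 2) + 4) + 3) (For rJ rK ?b) (I ?K) (F ?K) s (F 0 s)"
  proof (rule ensures_For)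
    show "regs s rK = ?K" using base by (simp add: base_def)
    show "I 0 s" using est M by (simp add: I_def cover_def)
  next
    fix j s' assume j: "j < ?K" and I: "I j s'"
      and un: "unchanged (insert rJ (written_regs ?b)) (written_arrs ?b) s s'"
    have base': "base s'" by (rule base_unchanged[OF base un]) auto
    have N: "regs s' rLen = ?N" and U': "arrs s' aU = ?U" using un by (simp_all add: unchanged_def)
    \<comment> \<open>\<open>M' k\<close> is what \<open>aMin\<close> becomes once sample
      \<open>k\<close> is processed. The average is taken right after the draw, when only the index
      is known; the deterministic processing then realizes the predicted value.\<close>
    define M' where "M' = (\<lambda>k v. min (arrs s' aMin v) (dst (?U k) v))"
    define G where "G = (\<lambda>s1 :: store. ennreal (real (card (bad ?N ?U (M' (regs s1 rIdx)))) * (1 / 2) ^ (?K - Suc j)))"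
    have "ensures (Suc (1 + sample_time)) ?b (I (Suc j)) (F (Suc j)) s' (F j s')"
    proof (rule ensures_Seq[where P = "\<lambda>s1. \<exists>k<?N. s1 = set_reg rIdx k s'" and G = G])
      let ?x = "(1 / 2 :: real) ^ (?K - Suc j)"
      have "(\<Sum>k<?N. G (set_reg rIdx k s')) = ennreal (\<Sum>k<?N. real (card (bad ?N ?U (M' k))) * ?x)"
        by (simp add: G_def sum_ennreal)
      then have "(\<Sum>k<?N. G (set_reg rIdx k s')) / of_nat ?N =
          ennreal (\<Sum>k<?N. real (card (bad ?N ?U (M' k))) * ?x) / of_nat ?N"
        by (rule arg_cong)
      also have "\<dots> = ennreal ((\<Sum>k<?N. real (card (bad ?N ?U (M' k))) * ?x) / real ?N)"
        using len by (subst divide_ennreal[symmetric]) (auto intro!: sum_nonneg simp: ennreal_of_nat_eq_real_of_nat)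
      also have "\<dots> \<le> F j s'"
        unfolding F_def
      proof (rule ennreal_leI)
        have "2 * (\<Sum>k<?N. card (bad ?N ?U (M' k))) \<le> ?N * card (bad ?N ?U (arrs s' aMin))"
          unfolding bad_def M'_def using sum_card_few_beyond[OF finite_S] .
        then have "real (2 * (\<Sum>k<?N. card (bad ?N ?U (M' k)))) \<le> real (?N * card (bad ?N ?U (arrs s' aMin)))"
          by (rule of_nat_mono)
        then have le: "(\<Sum>k<?N. real (card (bad ?N ?U (M' k)))) / real ?N \<le> real (card (bad ?N ?U (arrs s' aMin))) / 2"
          using len by (simp add: field_simps)
        have "?K - j = Suc (?K - Suc j)" using j by simp
        then have A: "(1 / 2 :: real) ^ (?K - j) = ?x / 2" by simp
        have B: "(\<Sum>k<?N. real (card (bad ?N ?U (M' k))) * ?x) / real ?N =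
          (\<Sum>k<?N. real (card (bad ?N ?U (M' k)))) / real ?N * ?x"
          by (simp add: sum_distrib_right)
        show "(\<Sum>k<?N. real (card (bad ?N ?U (M' k))) * ?x) / real ?N
            \<le> real (card (bad ?N ?U (arrs s' aMin))) * (1 / 2) ^ (?K - j)"
          unfolding A B using mult_right_mono[OF le, of ?x] by simp
      qed
      finally show "ensures 1 (Rand rIdx (Reg rLen)) (\<lambda>s1. \<exists>k<?N. s1 = set_reg rIdx k s') G s' (F j s')"
        using len N by (intro ensures_Rand[where k = ?N]) auto
    next
      fix s1 :: store assume "\<exists>k<?N. s1 = set_reg rIdx k s'"
      then obtain k where k: "k < ?N" and s1: "s1 = set_reg rIdx k s'" by blast
      have base1: "base s1"
        by (rule base_unchanged[OF base', of "{rIdx}" "{}"]) (auto simp: s1 unchanged_def)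
      have "always sample_time process_sample (\<lambda>s'. (\<forall>v<n. arrs s' aMin v = min (arrs s1 aMin v) (dst (?U k) v)) \<and>
        (\<forall>v<n. arrs s' aEst v = max (arrs s1 aEst v) (dst v (?U k)))) s1"
        using base1 U[OF k] U' S_less by (intro always_process_sample) (simp_all add: s1)
      then have "always sample_time process_sample (\<lambda>s2. I (Suc j) s2 \<and> F (Suc j) s2 \<le> G s1) s1"
      proof (rule always_weaken)
        fix s2 :: store assume s2: "(\<forall>v<n. arrs s2 aMin v = min (arrs s1 aMin v) (dst (?U k) v)) \<and>
          (\<forall>v<n. arrs s2 aEst v = max (arrs s1 aEst v) (dst v (?U k)))"
        have a: "?U k \<in> S" using U k by simp
        have "cover s2"
          unfolding cover_def
        proof (intro allI impI)
          fix u assume u: "u < n"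
          have "arrs s2 aMin u = min (arrs s' aMin u) (dst (?U k) u)" using s2 u s1 by simp
          then consider "arrs s2 aMin u = arrs s' aMin u" | "arrs s2 aMin u = dst (?U k) u"
            by (metis min_def)
          then show "arrs s2 aMin u = inf_dist \<or> (\<exists>a\<in>S. arrs s2 aMin u = dst a u \<and> (\<forall>v<n. dst v a \<le> arrs s2 aEst v))"
          proof cases
            case 1
            have "cover s'" using I by (simp add: I_def)
            then consider "arrs s' aMin u = inf_dist" |
              a where "a \<in> S" "arrs s' aMin u = dst a u" "\<forall>v<n. dst v a \<le> arrs s' aEst v"
              using u unfolding cover_def by blast
            then show ?thesis
            proof cases
              case (2 a)
              then have "\<forall>v<n. dst v a \<le> arrs s2 aEst v" using s2 s1 by (auto intro: max.coboundedI1)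
              with 1 2 show ?thesis by auto
            qed (use 1 in simp)
          next
            case 2
            have "\<forall>v<n. dst v (?U k) \<le> arrs s2 aEst v" using s2 by auto
            with 2 a show ?thesis by auto
          qed
        qed
        moreover have "est_between f s2"
          using s2 I s1 dst_le_ecc[OF a] unfolding I_def est_between_def
          by (auto intro: max.coboundedI1)
        ultimately have "I (Suc j) s2" by (simp add: I_def)
        moreover have "bad ?N ?U (arrs s2 aMin) = bad ?N ?U (M' k)"
          using s2 s1 S_less by (auto simp: bad_def M'_def)
        then have "F (Suc j) s2 \<le> G s1" by (simp add: F_def G_def s1)
        ultimately show "I (Suc j) s2 \<and> F (Suc j) s2 \<le> G s1" by simp
      qed simp
      then show "ensures sample_time process_sample (I (Suc j)) (F (Suc j)) s1 (G s1)"
        by (rule ensures_of_always_conj)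
    qed
    then show "ensures (sample_time + 2) ?b (I (Suc j)) (F (Suc j)) s' (F j s')" by simp
  qed (use word_consts word_K in \<open>auto simp: I_def F_def cover_def est_between_def\<close>)
  then show ?thesis
  proof (rule ensures_weaken)
    show "F 0 s \<le> miss_bound"
    proof -
      have "card (bad ?N ?U (arrs s aMin)) \<le> card S"
        unfolding bad_def using finite_S by (intro card_mono) auto
      also have "\<dots> \<le> card {..<n}" using S by (intro card_mono) auto
      finally show ?thesis unfolding F_def miss_bound_def
        by (intro ennreal_leI mult_right_mono) auto
    qed
  next
    fix s' :: store assume "I ?K s'"
    show "(if bad ?N ?U (arrs s' aMin) = {} then 0 else 1) \<le> F ?K s'"
    proof (cases "bad ?N ?U (arrs s' aMin) = {}")
      case False
      then have "1 \<le> card (bad ?N ?U (arrs s' aMin))" using fin by (simp add: Suc_le_eq card_gt_0_iff)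
      then show ?thesis by (simp add: F_def)
    qed simp
  qed (auto simp: I_def)
qed

lemma l_le_n: "l \<ge> 1" "l \<le> n"
proof -
  show l1: "l \<ge> 1" using l n_pos by (cases l) auto
  have "l - 1 < 2 ^ (l - 1)" by (rule less_exp)
  moreover have "2 * 2 ^ (l - 1) = (2 :: nat) ^ l" using l1 by (cases l) auto
  ultimately show "l \<le> n" using l by linarith
qed

section \<open>Pruning the set of open vertices\<close>

lemma always_farthest:
  assumes base: "base s" and src: "regs s rSrc \<in> S" "regs s rRad = arrs s aMin (regs s rSrc)"
  shows "always (9 * n + 3) farthest (\<lambda>s'. regs s' rSrc \<in> S \<and> regs s' rRad = arrs s aMin (regs s' rSrc) \<and>
    (\<forall>v\<in>S. arrs s aMin v \<le> regs s' rRad)) s"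
proof -
  let ?c = "If (Elem aS (Reg rI))
        (If (Op Less (Reg rRad) (Elem aMin (Reg rI)))
           (Assign rRad (Elem aMin (Reg rI)) ;; Assign rSrc (Reg rI)) Skip)
        Skip"
  define I where "I = (\<lambda>i (s' :: store). regs s' rSrc \<in> S \<and> regs s' rRad = arrs s aMin (regs s' rSrc) \<and>
    (\<forall>v\<in>S. v < i \<longrightarrow> arrs s aMin v \<le> regs s' rRad))"
  have "always (n * (cost ?c + 4) + 3) farthest (I n) s"
    unfolding farthest_def
  proof (rule always_For_exec)
    fix i s' assume i: "i < n" "I i s'" "regs s' rI = i" 
      and un: "unchanged (insert rI (written_regs ?c)) (written_arrs ?c) s s'"
    have "arrs s' = arrs s" using un by (auto simp: unchanged_def)
    moreover have "arrs s aS i \<noteq> 0 \<longleftrightarrow> i \<in> S" using base i by (simp add: base_def)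
    ultimately show "I (Suc i) (exec ?c s')"
      using i word_consts by (auto simp: I_def less_Suc_eq)
  qed (use src base_regs[OF base] word_consts n_word in \<open>auto simp: I_def\<close>)
  then show ?thesis by (rule always_weaken) (auto simp: I_def S_less)
qed

text \<open>The compaction works in place: the write position never passes the read position, so
  entries still to be read are intact. An equation between lists delivers both the new length and
  the new set.\<close>

lemma always_keep_near:
  assumes len: "regs s rLen = N" "N \<le> n" and new: "regs s rNewLen = 0"
  shows "always (8 * n + 3) keep_near (\<lambda>s'.
    map (arrs s' aU) [0..<regs s' rNewLen] = filter (\<lambda>u. arrs s aDist u < regs s rRad) (map (arrs s aU) [0..<N])) s"
proof -
  let ?c = "If (Op Less (Elem aDist (Elem aU (Reg rI))) (Reg rRad))
        (Store aU (Reg rNewLen) (Elem aU (Reg rI)) ;;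
         Assign rNewLen (Op Plus (Reg rNewLen) (Const 1)))
        Skip"
  let ?P = "\<lambda>u. arrs s aDist u < regs s rRad"
  define I where "I = (\<lambda>i (s' :: store). regs s' rNewLen \<le> i \<and> (\<forall>k\<ge>i. arrs s' aU k = arrs s aU k) \<and>
    map (arrs s' aU) [0..<regs s' rNewLen] = filter ?P (map (arrs s aU) [0..<i]))"
  have "always (N * (cost ?c + 4) + 3) keep_near (I N) s"
    unfolding keep_near_def
  proof (rule always_For_exec)
    fix i s' assume i: "i < N" "I i s'" "regs s' rI = i" 
      and un: "unchanged (insert rI (written_regs ?c)) (written_arrs ?c) s s'"
    define k where "k = regs s' rNewLen"
    have un': "arrs s' aDist = arrs s aDist" "regs s' rRad = regs s rRad" "arrs s' aU i = arrs s aU i"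
      using un i by (auto simp: unchanged_def I_def)
    have kw: "Suc k < 2 ^ w" using i len word_bounds(1) by (auto simp: I_def k_def)
    show "I (Suc i) (exec ?c s')"
    proof (cases "?P (arrs s aU i)")
      case True
      have "exec ?c s' = set_reg rNewLen (Suc k) (set_elem aU k (arrs s aU i) s')"
        using True un' i kw word_consts by (simp add: k_def)
      moreover have "map ((arrs s' aU)(k := arrs s aU i)) [0..<Suc k] = map (arrs s' aU) [0..<k] @ [arrs s aU i]"
        by simp
      ultimately show ?thesis
        using i True by (simp add: I_def k_def)
    next
      case False
      then have "exec ?c s' = s'"
        using un' i word_consts by simp
      then show ?thesis using i False by (simp add: I_def)
    qed
  qed (use len new word_consts n_word in \<open>auto simp: I_def\<close>)
  then show ?thesis 
    by (rule always_weaken) (use len in \<open>auto simp: I_def\<close>)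
qed

text \<open>This invariant holds at every outcome, including the certified estimates outside
  \<open>U\<close>. Chance only affects how fast \<open>rLen\<close> shrinks, so that is all the
  potential has to track.\<close>

definition sure :: "store \<Rightarrow> bool" where
  "sure s \<longleftrightarrow> base s \<and> (\<forall>i<regs s rLen. arrs s aU i \<in> S) \<and> regs s rLen \<le> n \<and>
     (\<forall>v<n. arrs s aEst v \<le> ecc v) \<and>
     (\<forall>v\<in>S - arrs s aU ` {..<regs s rLen}. good v (arrs s aEst v))"

definition "prune_time = dijkstra_time + 23 * n + 20"

text \<open>If \<open>f v\<close> is finite, then the distance of \<open>u\<close> from the samples
  is at most \<open>r \<le> dst v x \<le> f v\<close>, hence finite too. So \<open>cover\<close>
  supplies a sample \<open>a\<close> realizing it, and
  \<open>dst v u \<le> dst v a + dst a u\<close>, where both terms are at most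
  \<open>f v\<close>.\<close>

lemma good_if_far:
  assumes cover: "cover s" and est: "\<forall>v<n. f v = max (arrs s aEst v) (dst v x)" "\<forall>v<n. arrs s aEst v \<le> ecc v"
    and x: "x \<in> S" "\<forall>u\<in>S. arrs s aMin u \<le> r" and v: "v \<in> S" "r \<le> dst v x"
  shows "good v (f v)"
proof (cases "f v = inf_dist")
  case False
  have vn: "v < n" using v S_less by blast
  have le: "dst v x \<le> f v" "arrs s aEst v \<le> f v" using est vn by simp_all
  have "f v \<le> inf_dist"
    using est vn dst_le[OF vn] ecc_le[OF vn] by (metis max.bounded_iff order_trans)
  with False have fin: "f v < inf_dist" by simp
  have "dst v u < inf_dist \<and> dst v u \<le> 2 * f v" if u: "u \<in> S" for u
  proof -
    have "arrs s aMin u \<le> f v" using x(2) u v(2) le by (meson order_trans)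
    moreover from this fin have "arrs s aMin u \<noteq> inf_dist" by simp
    with cover u S_less obtain a where a: "a \<in> S" "arrs s aMin u = dst a u" "dst v a \<le> arrs s aEst v"
      unfolding cover_def using vn by blast
    ultimately have "dst v a \<le> f v" "dst a u \<le> f v" using le by simp_all
    then show ?thesis using dst_triangle[OF vn S_less[OF a(1)], of u] fin by linarith
  qed
  then show ?thesis by (simp add: good_def)
qed (simp add: good_def)

lemma always_prune:
  assumes base: "base s" and len: "regs s rLen = N" "0 < N" "N \<le> n" and U: "\<forall>i<N. arrs s aU i \<in> S"
    and est: "\<forall>v<n. arrs s aEst v \<le> ecc v" and good: "\<forall>v\<in>S - arrs s aU ` {..<N}. good v (arrs s aEst v)"
    and cover: "cover s"
  shows "always prune_time prune (\<lambda>s'. sure s' \<and>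
    (bad N (arrs s aU) (arrs s aMin) = {} \<longrightarrow> 2 * regs s' rLen \<le> N)) s"
proof -
  let ?U = "arrs s aU" and ?M = "arrs s aMin"
  let ?Q = "\<lambda>s'. sure s' \<and> (bad N ?U ?M = {} \<longrightarrow> 2 * regs s' rLen \<le> N)"
  let ?c1 = "Assign rSrc (Elem aU (Const 0)) ;; Assign rRad (Elem aMin (Reg rSrc))"
  let ?c2 = "Assign rNewLen (Const 0) ;; keep_near ;; Assign rLen (Reg rNewLen)"
  define s1 where "s1 = exec ?c1 s"
  have s1: "regs s1 rSrc = ?U 0" "regs s1 rRad = ?M (?U 0)" "regs s1 rLen = N" "arrs s1 = arrs s"
    using len by (simp_all add: s1_def)
  have b1: "base s1" by (rule base_unchanged[OF base, of "{rSrc, rRad}" "{}"]) (auto simp: s1_def unchanged_def)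
  have "always (Suc ((9 * n + 3) + Suc (dijkstra_time + Suc ((6 * n + 3) + Suc (1 + Suc ((8 * n + 3) + 1))))))
      (farthest ;; dijkstra_to ;; max_est ;; ?c2) ?Q s1"
  proof (rule always_Seq[OF always_farthest[OF b1]])
    show "regs s1 rSrc \<in> S" "regs s1 rRad = arrs s1 aMin (regs s1 rSrc)" using s1 U len by simp_all
  next
    fix s2 :: store
    assume r2: "regs s2 rSrc \<in> S \<and> regs s2 rRad = arrs s1 aMin (regs s2 rSrc) \<and> (\<forall>v\<in>S. arrs s1 aMin v \<le> regs s2 rRad)"
      and u2: "unchanged (written_regs farthest) (written_arrs farthest) s1 s2"
    have b2: "base s2" by (rule base_unchanged[OF b1 u2]) auto
    show "always (Suc (dijkstra_time + Suc ((6 * n + 3) + Suc (1 + Suc ((8 * n + 3) + 1)))))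
      (dijkstra_to ;; max_est ;; ?c2) ?Q s2"
    proof (rule always_Seq[OF always_dijkstra_to[OF b2]])
      show "regs s2 rSrc < n" using r2 S_less by blast
      fix s3 :: store assume D3: "\<forall>v<n. arrs s3 aDist v = dst v (regs s2 rSrc)"
        and u3: "unchanged (written_regs dijkstra_to) (written_arrs dijkstra_to) s2 s3"
      have b3: "base s3" by (rule base_unchanged[OF b2 u3]) auto
      show "always (Suc ((6 * n + 3) + Suc (1 + Suc ((8 * n + 3) + 1)))) (max_est ;; ?c2) ?Q s3"
      proof (rule always_Seq[OF always_max_est[OF base_regs(1)[OF b3]]])
        fix s4 :: store assume e4: "\<forall>v<n. arrs s4 aEst v = max (arrs s3 aEst v) (arrs s3 aDist v)"
          and u4: "unchanged (written_regs max_est) (written_arrs max_est) s3 s4"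
        have b4: "base s4" by (rule base_unchanged[OF b3 u4]) auto
        define s5 where "s5 = exec (Assign rNewLen (Const 0)) s4"
        define x R where "x = regs s2 rSrc" and "R = regs s2 rRad"
        have x: "x \<in> S" "R = ?M x" using r2 s1 by (simp_all add: x_def R_def)
        have max_R: "\<forall>u\<in>S. ?M u \<le> R" using r2 s1(4) unfolding R_def by metis
        have s5: "regs s5 rNewLen = 0" "regs s5 rLen = N" "regs s5 rRad = R" "arrs s5 aU = ?U"
          "arrs s5 aDist = arrs s3 aDist"
          using u2 u3 u4 s1 by (simp_all add: s5_def unchanged_def R_def)
        have est4: "\<forall>v<n. arrs s4 aEst v = max (arrs s aEst v) (dst v x)"
          using e4 D3 u2 u3 s1 by (simp add: unchanged_def x_def)
        have b5: "base s5" by (rule base_unchanged[OF b4, of "{rNewLen}" "{}"]) (auto simp: s5_def unchanged_def)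
        have "always (Suc ((8 * n + 3) + 1)) (keep_near ;; Assign rLen (Reg rNewLen)) ?Q s5"
        proof (rule always_Seq[OF always_keep_near[OF s5(2) len(3) s5(1)]])
          fix s6 :: store
          assume k6: "map (arrs s6 aU) [0..<regs s6 rNewLen] =
              filter (\<lambda>u. arrs s5 aDist u < regs s5 rRad) (map (arrs s5 aU) [0..<N])"
            and u6: "unchanged (written_regs keep_near) (written_arrs keep_near) s5 s6"
          define N' where "N' = regs s6 rNewLen"
          have b6: "base s6" by (rule base_unchanged[OF b5 u6]) auto
          have "map (arrs s6 aU) [0..<N'] = filter (\<lambda>u. arrs s3 aDist u < R) (map ?U [0..<N])"
            using k6 s5 by (simp add: N'_def)
          also have "\<dots> = filter (\<lambda>u. dst u x < R) (map ?U [0..<N])"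
            using D3 U S_less by (intro filter_cong) (auto simp: x_def)
          finally have map6: "map (arrs s6 aU) [0..<N'] = filter (\<lambda>u. dst u x < R) (map ?U [0..<N])" .
          have "N' = length (filter (\<lambda>u. dst u x < R) (map ?U [0..<N]))"
            using arg_cong[OF map6, of length] by simp
          also have "\<dots> = card {i. i < N \<and> dst (?U i) x < R}"
            by (simp add: length_filter_conv_card cong: conj_cong)
          finally have N': "N' = card {i. i < N \<and> dst (?U i) x < R}" .
          have set6: "arrs s6 aU ` {..<N'} = {u \<in> ?U ` {..<N}. dst u x < R}"
            using arg_cong[OF map6, of set] by (simp add: atLeast0LessThan)
          have est6: "\<forall>v<n. arrs s6 aEst v = max (arrs s aEst v) (dst v x)"
            using est4 u6 by (simp add: s5_def unchanged_def)
          have ecc6: "\<forall>v<n. arrs s6 aEst v \<le> ecc v"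
            using est6 est dst_le_ecc[OF x(1)] by simp
          have good6: "good v (arrs s6 aEst v)" if v: "v \<in> S" "v \<notin> arrs s6 aU ` {..<N'}" for v
          proof (cases "v \<in> ?U ` {..<N}")
            case True
            with v set6 have "R \<le> dst v x" by auto
            then show ?thesis using good_if_far[OF cover est6 est x(1) max_R v(1)] by blast
          next
            case False
            with v good have "good v (arrs s aEst v)" by blast
            moreover have "arrs s aEst v \<le> arrs s6 aEst v" using est6 v S_less by simp
            moreover have "arrs s6 aEst v \<le> inf_dist" using ecc6 v S_less ecc_le order_trans by blast
            ultimately show ?thesis by (rule good_mono)
          qed
          \<comment> \<open>\<open>R\<close> is the distance of \<open>x\<close> from the samples.
            As \<open>x\<close> is not missed, at least half of the indices have distance at least
            \<open>R\<close> to \<open>x\<close>, and exactly these are dropped.\<close>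
          have half: "2 * N' \<le> N" if "bad N ?U ?M = {}"
          proof -
            have "\<not> few_beyond N (\<lambda>i. dst (?U i) x) R" using that x by (auto simp: bad_def)
            then have "N \<le> 2 * card {i. i < N \<and> R \<le> dst (?U i) x}" by (simp add: few_beyond_def)
            moreover have "card ({i. i < N \<and> R \<le> dst (?U i) x} \<union> {i. i < N \<and> dst (?U i) x < R}) =
              card {i. i < N \<and> R \<le> dst (?U i) x} + card {i. i < N \<and> dst (?U i) x < R}"
              by (intro card_Un_disjoint) auto
            moreover have "{i. i < N \<and> R \<le> dst (?U i) x} \<union> {i. i < N \<and> dst (?U i) x < R} = {..<N}"
              by auto
            ultimately show ?thesis using N' by simp
          qed
          have N'_le: "N' \<le> n"
          proof -
            have "N' \<le> card {..<N}" unfolding N' by (intro card_mono) auto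
            then show ?thesis using len by simp
          qed
          define s7 where "s7 = set_reg rLen N' s6"
          have b7: "base s7" by (rule base_unchanged[OF b6, of "{rLen}" "{}"]) (auto simp: s7_def unchanged_def)
          have "arrs s6 aU i \<in> S" if "i < N'" for i
          proof -
            have "arrs s6 aU i \<in> arrs s6 aU ` {..<N'}" using that by simp
            then show ?thesis unfolding set6 using U by auto
          qed
          then have "sure s7"
            unfolding sure_def using b7 N'_le ecc6 good6 by (simp add: s7_def)
          then show "always 1 (Assign rLen (Reg rNewLen)) ?Q s6"
            using half by (intro ensures_Assign) (simp_all add: s7_def N'_def)
        qed
        then have "always (Suc (cost (Assign rNewLen (Const 0)) + Suc ((8 * n + 3) + 1))) ?c2 ?Q s4"
          by (intro always_exec_Seq) (simp_all add: s5_def)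
        then show "always (Suc (1 + Suc ((8 * n + 3) + 1))) ?c2 ?Q s4" by simp
      qed
    qed
  qed
  then have "always (Suc (cost ?c1 + Suc ((9 * n + 3) + Suc (dijkstra_time + Suc ((6 * n + 3) + Suc (1 + Suc ((8 * n + 3) + 1))))))) prune ?Q s"
    unfolding prune_def by (intro always_exec_Seq) (simp_all add: s1_def)
  then show ?thesis by (rule ensures_time) (simp add: prune_time_def)
qed

section \<open>One phase and the loop over phases\<close>

definition "phase_time = kc * l * (sample_time + 6) + prune_time + 5 * n + 11"

lemma ensures_phase:
  assumes sure: "sure s" and len: "regs s rLen > 0" and r: "regs s rPhase < 2 ^ w"
  shows "ensures phase_time phase (\<lambda>s'. sure s' \<and> regs s' rPhase = regs s rPhase - 1)
    (\<lambda>s'. if 2 * regs s' rLen \<le> regs s rLen then 0 else 1) s miss_bound"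
proof -
  let ?N = "regs s rLen" and ?U = "arrs s aU" and ?r = "regs s rPhase - 1"
  let ?F = "\<lambda>s'. if 2 * regs s' rLen \<le> ?N then 0 else (1 :: ennreal)"
  let ?Q = "\<lambda>s'. sure s' \<and> regs s' rPhase = ?r"
  let ?c1 = "Assign rPhase (Op Minus (Reg rPhase) (Const 1))"
  let ?c2 = "For rI rN (Store aMin (Reg rI) (Reg rInf))"
  let ?c3 = "For rJ rK (Rand rIdx (Reg rLen) ;; process_sample)"
  have base: "base s" using sure by (simp add: sure_def)
  have "always 1 ?c1 (\<lambda>s1. regs s1 rPhase = ?r) s"
    using r word_consts by (intro ensures_Assign) simp_all
  then have "ensures (Suc (1 + Suc ((5 * n + 3) + Suc ((kc * l * (sample_time + 6) + 3) + prune_time)))) phase ?Q ?F s miss_bound"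
    unfolding phase_def
  proof (rule ensures_always_Seq)
    fix s1 :: store assume r1: "regs s1 rPhase = ?r"
      and u1: "unchanged (written_regs ?c1) (written_arrs ?c1) s s1"
    have b1: "base s1" by (rule base_unchanged[OF base u1]) auto
    define I where "I = (\<lambda>i (s' :: store). \<forall>v<i. arrs s' aMin v = inf_dist)"
    let ?b = "Store aMin (Reg rI) (Reg rInf)"
    have "always (n * (cost ?b + 4) + 3) ?c2 (I n) s1"
    proof (rule always_For_exec)
      fix i s' assume i: "i < n" "I i s'" "regs s' rI = i"
        and un: "unchanged (insert rI (written_regs ?b)) (written_arrs ?b) s1 s'"
      have "regs s' rInf = inf_dist" using un base_regs[OF b1] by (simp add: unchanged_def)
      then show "I (Suc i) (exec ?b s')" using i by (auto simp: I_def less_Suc_eq)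
    qed (use base_regs[OF b1] word_consts n_word in \<open>auto simp: I_def\<close>)
    then have "always (5 * n + 3) ?c2 (\<lambda>s'. \<forall>v<n. arrs s' aMin v = inf_dist) s1"
      by (rule always_weaken) (auto simp: I_def)
    then show "ensures (Suc ((5 * n + 3) + Suc ((kc * l * (sample_time + 6) + 3) + prune_time))) (?c2 ;; ?c3 ;; prune) ?Q ?F s1 miss_bound"
    proof (rule ensures_always_Seq)
      fix s2 :: store assume M2: "\<forall>v<n. arrs s2 aMin v = inf_dist"
        and u2: "unchanged (written_regs ?c2) (written_arrs ?c2) s1 s2"
      have b2: "base s2" by (rule base_unchanged[OF b1 u2]) auto
      have eq2: "regs s2 rLen = ?N" "arrs s2 aU = ?U" "arrs s2 aEst = arrs s aEst" "regs s2 rPhase = ?r"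
        using u1 u2 r1 by (simp_all add: unchanged_def)
      let ?f = "arrs s aEst"
      have "ensures (kc * l * (sample_time + 6) + 3) ?c3 (\<lambda>s'. cover s' \<and> est_between ?f s')
          (\<lambda>s'. if bad (regs s2 rLen) (arrs s2 aU) (arrs s' aMin) = {} then 0 else 1) s2 miss_bound"
        using sure len M2 by (intro ensures_sampling b2) (auto simp: eq2 sure_def est_between_def)
      from ensures_frame[OF this] show
        "ensures (Suc ((kc * l * (sample_time + 6) + 3) + prune_time)) (?c3 ;; prune) ?Q ?F s2 miss_bound"
      proof (rule ensures_Seq)
        fix s3 :: store assume s3: "(cover s3 \<and> est_between ?f s3) \<and> unchanged (written_regs ?c3) (written_arrs ?c3) s2 s3"
        then have u3: "unchanged (written_regs ?c3) (written_arrs ?c3) s2 s3" by simp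
        have b3: "base s3" by (rule base_unchanged[OF b2 u3]) auto
        have eq3: "regs s3 rLen = ?N" "arrs s3 aU = ?U" "regs s3 rPhase = ?r"
          using u3 eq2 by (simp_all add: unchanged_def)
        let ?G = "if bad (regs s2 rLen) (arrs s2 aU) (arrs s3 aMin) = {} then 0 else (1 :: ennreal)"
        have "always prune_time prune (\<lambda>s'. sure s' \<and>
          (bad ?N (arrs s3 aU) (arrs s3 aMin) = {} \<longrightarrow> 2 * regs s' rLen \<le> ?N)) s3"
        proof (rule always_prune[OF b3])
          show "regs s3 rLen = ?N" "0 < ?N" "?N \<le> n" "\<forall>i<?N. arrs s3 aU i \<in> S" "cover s3"
            "\<forall>v<n. arrs s3 aEst v \<le> ecc v"
            using sure len eq3 s3 by (simp_all add: sure_def est_between_def)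
          show "\<forall>v\<in>S - arrs s3 aU ` {..<?N}. good v (arrs s3 aEst v)"
          proof
            fix v assume v: "v \<in> S - arrs s3 aU ` {..<?N}"
            then have vn: "v < n" using S_less by blast
            have "good v (?f v)" using v sure eq3 by (simp add: sure_def)
            moreover have "?f v \<le> arrs s3 aEst v" "arrs s3 aEst v \<le> ecc v"
              using s3 vn by (simp_all add: est_between_def)
            moreover from this(2) have "arrs s3 aEst v \<le> inf_dist" using ecc_le[OF vn] by (rule order_trans)
            ultimately show "good v (arrs s3 aEst v)" using good_mono by blast
          qed
        qed
        from ensures_frame[OF this]
        have "always prune_time prune (\<lambda>s'. ?Q s' \<and> ?F s' \<le> ?G) s3"
          by (rule always_weaken) (use eq2 eq3 in \<open>auto simp: unchanged_def\<close>)
        then show "ensures prune_time prune ?Q ?F s3 ?G"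
          by (rule ensures_of_always_conj)
      qed
    qed
  qed
  then show ?thesis by (rule ensures_time) (simp add: phase_time_def)
qed

text \<open>The failure budget of the phases to come, plus 1 if \<open>U\<close> has fallen behind
  the schedule that halves it in every phase.\<close>

definition potential :: "store \<Rightarrow> ennreal" where
  "potential s = of_nat (regs s rPhase) * miss_bound +
     (if regs s rLen * 2 ^ (l - regs s rPhase) \<le> n then 0 else 1)"

text \<open>When the phases are used up, being on schedule means
  \<open>rLen * 2 ^ l \<le> n\<close>, and \<open>n < 2 ^ l\<close> leaves only
  \<open>rLen = 0\<close>. Otherwise the loop has ended because \<open>U\<close> is already
  empty.\<close>

lemma ensures_phases:
  assumes sure: "sure s" and r: "regs s rPhase = l"
  shows "ensures (Suc (l * (phase_time + 2))) (While (Op Times (Reg rPhase) (Reg rLen)) phase)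
    sure (\<lambda>s'. if regs s' rLen = 0 then 0 else 1) s (of_nat l * miss_bound)"
proof -
  let ?e = "Op Times (Reg rPhase) (Reg rLen)"
  define I where "I = (\<lambda>s'. sure s' \<and> regs s' rPhase \<le> l)"
  define T where "T = (\<lambda>s' :: store. regs s' rPhase * (phase_time + 2))"
  have cond: "evl s' ?e = 0 \<longleftrightarrow> regs s' rPhase = 0 \<or> regs s' rLen = 0" if "I s'" for s'
  proof -
    have "regs s' rPhase * regs s' rLen \<le> n * n"
      using that l_le_n by (intro mult_mono) (auto simp: I_def sure_def)
    also have "\<dots> < 2 ^ w" by (rule word_n)
    finally show ?thesis by simp
  qed
  have "ensures (Suc (T s)) (While ?e phase) (\<lambda>s'. I s' \<and> evl s' ?e = 0) potential s (potential s)"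
  proof (rule ensures_While[where I = I and T = T and F = potential])
    show "I s" using sure r by (simp add: I_def)
  next
    fix s' assume I: "I s'" and c: "evl s' ?e \<noteq> 0"
    let ?r = "regs s' rPhase" and ?N = "regs s' rLen"
    from cond[OF I] c have pos: "?r > 0" "?N > 0" by auto
    have rl: "?r \<le> l" using I by (simp add: I_def)
    have "l < 2 ^ w" using l_le_n n_word by linarith
    then have ph: "ensures phase_time phase (\<lambda>s''. sure s'' \<and> regs s'' rPhase = ?r - 1)
      (\<lambda>s''. if 2 * regs s'' rLen \<le> ?N then 0 else 1) s' miss_bound"
      using I pos rl by (intro ensures_phase) (auto simp: I_def)
    \<comment> \<open>The part of the potential that is fixed before the phase: the budget of the
      later phases and any delay so far. A new delay is paid for by the \<open>miss_bound\<close> of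
      this phase.\<close>
    let ?a = "of_nat (?r - 1) * miss_bound + (if ?N * 2 ^ (l - ?r) \<le> n then 0 else (1 :: ennreal))"
    have "ensures phase_time phase (\<lambda>s''. I s'' \<and> T s'' + phase_time + 2 \<le> T s') potential s' (potential s')"
    proof (rule ensures_weaken[OF ensures_add_const[OF ph, of ?a]])
      fix s'' :: store assume s'': "sure s'' \<and> regs s'' rPhase = ?r - 1"
      obtain q where q: "?r = Suc q" using pos by (cases ?r) auto
      show "I s'' \<and> T s'' + phase_time + 2 \<le> T s'"
        using s'' rl q by (simp add: I_def T_def)
      have "regs s'' rLen * 2 ^ (l - (?r - 1)) \<le> n" if "2 * regs s'' rLen \<le> ?N" "?N * 2 ^ (l - ?r) \<le> n"
      proof -
        have "l - (?r - 1) = Suc (l - ?r)" using q rl by simp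
        then have "regs s'' rLen * 2 ^ (l - (?r - 1)) = (2 * regs s'' rLen) * 2 ^ (l - ?r)" by simp
        also have "\<dots> \<le> ?N * 2 ^ (l - ?r)" using that(1) by (rule mult_le_mono1)
        finally show ?thesis using that(2) by simp
      qed
      then have "(if regs s'' rLen * 2 ^ (l - (?r - 1)) \<le> n then 0 else (1 :: ennreal)) \<le>
        (if 2 * regs s'' rLen \<le> ?N then 0 else 1) + (if ?N * 2 ^ (l - ?r) \<le> n then 0 else 1)"
        by auto
      then show "potential s'' \<le> (if 2 * regs s'' rLen \<le> ?N then 0 else 1) + ?a"
        unfolding potential_def using s'' by (simp add: add.left_commute add_left_mono)
    next
      obtain q where q: "?r = Suc q" using pos by (cases ?r) auto
      show "miss_bound + ?a \<le> potential s'"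
        unfolding potential_def q by (simp add: distrib_right add.assoc)
    qed simp
    then show "\<exists>t. ensures t phase (\<lambda>s''. I s'' \<and> T s'' + t + 2 \<le> T s') potential s' (potential s')"
      by blast
  qed
  then show ?thesis
  proof (rule ensures_weaken)
    fix s' assume s': "I s' \<and> evl s' ?e = 0"
    then show "sure s'" by (simp add: I_def)
    show "(if regs s' rLen = 0 then 0 else 1) \<le> potential s'"
    proof (cases "regs s' rLen = 0")
      case False
      have "regs s' rPhase = 0 \<or> regs s' rLen = 0"
        using iffD1[OF cond[OF conjunct1[OF s']] conjunct2[OF s']] .
      with False have "regs s' rPhase = 0" by simp
      moreover have "\<not> regs s' rLen * 2 ^ l \<le> n"
        using l(1) mult_le_mono1[of 1 "regs s' rLen" "2 ^ l"] False by linarith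
      ultimately show ?thesis by (simp add: potential_def)
    qed simp
  next
    show "potential s \<le> of_nat l * miss_bound"
      using sure r by (simp add: potential_def sure_def)
  qed (simp add: T_def r)
qed

section \<open>Preprocessing of the input\<close>

definition initial :: "store \<Rightarrow> bool" where
  "initial s \<longleftrightarrow> regs s rN = n \<and> regs s rM = m \<and> (\<forall>r>1. regs s r = 0) \<and>
     (\<forall>e<m. arrs s aTail e = ta e \<and> arrs s aHead e = he e \<and> arrs s aWeight e = wt e) \<and>
     (\<forall>v<n. arrs s aS v \<noteq> 0 \<longleftrightarrow> v \<in> S) \<and> (\<forall>a\<ge>4. \<forall>i. arrs s a i = 0)"

lemma always_read_arcs:
  assumes "initial s"
  shows "always (14 * m + 3) read_arcs (\<lambda>s'. regs s' rW = W \<and>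
    (\<forall>u<n. arrs s' aFirstOut u = last_arc ta u m) \<and> (\<forall>e<m. arrs s' aNextOut e = last_arc ta (ta e) e) \<and>
    (\<forall>u<n. arrs s' aFirstIn u = last_arc he u m) \<and> (\<forall>e<m. arrs s' aNextIn e = last_arc he (he e) e)) s"
proof -
  let ?c = "If (Op Less (Reg rW) (Elem aWeight (Reg rI))) (Assign rW (Elem aWeight (Reg rI))) Skip ;;
      Store aNextOut (Reg rI) (Elem aFirstOut (Elem aTail (Reg rI))) ;;
      Store aFirstOut (Elem aTail (Reg rI)) (Op Plus (Reg rI) (Const 1)) ;;
      Store aNextIn (Reg rI) (Elem aFirstIn (Elem aHead (Reg rI))) ;;
      Store aFirstIn (Elem aHead (Reg rI)) (Op Plus (Reg rI) (Const 1))"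
  define I where "I = (\<lambda>i (s' :: store). regs s' rW = Max (insert 0 (wt ` {..<i})) \<and>
    (\<forall>u<n. arrs s' aFirstOut u = last_arc ta u i) \<and> (\<forall>e<i. arrs s' aNextOut e = last_arc ta (ta e) e) \<and>
    (\<forall>u<n. arrs s' aFirstIn u = last_arc he u i) \<and> (\<forall>e<i. arrs s' aNextIn e = last_arc he (he e) e))"
  have "always (m * (cost ?c + 4) + 3) read_arcs (I m) s"
    unfolding read_arcs_def
  proof (rule always_For_exec)
    fix i s' assume i: "i < m" "I i s'" "regs s' rI = i"
      and un: "unchanged (insert rI (written_regs ?c)) (written_arrs ?c) s s'"
    have arr: "arrs s' aTail i = ta i" "arrs s' aHead i = he i" "arrs s' aWeight i = wt i"
      using un assms i by (simp_all add: unchanged_def initial_def)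
    have iw: "Suc i < 2 ^ w" using i word_bounds(2) by simp
    have lt: "ta i < n" "he i < n" using i ta_less he_less by simp_all
    have Max: "Max (insert 0 (wt ` {..<Suc i})) = max (Max (insert 0 (wt ` {..<i}))) (wt i)"
    proof -
      have "insert 0 (wt ` {..<Suc i}) = insert (wt i) (insert 0 (wt ` {..<i}))"
        by (auto simp: lessThan_Suc)
      also have "Max \<dots> = max (wt i) (Max (insert 0 (wt ` {..<i})))"
        by (rule Max_insert) auto
      finally show ?thesis by (simp add: max.commute)
    qed
    define s'' where "s'' = exec ?c s'"
    have "regs s'' rW = max (regs s' rW) (wt i)"
      "arrs s'' aFirstOut = (arrs s' aFirstOut)(ta i := Suc i)"
      "arrs s'' aNextOut = (arrs s' aNextOut)(i := arrs s' aFirstOut (ta i))"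
      "arrs s'' aFirstIn = (arrs s' aFirstIn)(he i := Suc i)"
      "arrs s'' aNextIn = (arrs s' aNextIn)(i := arrs s' aFirstIn (he i))"
      using arr i(3) iw word_consts by (simp_all add: s''_def)
    then have "I (Suc i) s''"
      using i(1,2) lt unfolding I_def Max by (auto simp: less_Suc_eq)
    then show "I (Suc i) (exec ?c s')"
      by (simp only: s''_def)
  qed (use assms word_consts word_bounds(2) in \<open>auto simp: I_def initial_def\<close>)
  then show ?thesis
    by (rule always_weaken) (auto simp: I_def W_eq)
qed

text \<open>Doubling stops at the least power of 2 above \<open>n\<close>; the two bounds on
  \<open>2 ^ l\<close> say that this is the power with exponent \<open>l\<close>.\<close>

lemma always_log_loop:
  assumes "regs s rN = n" "regs s rPow = 1" "regs s rL = 0"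
  shows "always (5 * l + 1) log_loop (\<lambda>s'. regs s' rL = l) s"
proof -
  let ?e = "Op Less (Reg rPow) (Op Plus (Reg rN) (Const 1))"
  let ?c = "Assign rPow (Op Plus (Reg rPow) (Reg rPow)) ;; Assign rL (Op Plus (Reg rL) (Const 1))"
  define I where "I = (\<lambda>s' :: store. regs s' rL \<le> l \<and> regs s' rPow = 2 ^ regs s' rL)"
  define T where "T = (\<lambda>s' :: store. (l - regs s' rL) * 5)"
  have nw: "Suc n < 2 ^ w" using word_bounds(1) by simp
  have half: "2 ^ k \<le> n" if "k < l" for k
  proof -
    have "2 * 2 ^ k \<le> (2 :: nat) ^ l" using that power_increasing[of "Suc k" l "2 :: nat"] by simp
    with l(2) show ?thesis by linarith
  qed
  have cond: "evl s' ?e \<noteq> 0 \<longleftrightarrow> regs s' rL < l"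
    if "I s'" "unchanged (written_regs ?c) (written_arrs ?c) s s'" for s'
  proof -
    have N: "regs s' rN = n" using that assms by (simp add: unchanged_def)
    have "evl s' ?e \<noteq> 0 \<longleftrightarrow> 2 ^ regs s' rL < Suc n"
      using that(1) N nw word_consts by (simp add: I_def)
    also have "\<dots> \<longleftrightarrow> regs s' rL < l"
      using half[of "regs s' rL"] l(1) that(1) by (cases "regs s' rL = l") (auto simp: I_def)
    finally show ?thesis .
  qed
  have "always (Suc (T s)) log_loop (\<lambda>s'. I s' \<and> evl s' ?e = 0) s"
    unfolding log_loop_def
  proof (rule ensures_While[where I = I and T = T and F = "\<lambda>_. 0"])
    show "I s" using assms by (simp add: I_def)
  next
    fix s' assume I: "I s'" and c: "evl s' ?e \<noteq> 0" and un: "unchanged (written_regs ?c) (written_arrs ?c) s s'"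
    define k where "k = regs s' rL"
    have k: "k < l" "regs s' rPow = 2 ^ k" using cond[OF I un] c I by (auto simp: k_def I_def)
    have "2 ^ k \<le> n" "Suc k \<le> n" using half[OF k(1)] k(1) l_le_n by auto
    then have "2 ^ k + 2 ^ k < (2 :: nat) ^ w" "Suc k < 2 ^ w" using word_bounds(1) by linarith+
    then have ex: "regs (exec ?c s') rL = Suc k" "regs (exec ?c s') rPow = 2 ^ Suc k"
      using k word_consts by (simp_all add: k_def[symmetric])
    have "l - k = Suc (l - Suc k)" using k by simp
    then have "I (exec ?c s') \<and> T (exec ?c s') + cost ?c + 2 \<le> T s'"
      unfolding I_def T_def ex k_def[symmetric] using k by simp
    then have "always (cost ?c) ?c (\<lambda>s''. I s'' \<and> T s'' + cost ?c + 2 \<le> T s') s'"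
      by (intro always_exec) simp_all
    then show "\<exists>t. always t ?c (\<lambda>s''. I s'' \<and> T s'' + t + 2 \<le> T s') s'" by blast
  qed
  from ensures_frame[OF this] show ?thesis
  proof (rule always_weaken)
    fix s' assume s': "(I s' \<and> evl s' ?e = 0) \<and> unchanged (written_regs log_loop) (written_arrs log_loop) s s'"
    then have "\<not> regs s' rL < l" using cond[of s'] by (auto simp: log_loop_def)
    with s' show "regs s' rL = l" by (simp add: I_def)
  qed (use assms in \<open>simp add: T_def\<close>)
qed

lemma always_collect_S:
  assumes "regs s rN = n" "regs s rLen = 0" "\<forall>v<n. arrs s aS v \<noteq> 0 \<longleftrightarrow> v \<in> S"
  shows "always (8 * n + 3) collect_S (\<lambda>s'. regs s' rLen \<le> n \<and> arrs s' aU ` {..<regs s' rLen} = S) s"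
proof -
  let ?c = "If (Elem aS (Reg rI))
        (Store aU (Reg rLen) (Reg rI) ;; Assign rLen (Op Plus (Reg rLen) (Const 1)))
        Skip"
  define I where "I = (\<lambda>i (s' :: store). regs s' rLen \<le> i \<and> arrs s' aU ` {..<regs s' rLen} = {v\<in>S. v < i})"
  have "always (n * (cost ?c + 4) + 3) collect_S (I n) s"
    unfolding collect_S_def
  proof (rule always_For_exec)
    fix i s' assume i: "i < n" "I i s'" "regs s' rI = i"
      and un: "unchanged (insert rI (written_regs ?c)) (written_arrs ?c) s s'"
    define k where "k = regs s' rLen"
    have kw: "Suc k < 2 ^ w" using i word_bounds(1) by (simp add: I_def k_def)
    have mem: "arrs s' aS i \<noteq> 0 \<longleftrightarrow> i \<in> S" using un i assms by (simp add: unchanged_def)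
    have img: "arrs s' aU ` {..<k} = {v\<in>S. v < i}" using i by (simp add: I_def k_def)
    show "I (Suc i) (exec ?c s')"
    proof (cases "i \<in> S")
      case True
      have ex: "regs (exec ?c s') rLen = Suc k" "arrs (exec ?c s') aU = (arrs s' aU)(k := i)"
        using True mem i kw word_consts by (simp_all add: k_def)
      have "((arrs s' aU)(k := i)) ` {..<Suc k} = insert i (arrs s' aU ` {..<k})"
        by (auto simp: lessThan_Suc image_def)
      also have "\<dots> = {v\<in>S. v < Suc i}" using img True by auto
      finally show ?thesis using i unfolding I_def ex by (simp add: I_def k_def)
    next
      case False
      then have "exec ?c s' = s'" using mem i by simp
      moreover have "{v\<in>S. v < Suc i} = {v\<in>S. v < i}" using False by (auto simp: less_Suc_eq)
      ultimately show ?thesis using i by (simp add: I_def)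
    qed
  qed (use assms word_consts n_word in \<open>auto simp: I_def\<close>)
  then show ?thesis
    by (rule always_weaken) (use S in \<open>auto simp: I_def\<close>)
qed

definition "prepare_time = 14 * m + 8 * n + 5 * l + 21"

lemma always_prepare:
  assumes init: "initial s"
  shows "always prepare_time (prepare kc) (\<lambda>s'. sure s' \<and> regs s' rPhase = l) s"
proof -
  let ?c2 = "Assign rInf (Op Plus (Op Times (Reg rN) (Reg rW)) (Const 1)) ;;
      Assign rKeyInf (Op Times (Reg rInf) (Reg rN)) ;;
      Assign rPow (Const 1)"
  let ?c4 = "Assign rK (Op Times (Const kc) (Reg rL)) ;; Assign rPhase (Reg rL)"
  let ?Q = "\<lambda>s'. sure s' \<and> regs s' rPhase = l"
  have "always (Suc ((14 * m + 3) + Suc (cost ?c2 + Suc ((5 * l + 1) + Suc (cost ?c4 + (8 * n + 3)))))) (prepare kc) ?Q s"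
    unfolding prepare_def
  proof (rule always_Seq[OF always_read_arcs[OF init]])
    fix s1 :: store assume s1: "regs s1 rW = W \<and>
      (\<forall>u<n. arrs s1 aFirstOut u = last_arc ta u m) \<and> (\<forall>e<m. arrs s1 aNextOut e = last_arc ta (ta e) e) \<and>
      (\<forall>u<n. arrs s1 aFirstIn u = last_arc he u m) \<and> (\<forall>e<m. arrs s1 aNextIn e = last_arc he (he e) e)"
      and u1: "unchanged (written_regs read_arcs) (written_arrs read_arcs) s s1"
    define s2 where "s2 = exec ?c2 s1"
    have r1: "regs s1 rN = n" "regs s1 rL = 0" "regs s1 rLen = 0"
      using u1 init by (simp_all add: unchanged_def initial_def)
    have "inf_dist < 2 ^ w" "inf_key < 2 ^ w" "n * W < 2 ^ w"
      using word_bounds(3,4) by (linarith, linarith, simp add: inf_dist_def)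
    then have s2: "regs s2 rInf = inf_dist" "regs s2 rKeyInf = inf_key" "regs s2 rPow = 1" "arrs s2 = arrs s1"
      "regs s2 rN = n" "regs s2 rL = 0" "regs s2 rLen = 0"
      using r1 s1 word_consts by (simp_all add: s2_def inf_dist_def inf_key_def)
    have "always (Suc ((5 * l + 1) + Suc (cost ?c4 + (8 * n + 3)))) (log_loop ;; ?c4 ;; collect_S) ?Q s2"
    proof (rule always_Seq[OF always_log_loop[OF s2(5,3,6)]])
      fix s3 :: store assume L3: "regs s3 rL = l"
        and u3: "unchanged (written_regs log_loop) (written_arrs log_loop) s2 s3"
      define s4 where "s4 = exec ?c4 s3"
      have "kc \<le> kc * l" using l_le_n by simp
      then have "kc < 2 ^ w" using word_K by linarith
      moreover have "arrs s3 = arrs s2" using u3 by (auto simp: unchanged_def)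
      ultimately have s4: "regs s4 rK = kc * l" "regs s4 rPhase = l" "arrs s4 = arrs s1"
        "regs s4 rN = n" "regs s4 rInf = inf_dist" "regs s4 rKeyInf = inf_key" "regs s4 rLen = 0"
        using L3 word_K s2 u3 by (simp_all add: s4_def unchanged_def)
      have arr1: "arrs s1 aTail = arrs s aTail" "arrs s1 aHead = arrs s aHead" "arrs s1 aWeight = arrs s aWeight"
        "arrs s1 aS = arrs s aS" "arrs s1 aEst = arrs s aEst"
        using u1 by (simp_all add: unchanged_def)
      have b4: "base s4"
        unfolding base_def adjacency_def rev.adjacency_def
        using s1 init by (simp add: s4 arr1 arr1(2)[unfolded One_nat_def] initial_def)
      have "always (8 * n + 3) collect_S ?Q s4"
      proof (rule always_weaken[OF ensures_frame[OF always_collect_S]])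
        show "regs s4 rN = n" "regs s4 rLen = 0" by (simp_all add: s4)
        show "\<forall>v<n. arrs s4 aS v \<noteq> 0 \<longleftrightarrow> v \<in> S" using b4 by (simp add: base_def)
        fix s5 :: store
        assume s5: "(regs s5 rLen \<le> n \<and> arrs s5 aU ` {..<regs s5 rLen} = S) \<and>
          unchanged (written_regs collect_S) (written_arrs collect_S) s4 s5"
        then have u5: "unchanged (written_regs collect_S) (written_arrs collect_S) s4 s5" by simp
        have b5: "base s5" by (rule base_unchanged[OF b4 u5]) auto
        have "arrs s5 aEst = arrs s4 aEst" "regs s5 rPhase = l" using u5 s4 by (simp_all add: unchanged_def)
        then show "?Q s5" using s5 b5 init by (auto simp: sure_def s4 arr1 initial_def)
      qed simp
      then show "always (Suc (cost ?c4 + (8 * n + 3))) (?c4 ;; collect_S) ?Q s3"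
        by (intro always_exec_Seq) (simp_all add: s4_def)
    qed
    then show "always (Suc (cost ?c2 + Suc ((5 * l + 1) + Suc (cost ?c4 + (8 * n + 3))))) (?c2 ;; log_loop ;; ?c4 ;; collect_S) ?Q s1"
      by (intro always_exec_Seq) (simp_all add: s2_def)
  qed
  then show ?thesis by (rule ensures_time) (simp add: prepare_time_def)
qed

section \<open>Output and the probability of failure\<close>

lemma always_flag_infinite:
  assumes "base s" "\<forall>v<n. arrs s aFlag v = 0"
  shows "always (6 * n + 3) flag_infinite (\<lambda>s'. \<forall>v<n. arrs s' aFlag v \<noteq> 0 \<longleftrightarrow> inf_dist \<le> arrs s aEst v) s"
proof -
  let ?c = "If (Op Less (Elem aEst (Reg rI)) (Reg rInf)) Skip (Store aFlag (Reg rI) (Const 1))"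
  define I where "I = (\<lambda>i (s' :: store). \<forall>v<n. arrs s' aFlag v \<noteq> 0 \<longleftrightarrow> v < i \<and> inf_dist \<le> arrs s aEst v)"
  have "always (n * (cost ?c + 4) + 3) flag_infinite (I n) s"
    unfolding flag_infinite_def
  proof (rule always_For_exec)
    fix i s' assume i: "i < n" "I i s'" "regs s' rI = i"
      and un: "unchanged (insert rI (written_regs ?c)) (written_arrs ?c) s s'"
    have "arrs s' aEst = arrs s aEst" "regs s' rInf = inf_dist"
      using un base_regs[OF assms(1)] by (simp_all add: unchanged_def)
    then show "I (Suc i) (exec ?c s')"
      using i word_consts by (auto simp: I_def less_Suc_eq)
  qed (use assms base_regs[OF assms(1)] word_consts n_word in \<open>auto simp: I_def\<close>)
  then show ?thesis by (rule always_weaken) (auto simp: I_def)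
qed

definition correct :: "store \<Rightarrow> bool" where
  "correct s \<longleftrightarrow> (\<forall>v\<in>S. arrs s aEst v \<le> ecc v \<and> good v (arrs s aEst v) \<and>
     (arrs s aFlag v \<noteq> 0 \<longleftrightarrow> inf_dist \<le> arrs s aEst v))"

definition "total_time = prepare_time + l * (phase_time + 2) + 6 * n + 6"

theorem ensures_eccentricities:
  assumes init: "initial s"
  shows "ensures total_time (eccentricities kc) (\<lambda>_. True) (\<lambda>s'. if correct s' then 0 else 1) s
    (of_nat l * miss_bound)"
proof -
  let ?W = "While (Op Times (Reg rPhase) (Reg rLen)) phase"
  let ?F = "\<lambda>s'. if correct s' then 0 else (1 :: ennreal)"
  have "ensures (Suc (prepare_time + Suc (Suc (l * (phase_time + 2)) + (6 * n + 3)))) (eccentricities kc) (\<lambda>_. True) ?F s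
    (of_nat l * miss_bound)"
    unfolding eccentricities_def
  proof (rule ensures_always_Seq[OF always_prepare[OF init]])
    fix s1 :: store assume s1: "sure s1 \<and> regs s1 rPhase = l"
      and u1: "unchanged (written_regs (prepare kc)) (written_arrs (prepare kc)) s s1"
    have "arrs s1 aFlag = arrs s aFlag" using u1 by (simp add: unchanged_def prepare_def)
    then have flag1: "\<forall>v. arrs s1 aFlag v = 0" using init by (simp add: initial_def)
    have "ensures (Suc (l * (phase_time + 2))) ?W sure (\<lambda>s'. if regs s' rLen = 0 then 0 else 1) s1 (of_nat l * miss_bound)"
      using s1 by (intro ensures_phases) simp_all
    from ensures_frame[OF this]
    show "ensures (Suc (Suc (l * (phase_time + 2)) + (6 * n + 3))) (?W ;; flag_infinite) (\<lambda>_. True) ?F s1 (of_nat l * miss_bound)"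
    proof (rule ensures_Seq)
      fix s2 :: store assume s2: "sure s2 \<and> unchanged (written_regs ?W) (written_arrs ?W) s1 s2"
      then have b2: "base s2" and flag2: "\<forall>v<n. arrs s2 aFlag v = 0"
        using flag1 by (simp_all add: sure_def unchanged_def)
      let ?B = "if regs s2 rLen = 0 then 0 else (1 :: ennreal)"
      have "always (6 * n + 3) flag_infinite (\<lambda>s'. True \<and> ?F s' \<le> ?B) s2"
      proof (rule always_weaken[OF ensures_frame[OF always_flag_infinite[OF b2 flag2]]])
        fix s3 :: store
        assume s3: "(\<forall>v<n. arrs s3 aFlag v \<noteq> 0 \<longleftrightarrow> inf_dist \<le> arrs s2 aEst v) \<and>
          unchanged (written_regs flag_infinite) (written_arrs flag_infinite) s2 s3"
        then have "arrs s3 aEst = arrs s2 aEst" by (simp add: unchanged_def)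
        then have "correct s3" if "regs s2 rLen = 0"
          using s2 s3 that S_less by (simp add: correct_def sure_def)
        then show "True \<and> ?F s3 \<le> ?B" by simp
      qed simp
      then show "ensures (6 * n + 3) flag_infinite (\<lambda>_. True) ?F s2 ?B"
        by (rule ensures_of_always_conj)
    qed
  qed
  then show ?thesis by (rule ensures_time) (simp add: total_time_def)
qed

end

section \<open>Distances in the digraph and in its arc list\<close>

locale arc_list_of_digraph = pair_fin_digraph G for G :: "nat pair_pre_digraph" +
  fixes es :: "(nat \<times> nat) list" and wt :: weights
  assumes set_es: "set es = parcs G"
begin

abbreviation "al_walk \<equiv> arc_walk (length es) (\<lambda>e. fst (es ! e)) (\<lambda>e. snd (es ! e)) (\<lambda>e. wt (es ! e))"
abbreviation "walk_cost \<equiv> awalk_cost (\<lambda>e. real (wt e))"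

lemma awalk_of_arc_walk:
  assumes "al_walk u v x" "u \<in> pverts G"
  shows "\<exists>p. awalk u p v \<and> walk_cost p = real x"
  using assms
proof (induction rule: arc_walk.induct)
  case Nil
  then show ?case by (intro exI[of _ "[]"]) (simp add: awalk_Nil_iff)
next
  case (snoc e x)
  then obtain p where p: "awalk u p (fst (es ! e))" "walk_cost p = real x" by blast
  have "es ! e \<in> parcs G" using snoc set_es nth_mem by blast
  then have "awalk (fst (es ! e)) [es ! e] (snd (es ! e))"
    using arc_fst_in_verts arc_snd_in_verts by (simp add: awalk_simps)
  with p have "awalk u (p @ [es ! e]) (snd (es ! e))" by (blast intro: awalk_appendI)
  with p show ?case by (intro exI[of _ "p @ [es ! e]"]) simp
qed

lemma arc_walk_of_awalk:
  assumes "awalk u p v" "\<And>e. e \<in> parcs G \<Longrightarrow> wt e \<le> W"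
  shows "\<exists>x. al_walk u v x \<and> walk_cost p = real x \<and> x \<le> length p * W"
  using assms(1)
proof (induction p arbitrary: u)
  case Nil
  then have "u = v" by (simp add: awalk_Nil_iff)
  then show ?case using arc_walk.Nil by (intro exI[of _ 0]) auto
next
  case (Cons e p)
  then have e: "e \<in> parcs G" "fst e = u" "awalk (snd e) p v" by (simp_all add: awalk_Cons_iff)
  with Cons.IH obtain x where x: "al_walk (snd e) v x" "walk_cost p = real x" "x \<le> length p * W" by blast
  from e set_es obtain i where i: "i < length es" "es ! i = e" by (metis in_set_conv_nth)
  have "al_walk u (snd (es ! i)) (0 + wt (es ! i))"
    using arc_walk.snoc[OF _ i(1), of "\<lambda>e. fst (es ! e)"] i e arc_walk.Nil by metis
  with x i have "al_walk u v (wt e + x)" using arc_walk_trans by fastforce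
  moreover have "wt e \<le> W" using e assms(2) by simp
  ultimately show ?case using x by (intro exI[of _ "wt e + x"]) simp
qed

text \<open>Passing to a simple path bounds the number of arcs by the number of vertices. This
  discharges \<open>walk_short\<close>.\<close>

lemma arc_walk_short:
  assumes "al_walk u v x" "u \<in> pverts G" "\<And>e. e \<in> parcs G \<Longrightarrow> wt e \<le> W"
  shows "\<exists>y \<le> card (pverts G) * W. al_walk u v y"
proof -
  from awalk_of_arc_walk[OF assms(1,2)] have "u \<rightarrow>\<^sup>*\<^bsub>with_proj G\<^esub> v" by (auto simp: reachable_awalk)
  then obtain p where p: "apath u p v" using min_cost_awalk[of u v "\<lambda>e. real (wt e)"] by auto
  then have "awalk u p v" by (simp add: apath_def)
  then obtain y where y: "al_walk u v y" "y \<le> length p * W" using arc_walk_of_awalk assms(3) by blast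
  have "length p \<le> card (pverts G)" using length_apath[OF p] by simp
  then have "length p * W \<le> card (pverts G) * W" by (rule mult_le_mono1)
  with y show ?thesis by (meson order_trans)
qed

text \<open>Costs of walks are natural numbers, so the infimum is attained by the least one; without
  walks it is the infimum of the empty set, which is infinite.\<close>

lemma dist_G_eq:
  assumes u: "u \<in> pverts G" and W: "\<And>e. e \<in> parcs G \<Longrightarrow> wt e \<le> W"
  shows "dist_G G wt u v =
    (if \<exists>x. al_walk u v x then ereal (real (LEAST x. al_walk u v x)) else \<infinity>)"
proof (cases "\<exists>x. al_walk u v x")
  case True
  then have least: "al_walk u v (LEAST x. al_walk u v x)" by (rule LeastI_ex)
  have "dist_G G wt u v = ereal (real (LEAST x. al_walk u v x))"
    unfolding dist_G_def \<mu>_def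
  proof (rule antisym)
    obtain p where "awalk u p v" "walk_cost p = real (LEAST x. al_walk u v x)"
      using awalk_of_arc_walk[OF least u] by blast
    then show "(INF p\<in>{p. awalk u p v}. ereal (walk_cost p)) \<le> ereal (real (LEAST x. al_walk u v x))"
      by (intro INF_lower2[of p]) auto
    show "ereal (real (LEAST x. al_walk u v x)) \<le> (INF p\<in>{p. awalk u p v}. ereal (walk_cost p))"
    proof (rule INF_greatest)
      fix p assume "p \<in> {p. awalk u p v}"
      then obtain x where "al_walk u v x" "walk_cost p = real x" using arc_walk_of_awalk W by blast
      then show "ereal (real (LEAST x. al_walk u v x)) \<le> ereal (walk_cost p)" by (simp add: Least_le)
    qed
  qed
  with True show ?thesis by simp
next
  case False
  then have "{p. awalk u p v} = {}" using arc_walk_of_awalk W by blast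
  then have "dist_G G wt u v = \<infinity>" unfolding dist_G_def \<mu>_def by (simp add: top_ereal_def)
  with False show ?thesis by simp
qed

end

section \<open>Approximation guarantee and running time\<close>

lemma (in ecc_input) correct_approximates:
  assumes corr: "correct s" and \<tau>: "0 < \<tau>" "\<tau> < 1"
    and dist: "\<And>v u. v \<in> S \<Longrightarrow> dist_G G wt' v u = (if dst v u < inf_dist then ereal (real (dst v u)) else \<infinity>)"
  shows "approximates \<tau> G wt' S s"
  unfolding approximates_def
proof (intro ballI conjI)
  fix v assume v: "v \<in> S"
  let ?x = "arrs s aEst v"
  have fin: "finite (dist_G G wt' v ` S)" "dist_G G wt' v ` S \<noteq> {}" using finite_S v by auto
  have x: "?x \<le> ecc v" "good v ?x" "arrs s aFlag v \<noteq> 0 \<longleftrightarrow> inf_dist \<le> ?x"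
    using corr v by (simp_all add: correct_def)
  then have est: "estimate s v = (if ?x < inf_dist then ereal (real ?x) else \<infinity>)"
    by (auto simp: estimate_def)
  have "ecc v \<in> insert 0 (dst v ` S)"
    unfolding ecc_def using finite_S by (intro Max_in) auto
  \<comment> \<open>If \<open>ecc v\<close> is only the extra 0, the estimate is 0 and
    \<open>u = v\<close> will do.\<close>
  then obtain u where u: "u \<in> S" "?x \<le> dst v u" using x(1) v by fastforce
  then have "estimate s v \<le> dist_G G wt' v u"
    unfolding est dist[OF v] using dst_le[OF S_less[OF v], of u] by auto
  also have "\<dots> \<le> subset_ecc G wt' S v"
    unfolding subset_ecc_def using fin u by (intro Max_ge) auto
  finally show "estimate s v \<le> subset_ecc G wt' S v" .
  show "ereal ((1 - \<tau>) / 2) * subset_ecc G wt' S v \<le> estimate s v"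
  proof (cases "?x < inf_dist")
    case True
    have "subset_ecc G wt' S v \<in> dist_G G wt' v ` S"
      unfolding subset_ecc_def using fin by (rule Max_in)
    then obtain y where y: "y \<in> S" "subset_ecc G wt' S v = dist_G G wt' v y" by auto
    have "dst v y < inf_dist" "dst v y \<le> 2 * ?x"
      using True x(2) y by (auto simp: good_def)
    then have eq: "subset_ecc G wt' S v = ereal (real (dst v y))" and "real (dst v y) \<le> 2 * real ?x"
      using y dist[OF v] by simp_all
    then have "(1 - \<tau>) / 2 * real (dst v y) \<le> (1 - \<tau>) / 2 * (2 * real ?x)"
      using \<tau> by (intro mult_left_mono) auto
    also have "\<dots> \<le> real ?x" using \<tau> by (simp add: mult_left_le_one_le)
    finally show ?thesis unfolding est eq using True by simp
  qed (simp add: est)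
qed

text \<open>There are \<open>l\<close> phases with \<open>kc * l\<close> samples each, and a sample
  takes two runs of Dijkstra in \<open>O((n + m) * l)\<close>; hence the exponent 3. Lower-order
  terms are absorbed by measuring in units of \<open>x = (n + m) * l\<close>.\<close>

lemma (in ecc_input) total_time_le: "total_time \<le> (141 * kc + 169) * ((n + m) * l ^ 3)"
proof -
  define x where "x = (n + m) * l"
  have l1: "1 \<le> l" using l_le_n by simp
  have mono: "a \<le> a * l" for a using mult_le_mono2[OF l1, of a] by simp
  have nx: "n + m \<le> x" "l \<le> x" "1 \<le> x"
    using mono[of "n + m"] mult_le_mono1[of 1 "n + m" l] n_pos l1 unfolding x_def by linarith+
  have d: "dijkstra_time \<le> 56 * x"
  proof -
    have "12 * l + 44 \<le> 56 * l" using l1 by simp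
    then have "dijkstra_time \<le> (n + m) * (56 * l)" unfolding dijkstra_time_def by (rule mult_le_mono2)
    then show ?thesis by (simp add: x_def)
  qed
  have s: "sample_time + 6 \<le> 141 * x" using d nx unfolding sample_time_def by linarith
  have p: "prune_time \<le> 99 * x" using d nx unfolding prune_time_def by linarith
  have xx: "x \<le> x * l" "x * l \<le> x * l * l" using mono by blast+
  have "kc * l * (sample_time + 6) \<le> kc * l * (141 * x)" using s by (rule mult_le_mono2)
  also have "\<dots> = 141 * kc * (x * l)" by (simp add: algebra_simps)
  finally have ph: "phase_time + 2 \<le> 141 * kc * (x * l) + 117 * (x * l)"
    using p nx xx unfolding phase_time_def by linarith
  have "l * (phase_time + 2) \<le> l * (141 * kc * (x * l) + 117 * (x * l))" using ph by (rule mult_le_mono2)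
  also have "\<dots> = 141 * kc * (x * l * l) + 117 * (x * l * l)" by (simp add: algebra_simps)
  finally have "total_time \<le> 141 * kc * (x * l * l) + 169 * (x * l * l)"
    using nx xx unfolding total_time_def prepare_time_def by linarith
  also have "\<dots> = (141 * kc + 169) * ((n + m) * l ^ 3)"
    by (simp add: x_def algebra_simps power3_eq_cube)
  finally show ?thesis .
qed

section \<open>Logarithm, word size and failure probability\<close>

lemma ex_log:
  assumes "n \<ge> (1 :: nat)"
  obtains l where "n < 2 ^ l" "2 ^ l \<le> 2 * n"
proof
  let ?l = "LEAST l. n < 2 ^ l"
  show 1: "n < 2 ^ ?l" by (rule LeastI[of _ n]) (rule less_exp)
  with assms obtain k where k: "?l = Suc k" by (cases ?l) auto
  then have "\<not> n < 2 ^ k" using not_less_Least[of k "\<lambda>l. n < 2 ^ l"] by simp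
  with k show "2 ^ ?l \<le> 2 * n" by simp
qed

text \<open>With \<open>N = n + W + 2\<close> the first sum is at most
  \<open>N ^ 3 + 2 * N ^ 2 < 3 * N ^ 3 \<le> N ^ 4\<close>, which explains the 4. The summand
  \<open>kc\<close> in the exponent makes room for the program constant:
  \<open>kc < 2 ^ kc \<le> N ^ kc\<close>, so \<open>kc * l < N ^ (kc + 1)\<close>.\<close>

lemma word_size_bounds:
  fixes n W m l kc w :: nat
  assumes "(n + W + 2) ^ (kc + 4) \<le> 2 ^ w" "m \<le> n * n" "l \<le> n" "n \<ge> 1"
  shows "(n * W + 1) * n + W + 2 * n + m + 2 < 2 ^ w" "kc * l < 2 ^ w" "n * n < 2 ^ w"
proof -
  define N where "N = n + W + 2"
  have N: "n \<le> N" "W \<le> N" "3 \<le> N" "1 \<le> N" using assms(4) by (simp_all add: N_def)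
  have le: "N ^ k \<le> 2 ^ w" if "k \<le> kc + 4" for k
    using power_increasing[OF that N(4)] assms(1) unfolding N_def by linarith
  have "n * W + 1 \<le> N * N" by (simp add: N_def algebra_simps)
  then have 1: "(n * W + 1) * n \<le> N * N * N" using N(1) by (rule mult_le_mono)
  have 2: "W + 2 * n + 2 \<le> 2 * N" by (simp add: N_def)
  have 3: "n * n \<le> N * N" using N by (intro mult_le_mono)
  have 4: "2 * N \<le> N * N" using N by simp
  have 5: "3 * (N * N) \<le> N * (N * N)" using N(3) by (rule mult_le_mono1)
  have 6: "3 * (N * (N * N)) \<le> N * (N * (N * N))" using N(3) by (rule mult_le_mono1)
  have 7: "0 < N * (N * N)" using N by simp
  have N4: "N * (N * (N * N)) \<le> 2 ^ w" using le[of 4] by (simp add: numeral_eq_Suc)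
  have "(n * W + 1) * n + (W + 2 * n + 2) + m \<le> N * (N * N) + N * N + N * N"
    using 1 2 3 4 assms(2) by (simp only: mult.assoc)
  also have "\<dots> < 3 * (N * (N * N))" using 5 7 by linarith
  also have "\<dots> \<le> 2 ^ w" using 6 N4 by linarith
  finally show "(n * W + 1) * n + W + 2 * n + m + 2 < 2 ^ w" by linarith
  have "N * N < N * (N * (N * N))" using 5 6 7 by linarith
  with 3 N4 show "n * n < 2 ^ w" by linarith
  have "kc < 2 ^ kc" by (rule less_exp)
  also have "\<dots> \<le> N ^ kc" using N by (intro power_mono) auto
  finally have "kc * N < N ^ kc * N" using N by simp
  moreover have "kc * l \<le> kc * N" using assms(3) N(1) by (intro mult_le_mono2) simp
  moreover have "N ^ kc * N \<le> 2 ^ w" using le[of "Suc kc"] by (simp add: mult.commute)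
  ultimately show "kc * l < 2 ^ w" by linarith
qed

text \<open>One factor \<open>n\<close> is the union bound and the other bounds the number
  \<open>l\<close> of phases; against them stands \<open>2 ^ (kc * l) \<ge> n ^ kc\<close>.\<close>

lemma failure_le:
  fixes c :: real
  assumes n: "n \<ge> 1" and l: "l \<le> n" "n < 2 ^ l" and kc: "c + 2 \<le> real kc"
  shows "real l * (real n * (1 / 2) ^ (kc * l)) \<le> 1 / real n powr c"
proof -
  have "real n ^ kc \<le> (2 ^ l) ^ kc"
    using l(2) by (intro power_mono) (simp_all add: less_imp_le flip: of_nat_power_less_of_nat_cancel_iff)
  then have "(1 / 2 :: real) ^ (kc * l) \<le> 1 / real n ^ kc"
    using n by (simp add: power_mult[symmetric] mult.commute power_one_over frac_le)
  then have "real l * (real n * (1 / 2) ^ (kc * l)) \<le> real n * (real n * (1 / real n ^ kc))"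
    using l(1) by (intro mult_mono) auto
  also have "\<dots> = real n powr (2 - real kc)"
    using n by (simp add: powr_diff powr_realpow power2_eq_square)
  also have "\<dots> \<le> real n powr (- c)"
    using n kc by (intro powr_mono) auto
  finally show ?thesis by (simp add: powr_minus_divide)
qed

theorem theorem27:
  fixes c :: real
  assumes "c > 0"
  shows "\<exists>(P :: com) (b :: nat) (k :: nat) (C :: real).
    \<forall>(n :: nat) (m :: nat) (G :: nat pair_pre_digraph) (wt :: weights) (S :: nat set)
      (\<tau> :: real) (es :: (nat \<times> nat) list) (w :: nat).
      n \<ge> 1 \<longrightarrow> pair_fin_digraph G \<longrightarrow> pverts G = {..<n} \<longrightarrow> card (parcs G) = m \<longrightarrow>
      S \<subseteq> pverts G \<longrightarrow> 0 < \<tau> \<longrightarrow> \<tau> < 1 \<longrightarrow>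
      distinct es \<longrightarrow> set es = parcs G \<longrightarrow> word_size_ok b w G wt \<longrightarrow>
      (\<exists>t :: nat.
        real t \<le> C * (real (n + m) / \<tau>) * log 2 (real n + 2) ^ k \<and>
        halts_within w \<tau> t P (input_store n es wt S) \<and>
        measure_pmf.prob (run w \<tau> t P (input_store n es wt S))
          {(c', s). approximates \<tau> G wt S s} \<ge> 1 - 1 / real n powr c)"
proof -
  define kc where "kc = nat \<lceil>c\<rceil> + 2"
  have kc: "c + 2 \<le> real kc" unfolding kc_def by linarith
  show ?thesis
  \<comment> \<open>The exponent \<open>kc + 4\<close> is that of \<open>word_size_bounds\<close>, 3
    is the power of \<open>l\<close> in \<open>total_time_le\<close>, and \<open>8 = 2 ^ 3\<close>
    comes from \<open>l \<le> 2 * log 2 (n + 2)\<close>.\<close>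
  proof (rule exI[of _ "eccentricities kc"], rule exI[of _ "kc + 4"], rule exI[of _ 3],
      rule exI[of _ "real (8 * (141 * kc + 169))"], intro allI impI)
    fix n m :: nat and G :: "nat pair_pre_digraph" and wt :: weights and S :: "nat set"
      and \<tau> :: real and es :: "(nat \<times> nat) list" and w :: nat
    assume n: "n \<ge> 1" and G: "pair_fin_digraph G" and V: "pverts G = {..<n}" and m: "card (parcs G) = m"
      and S: "S \<subseteq> pverts G" and \<tau>: "0 < \<tau>" "\<tau> < 1" and es: "distinct es" "set es = parcs G"
      and word: "word_size_ok (kc + 4) w G wt"
    interpret pair_fin_digraph G by (rule G)
    interpret arc_list_of_digraph G es wt by unfold_locales (rule es(2))
    let ?s = "input_store n es wt S"
    define W where "W = max_weight G wt"
    define ta he wt' where "ta = (\<lambda>e. fst (es ! e))" and "he = (\<lambda>e. snd (es ! e))" and "wt' = (\<lambda>e. wt (es ! e))"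
    have len: "length es = m" using es m distinct_card by metis
    obtain l where l: "n < 2 ^ l" "2 ^ l \<le> 2 * n" using ex_log[OF n] by blast
    have nth: "es ! e \<in> parcs G" if "e < m" for e using that len es(2) nth_mem by blast
    have W_le: "wt e \<le> W" if "e \<in> parcs G" for e
      unfolding W_def max_weight_def using that pair_finite_arcs by (intro Max_ge) auto
    have sub: "parcs G \<subseteq> {..<n} \<times> {..<n}"
      using arc_fst_in_verts arc_snd_in_verts V by (metis SigmaI lessThan_iff prod.collapse subsetI)
    have "m \<le> card ({..<n} \<times> {..<n})"
      unfolding m[symmetric] by (intro card_mono sub) simp
    then have m_le: "m \<le> n * n" by simp
    have l_le: "l \<le> n"
    proof (cases l)
      case (Suc k)
      then have "2 ^ k \<le> n" using l(2) by simp
      then show ?thesis using less_exp[of k] Suc by linarith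
    qed simp
    have "(n + W + 2) ^ (kc + 4) \<le> 2 ^ w"
      using word unfolding word_size_ok_def W_def V by simp
    note words = word_size_bounds[OF this m_le l_le n]
    have W_eq: "W = Max (insert 0 (wt' ` {..<m}))"
    proof -
      have "parcs G = (!) es ` {..<m}"
        using es(2) len by (simp add: set_conv_nth image_def) (auto simp: image_def)
      then have "wt ` parcs G = wt' ` {..<m}" by (simp add: wt'_def image_image)
      then show ?thesis by (simp add: W_def max_weight_def)
    qed
    have walk_eq: "al_walk = arc_walk m ta he wt'" by (simp add: ta_def he_def wt'_def len)
    interpret ecc_input w \<tau> n m W l ta he wt' S kc
    proof unfold_locales
      show "n \<le> 2 ^ l" using l by simp
      show "\<exists>y\<le>n * W. arc_walk m ta he wt' u v y" if "arc_walk m ta he wt' u v x" "u < n" for u v x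
        using arc_walk_short[of u v x W] that W_le V unfolding walk_eq by simp
    qed (use n nth arc_fst_in_verts arc_snd_in_verts V W_le words l S W_eq in \<open>auto simp: ta_def he_def wt'_def\<close>)
    have "initial ?s"
      unfolding initial_def using S V len by (auto simp: input_store_def ta_def he_def wt'_def)
    then have main: "ensures total_time (eccentricities kc) (\<lambda>_. True) (\<lambda>s'. if correct s' then 0 else 1) ?s
        (of_nat l * miss_bound)"
      by (rule ensures_eccentricities)
    let ?M = "measure_pmf (run w \<tau> total_time (eccentricities kc) ?s)"
    let ?A = "{(c', s). approximates \<tau> G wt S s}"
    have dist: "dist_G G wt v u = (if dst v u < inf_dist then ereal (real (dst v u)) else \<infinity>)" if "v \<in> S" for v u
    proof -
      have v: "v \<in> pverts G" "v < n" using that S V by auto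
      have "dist_G G wt v u = (if \<exists>x. al_walk v u x then ereal (real (LEAST x. al_walk v u x)) else \<infinity>)"
        by (rule dist_G_eq[OF v(1)]) (rule W_le)
      then show ?thesis
        using dst_less_iff[OF v(2), of u] unfolding walk_eq by (auto simp: arc_dist_def)
    qed
    \<comment> \<open>A run that misses the approximation is not \<open>correct\<close>, so the
      indicator of failure lies below the final potential, whose expectation \<open>main\<close>
      bounds.\<close>
    have "emeasure ?M (- ?A) = (\<integral>\<^sup>+x. indicator (- ?A) x \<partial>?M)" by simp
    also have "\<dots> \<le> (\<integral>\<^sup>+x. (if correct (snd x) then 0 else 1) \<partial>?M)"
      using correct_approximates[OF _ \<tau> dist] by (intro nn_integral_mono) (auto simp: indicator_def)
    also have "\<dots> \<le> of_nat l * miss_bound" using main by (simp add: ensures_def)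
    also have "\<dots> = ennreal (real l * (real n * (1 / 2) ^ (kc * l)))"
      unfolding miss_bound_def by (simp add: ennreal_mult ennreal_of_nat_eq_real_of_nat)
    also have "\<dots> \<le> ennreal (1 / real n powr c)"
      using failure_le[OF n l_le l(1) kc] by (rule ennreal_leI)
    finally have "measure ?M (- ?A) \<le> 1 / real n powr c"
      by (simp add: measure_pmf.emeasure_eq_measure)
    then have prob: "measure ?M ?A \<ge> 1 - 1 / real n powr c"
      using measure_pmf.prob_compl[of ?A "run w \<tau> total_time (eccentricities kc) ?s"] by (simp add: Compl_eq_Diff_UNIV)
    have log: "real l \<le> 2 * log 2 (real n + 2)"
    proof -
      have "2 * n \<le> (n + 2) ^ 2" by (simp add: power2_eq_square)
      then have "2 ^ l \<le> (n + 2) ^ 2" using l(2) by linarith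
      then have "real (2 ^ l) \<le> real ((n + 2) ^ 2)" by (rule of_nat_mono)
      then have "2 ^ l \<le> (real n + 2) ^ 2" by (simp add: add.commute)
      then have "log 2 (2 ^ l) \<le> log 2 ((real n + 2) ^ 2)" by (intro log_mono) auto
      then show ?thesis by (simp add: log_nat_power)
    qed
    have "real total_time \<le> real ((141 * kc + 169) * ((n + m) * l ^ 3))"
      using total_time_le by (rule of_nat_mono)
    also have "\<dots> = real (141 * kc + 169) * (real (n + m) * real l ^ 3)" by simp
    also have "\<dots> \<le> real (141 * kc + 169) * (real (n + m) / \<tau> * (2 * log 2 (real n + 2)) ^ 3)"
    proof (intro mult_left_mono mult_mono power_mono log)
      \<comment> \<open>As \<open>\<tau> < 1\<close>, dividing by it only enlarges the
        bound.\<close>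
      have "real (n + m) * \<tau> \<le> real (n + m) * 1" using \<tau> by (intro mult_left_mono) auto
      then show "real (n + m) \<le> real (n + m) / \<tau>" using \<tau> by (simp add: field_simps)
    qed (use \<tau> in auto)
    also have "\<dots> = real (8 * (141 * kc + 169)) * (real (n + m) / \<tau>) * log 2 (real n + 2) ^ 3"
      by (simp add: power_mult_distrib)
    finally show "\<exists>t. real t \<le> real (8 * (141 * kc + 169)) * (real (n + m) / \<tau>) * log 2 (real n + 2) ^ 3 \<and>
        halts_within w \<tau> t (eccentricities kc) ?s \<and>
        measure_pmf.prob (run w \<tau> t (eccentricities kc) ?s) ?A \<ge> 1 - 1 / real n powr c"
      using prob ensures_halts[OF main] by (intro exI[of _ total_time]) simp
  qed
qed

end
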